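(* Let $\mathbf{t}=(\psi_0;(\phi_1,\lambda_1,\psi_1);\dots;(\phi_{r-1},\lambda_{r-1},\psi_{r-1}))$ be a type over $\mathcal{O}_{\mathfrak p}$, of order $r-1\ge 0$, and let $\phi_r$ be a representative of $\mathbf{t}$. Suppose that $\mathbf{t}\mid f(x)$ and that all polynomials $\phi_1,\dots,\phi_r$ have coefficients in $A$. For any integer $1\le s\le \ell(N_r^-(f))$, let $Q_s(x)$ be the $s$-th $\phi_r$-quotient of $f(x)$, and let $y_s\in\mathbb{Q}$ be determined by $(s,y_s)\in N_r^-(f)$. Then, for every prime ideal $\mathfrak P$ of $B$ lying over $\mathfrak p$, $$w_{\mathfrak P}(Q_s(\theta))\ \ge\ H_s:=\frac{y_s-sV_r}{e_0e_1\cdots e_{r-1}}.$$ In particular, $Q_s(\theta)/\pi^{\lfloor H_s\rfloor}$ is $\mathfrak p$-integral.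
   Context: Global setting. $A$ is a Dedekind domain whose field of fractions $K$ is a global field; $f(x)\in A[x]$ is monic, irreducible and separable of degree $n>1$; $\theta\in K^{\rm sep}$ is a root of $f$; $L=K(\theta)$; $B$ is the integral closure of $A$ in $L$. $\mathfrak p$ is a non-zero prime ideal of $A$, $\pi\in A$ a generator of the maximal ideal of the localization $A_{\mathfrak p}$, $K_{\mathfrak p}$ the completion of $K$ at $\mathfrak p$, $\mathcal{O}_{\mathfrak p}$ its valuation ring. An element $\alpha\in L$ is $\mathfrak p$-integral if $v_{\mathfrak P}(\alpha)\ge 0$ for all primes $\mathfrak P\mid\mathfrak p$ of $B$. For $\mathfrak P\mid\mathfrak p$, $w_{\mathfrak P}:=e(\mathfrak P/\mathfrak p)^{-1}v_{\mathfrak P}$, where $v_{\mathfrak P}$ is the normalized discrete valuation of $L$ attached to $\mathfrak P$. Quotients. For a monic $\phi\in A[x]$ of positive degree, the $s$-th $\phi$-quotient $Q_s(x)$ of $f$ is the quotient of the division with remainder of $f(x)$ by $\phi(x)^s$. The $\phi$-expansion of a polynomial $g$ is $g=\sum_{s\ge0}a_s\phi^s$ with $\deg a_s<\deg\phi$. Types. Let $k=K_{\mathfrak p}$, with normalized valuation $v$, valuation ring $\mathcal{O}=\mathcal O_{\mathfrak p}$, uniformizer $\pi$, residue field $\mathbb{F}=\mathbb F_0$. The symbol $\sim$ means equality up to a non-zero constant factor. A type of order $0$ is $\mathbf t=(\psi_0)$ with $\psi_0\in\mathbb F[y]$ monic irreducible. Put $e_0=1$, $h_0=V_0=0$, $m_0=1$,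 $f_0=m_1=\deg\psi_0$, $\mathbb F_1=\mathbb F[y]/(\psi_0)$, $z_0$ = class of $y$; $v_1(g)$ is the minimum of the $v$-values of the coefficients of $g\in k[x]$; $R_0(g)\in\mathbb F[y]$ is the reduction of $g/\pi^{v_1(g)}$. Recursively, a type of order $i\ge1$ is $\mathbf t=(\psi_0;(\phi_1,\lambda_1,\psi_1);\dots;(\phi_i,\lambda_i,\psi_i))$, where dropping the last level gives a type of order $i-1$, $\phi_i$ is a representative of that type of order $i-1$, $\lambda_i=-h_i/e_i$ with $h_i,e_i$ positive coprime integers, and $\psi_i\in\mathbb F_i[y]$ is monic irreducible, $\psi_i\ne y$. A representative of a type of order $i-1$ is a monic $\phi_i\in\mathcal O[x]$ of degree $m_i$ with $R_{i-1}(\phi_i)\sim\psi_{i-1}$. Given a type of order $i-1$ and a representative $\phi_i$: (1) For $0\ne g\in k[x]$ with $\phi_i$-expansion $g=\sum_s a_s\phi_i^s$, $N_i(g)$ is the lower convex hull of the points $(s,v_i(a_s\phi_i^s))$ and $N_i^-(g)$ is its part formed by the sides of negative slope (only the left end point if there are none). The length $\ell(N)$ of a polygon is the abscissa of its right end point. (2) For $\lambda=-h/e<0$ ($h,e$ positive coprime), the $\lambda$-component of a polygon $N$ is $\{(x,y)\in N: y-\lambda x \text{ minimal}\}$. For $s$ in the abscissa range of $N_i^-(g)$ put $c_s=0$ if $(s,v_i(a_s\phi_i^s))$ lies above $N_i^-(g)$, and $c_s=z_{i-1}^{t_{i-1}(s)}R_{i-1}(a_s)(z_{i-1})\in\mathbb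 F_i$ if it lies on $N_i^-(g)$, where $t_0(s)=0$ and, for $i>1$, $t_{i-1}(s)=(\sigma-\ell_{i-1}v_i(a_s\phi_i^s))/e_{i-1}$ with $\sigma$ the abscissa of the left end point of the $\lambda_{i-1}$-component of $N_{i-1}(a_s)$. If the $\lambda$-component of $N_i(g)$ has left end abscissa $s_0$ and its projection has length $de$, then $R_{\lambda,i}(g)(y)=\sum_{0\le j\le d}c_{s_0+je}\,y^j\in\mathbb F_i[y]$. (3) Given also $\lambda_i,\psi_i$: $R_i=R_{\lambda_i,i}$, $f_i=\deg\psi_i$, $m_{i+1}=e_if_im_i$, $\mathbb F_{i+1}=\mathbb F_i[y]/(\psi_i)$, $z_i$ = class of $y$, $\ell_i,\ell_i'$ are fixed integers with $\ell_ih_i-\ell_i'e_i=1$, and $v_{i+1}$ is the valuation of $k(x)$ given on polynomials by $v_{i+1}(g)=\min_s\{e_iv_i(a_s\phi_i^s)+sh_i\}$. Put $V_i:=v_i(\phi_i)$. For a type $\mathbf t$ of order $i$, $\operatorname{ord}_{\mathbf t}(g)$ is the exponent of $\psi_i$ in $R_i(g)$, and $\mathbf t\mid g$ means $\operatorname{ord}_{\mathbf t}(g)>0$. *)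

theory Defs
  imports
    "HOL-Analysis.Convex"
    "HOL-Library.Extended_Real"
    "HOL-Computational_Algebra.Computational_Algebra"
    "HOL-Algebra.Ideal_Product"
    "HOL-Algebra.Generated_Fields"
    "HOL-Algebra.Algebraic_Closure_Type"
begin

section \<open>Subrings of a field and polynomials over them\<close>

text \<open>Fields are types of class \<open>field\<close>; a subring of a field is viewed as a ring of HOL-Algebra by
  restricting the carrier.\<close>

definition ring_on :: "'a::field set \<Rightarrow> 'a ring" where
  "ring_on D = ring_of_type_algebra\<lparr>carrier := D\<rparr>"

definition field_embedding :: "('a::field \<Rightarrow> 'b::field) \<Rightarrow> bool" where
  "field_embedding j \<longleftrightarrow> j \<in> ring_hom ring_of_type_algebra ring_of_type_algebra"

definition poly_over :: "'a::field set \<Rightarrow> 'a poly set" where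
  "poly_over D = {p. set (coeffs p) \<subseteq> D}"

definition monic :: "'a::field poly \<Rightarrow> bool" where
  "monic p \<longleftrightarrow> Polynomial.lead_coeff p = 1"

text \<open>Irreducible elements of the ring \<open>D[x]\<close>, where \<open>D\<close> is a subring of a field.\<close>

definition unit_in :: "'a::field set \<Rightarrow> 'a poly \<Rightarrow> bool" where
  "unit_in D p \<longleftrightarrow> p \<in> poly_over D \<and> (\<exists>q\<in>poly_over D. p * q = 1)"

definition irreducible_in :: "'a::field set \<Rightarrow> 'a poly \<Rightarrow> bool" where
  "irreducible_in D p \<longleftrightarrow> p \<in> poly_over D \<and> p \<noteq> 0 \<and> \<not> unit_in D p \<and>
     (\<forall>g\<in>poly_over D. \<forall>h\<in>poly_over D. p = g * h \<longrightarrow> unit_in D g \<or> unit_in D h)"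

definition integral_closure :: "'a::field set \<Rightarrow> 'a set" where
  "integral_closure D = {x. \<exists>p\<in>poly_over D. monic p \<and> poly p x = 0}"

lemma ring_of_type_simps [simp]:
  "carrier (ring_of_type_algebra :: 'a::field ring) = UNIV"
  "monoid.mult (ring_of_type_algebra :: 'a ring) = (*)"
  "one (ring_of_type_algebra :: 'a ring) = 1"
  "ring.zero (ring_of_type_algebra :: 'a ring) = 0"
  "add (ring_of_type_algebra :: 'a ring) = (+)"
  by (auto simp: ring_of_type_algebra_def)

lemma subfield_closed:
  fixes D :: "'a::field set"
  assumes "subfield D ring_of_type_algebra"
  shows "0 \<in> D" "1 \<in> D" "x \<in> D \<Longrightarrow> x' \<in> D \<Longrightarrow> x + x' \<in> D" "x \<in> D \<Longrightarrow> x' \<in> D \<Longrightarrow> x * x' \<in> D"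
    "x \<in> D \<Longrightarrow> - x \<in> D" "x \<in> D \<Longrightarrow> inverse x \<in> D"
proof -
  interpret R: field "ring_of_type_algebra :: 'a ring" by (rule field_from_type_algebra)
  interpret subfield D "ring_of_type_algebra :: 'a ring" by (rule assms)
  show z: "0 \<in> D" and "1 \<in> D" and "x \<in> D \<Longrightarrow> x' \<in> D \<Longrightarrow> x + x' \<in> D"
    and m: "x \<in> D \<Longrightarrow> x' \<in> D \<Longrightarrow> x * x' \<in> D"
    using R.subring_props(2,3,5,6,7)[OF assms] by auto
  have neg: "a_inv (ring_of_type_algebra :: 'a ring) x = - x" for x
    by (rule R.minus_equality) auto
  show "x \<in> D \<Longrightarrow> - x \<in> D" using R.subring_props(5)[OF assms, of x] neg by simp
  show "inverse x \<in> D" if x: "x \<in> D"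
  proof (cases "x = 0")
    case False
    then have "m_inv (ring_of_type_algebra :: 'a ring) x \<in> D"
      using R.subfield_m_inv(1)[OF assms, of x] x by auto
    moreover have "m_inv (ring_of_type_algebra :: 'a ring) x = inverse x"
      using R.subfield_m_inv(2)[OF assms, of x] x False
      by (metis Diff_iff inverse_unique ring_of_type_simps(2,3,4) singletonD)
    ultimately show ?thesis by simp
  qed (use z in auto)
qed

lemma poly_over_iff: "0 \<in> D \<Longrightarrow> p \<in> poly_over D \<longleftrightarrow> (\<forall>n. Polynomial.coeff p n \<in> D)"
proof -
  assume "0 \<in> D"
  moreover have "set (coeffs p) \<subseteq> D \<and> 0 \<in> D \<longleftrightarrow> range (Polynomial.coeff p) \<subseteq> D"
    by (auto simp: range_coeff)
  ultimately show ?thesis unfolding poly_over_def by (simp add: image_subset_iff)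
qed

lemma poly_over_closed:
  fixes D :: "'a::field set"
  assumes D: "subfield D ring_of_type_algebra" and "g \<in> poly_over D" "h \<in> poly_over D"
  shows "g + h \<in> poly_over D" "g - h \<in> poly_over D" "g * h \<in> poly_over D"
proof -
  note c = subfield_closed[OF D]
  have gh: "Polynomial.coeff g n \<in> D" "Polynomial.coeff h n \<in> D" for n
    using assms c(1) by (auto simp: poly_over_iff)
  have sum: "(\<And>i. i \<in> I \<Longrightarrow> u i \<in> D) \<Longrightarrow> sum u I \<in> D" for u :: "nat \<Rightarrow> 'a" and I
    by (induction I rule: infinite_finite_induct) (auto intro: c)
  have d: "x - x' \<in> D" if "x \<in> D" "x' \<in> D" for x x'
    using c(3)[OF that(1) c(5)[OF that(2)]] by simp
  show "g + h \<in> poly_over D" "g - h \<in> poly_over D" "g * h \<in> poly_over D"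
    using gh by (auto simp: poly_over_iff c(1) coeff_mult intro!: sum c d)
qed

lemma poly_over_division:
  fixes D :: "'a::field set"
  assumes D: "subfield D ring_of_type_algebra" and m: "m \<in> poly_over D" "m \<noteq> 0"
  shows "g \<in> poly_over D \<Longrightarrow>
    \<exists>q\<in>poly_over D. \<exists>r\<in>poly_over D. g = m * q + r \<and> (r = 0 \<or> Polynomial.degree r < Polynomial.degree m)"
proof (induction "Polynomial.degree g" arbitrary: g rule: less_induct)
  case less
  note c = subfield_closed[OF D]
  have 0: "(0 :: 'a poly) \<in> poly_over D" by (simp add: poly_over_def)
  show ?case
  proof (cases "g = 0 \<or> Polynomial.degree g < Polynomial.degree m")
    case True
    then show ?thesis using 0 less.prems by (intro bexI[of _ 0] bexI[of _ g]) auto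
  next
    case False
    define k where "k = Polynomial.degree g - Polynomial.degree m"
    define t where "t = Polynomial.monom (Polynomial.lead_coeff g * inverse (Polynomial.lead_coeff m)) k"
    have t: "t \<in> poly_over D"
      using less.prems m c by (auto simp: t_def poly_over_iff)
    have tn: "t \<noteq> 0" using False m by (auto simp: t_def)
    have dt: "Polynomial.degree (m * t) = Polynomial.degree g"
    proof -
      have "Polynomial.lead_coeff g * inverse (Polynomial.lead_coeff m) \<noteq> 0" using False m by auto
      then have "Polynomial.degree t = k" unfolding t_def by (rule degree_monom_eq)
      then show ?thesis using False m tn by (auto simp: degree_mult_eq k_def)
    qed
    have lt: "Polynomial.lead_coeff (m * t) = Polynomial.lead_coeff g"
    proof -
      have "Polynomial.lead_coeff t = Polynomial.lead_coeff g * inverse (Polynomial.lead_coeff m)"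
        unfolding t_def by (rule lead_coeff_monom)
      then show ?thesis using m by (simp only: lead_coeff_mult) simp
    qed
    let ?g = "g - m * t"
    have g': "?g \<in> poly_over D" using less.prems m t by (intro poly_over_closed[OF D])
    show ?thesis
    proof (cases "?g = 0")
      case True
      then show ?thesis using 0 t by (intro bexI[of _ t] bexI[of _ 0]) auto
    next
      case ne: False
      show ?thesis
      proof (cases "Polynomial.degree g = 0")
        case True
        with dt lt have "?g = 0"
          by (metis degree_eq_zeroE diff_self lead_coeff_pCons(2) pCons_0_0)
        with ne show ?thesis by simp
      next
        case pos: False
        have "Polynomial.degree ?g < Polynomial.degree g"
        proof -
          have "Polynomial.degree ?g \<le> Polynomial.degree g" using dt by (metis degree_diff_le order_refl)
          moreover have "Polynomial.coeff ?g (Polynomial.degree g) = 0" using dt lt by simp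
          ultimately show ?thesis using ne
            by (metis leading_coeff_0_iff le_neq_implies_less)
        qed
        from less.hyps[OF this g'] obtain q r where qr: "q \<in> poly_over D" "r \<in> poly_over D"
          "?g = m * q + r" "r = 0 \<or> Polynomial.degree r < Polynomial.degree m" by blast
        from qr(3) have "g = m * (q + t) + r" by (simp add: algebra_simps)
        with qr show ?thesis using poly_over_closed(1)[OF D qr(1) t] by blast
      qed
    qed
  qed
qed

text \<open>Evaluation at a root \<open>z\<close> of an irreducible polynomial \<open>\<psi>\<close> over \<open>D\<close> has kernel generated by
  \<open>\<psi>\<close>; hence it induces an isomorphism of \<open>D[y]/(\<psi>)\<close> with the ring of values of polynomials over
  \<open>D\<close> at \<open>z\<close>.\<close>

lemma poly_root_iff_dvd:
  fixes D :: "'a::field set"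
  assumes D: "subfield D ring_of_type_algebra" and \<psi>: "irreducible_in D \<psi>" "poly \<psi> z = 0"
    and g: "g \<in> poly_over D"
  shows "poly g z = 0 \<longleftrightarrow> (\<exists>h\<in>poly_over D. g = \<psi> * h)"
proof
  assume gz: "poly g z = 0"
  define P where "P = (\<lambda>m. m \<in> poly_over D \<and> m \<noteq> 0 \<and> poly m z = 0)"
  have "P \<psi>" using \<psi> by (auto simp: P_def irreducible_in_def)
  then obtain m where m: "P m" and min: "\<And>m'. P m' \<Longrightarrow> Polynomial.degree m \<le> Polynomial.degree m'"
    using ex_has_least_nat[of P \<psi> Polynomial.degree] by auto
  have dvd: "\<exists>q\<in>poly_over D. k = m * q" if k: "k \<in> poly_over D" "poly k z = 0" for k
  proof -
    obtain q r where qr: "q \<in> poly_over D" "r \<in> poly_over D" "k = m * q + r"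
      "r = 0 \<or> Polynomial.degree r < Polynomial.degree m"
      using poly_over_division[OF D _ _ k(1), of m] m by (auto simp: P_def)
    have "poly r z = 0" using k(2) m qr(3) by (simp add: P_def)
    then have "r = 0" using qr(2,4) min[of r] unfolding P_def by (metis not_le)
    with qr show ?thesis by auto
  qed
  obtain q where q: "q \<in> poly_over D" "\<psi> = m * q"
    using dvd[of \<psi>] \<psi> unfolding irreducible_in_def by metis
  have "\<not> unit_in D m"
  proof
    assume "unit_in D m"
    then obtain u where "m * u = 1" by (auto simp: unit_in_def)
    then have "poly m z * poly u z = 1" by (metis poly_1 poly_mult)
    with m show False by (simp add: P_def)
  qed
  moreover have "m \<in> poly_over D" using m by (simp add: P_def)
  ultimately have "unit_in D q" using \<psi>(1) q unfolding irreducible_in_def by metis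
  then obtain u where u: "u \<in> poly_over D" "q * u = 1" unfolding unit_in_def by metis
  obtain h where h: "h \<in> poly_over D" "g = m * h" using dvd[OF g gz] by blast
  have "g = \<psi> * (u * h)" using h q u by (metis mult.assoc mult.right_neutral)
  then show "\<exists>h\<in>poly_over D. g = \<psi> * h" using poly_over_closed(3)[OF D u(1) h(1)] by blast
qed (use \<psi> in auto)

section \<open>Dedekind domains, global fields, valuations\<close>

text \<open>\<open>A\<close> is a Dedekind domain whose field of fractions is the whole type.\<close>

definition dedekind_domain :: "'a::field set \<Rightarrow> bool" where
  "dedekind_domain A \<longleftrightarrow>
     noetherian_domain (ring_on A) \<and>
     (\<forall>x. \<exists>a\<in>A. \<exists>b\<in>A. b \<noteq> 0 \<and> x = a / b) \<and>
     integral_closure A \<subseteq> A \<and>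
     (\<forall>P. primeideal P (ring_on A) \<and> P \<noteq> {0} \<longrightarrow> maximalideal P (ring_on A))"

text \<open>A finite extension of the prime field in characteristic 0, or of a field \<open>F(t)\<close> of rational
  functions over a finite field \<open>F\<close>.\<close>

definition global_field :: "'a::field itself \<Rightarrow> bool" where
  "global_field _ \<longleftrightarrow> (let K = (ring_of_type_algebra :: 'a ring) in
     (CHAR('a) = 0 \<and> ring.finite_dimension K (generate_field K {}) (carrier K)) \<or>
     (\<exists>F t. subfield F K \<and> finite F \<and> ring.transcendental K F t \<and>
        ring.finite_dimension K (generate_field K (insert t F)) (carrier K)))"

definition ideal_power :: "'a::field set \<Rightarrow> 'a set \<Rightarrow> nat \<Rightarrow> 'a set" where
  "ideal_power D P n = P [^]\<^bsub>ideals_set (ring_on D)\<^esub> n"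

definition ideal_ord :: "'a::field set \<Rightarrow> 'a set \<Rightarrow> 'a \<Rightarrow> nat" where
  "ideal_ord D P a = (GREATEST n. a \<in> ideal_power D P n)"

text \<open>The normalized discrete valuation \<open>v\<^sub>P\<close> on the field of fractions of the Dedekind domain
  \<open>D\<close>, for a non-zero prime ideal \<open>P\<close> of \<open>D\<close>; the value at 0 is infinite.\<close>

definition prime_val :: "'a::field set \<Rightarrow> 'a set \<Rightarrow> 'a \<Rightarrow> ereal" where
  "prime_val D P x = (if x = 0 then \<infinity> else
     ereal (real_of_int (THE n. \<exists>a\<in>D. \<exists>b\<in>D. a \<noteq> 0 \<and> b \<noteq> 0 \<and> x = a / b \<and>
        n = int (ideal_ord D P a) - int (ideal_ord D P b))))"

text \<open>\<open>x\<close> generates the maximal ideal of the localization of \<open>A\<close> at \<open>p\<close>.\<close>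

definition generates_local_maxideal :: "'a::field set \<Rightarrow> 'a set \<Rightarrow> 'a \<Rightarrow> bool" where
  "generates_local_maxideal A p x \<longleftrightarrow>
     {x * (a / b) | a b. a \<in> A \<and> b \<in> A - p} = {a / b | a b. a \<in> p \<and> b \<in> A - p}"

text \<open>In the following, \<open>j\<close> embeds the field of fractions of \<open>A\<close> into the extension field
  \<open>L\<close> (the type \<open>'l\<close>), and \<open>B\<close> is the integral closure of \<open>A\<close> in \<open>L\<close>.\<close>

definition primes_over :: "'k::field set \<Rightarrow> 'k set \<Rightarrow> ('k \<Rightarrow> 'l::field) \<Rightarrow> 'l set \<Rightarrow> 'l set set" where
  "primes_over A p j B = {P. primeideal P (ring_on B) \<and> {a\<in>A. j a \<in> P} = p}"

definition ramification_index :: "'k::field set \<Rightarrow> ('k \<Rightarrow> 'l::field) \<Rightarrow> 'l set \<Rightarrow> 'l set \<Rightarrow> nat" where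
  "ramification_index p j B P = (GREATEST n. genideal (ring_on B) (j ` p) \<subseteq> ideal_power B P n)"

definition w_val :: "'k::field set \<Rightarrow> ('k \<Rightarrow> 'l::field) \<Rightarrow> 'l set \<Rightarrow> 'l set \<Rightarrow> 'l \<Rightarrow> ereal" where
  "w_val p j B P \<alpha> = prime_val B P \<alpha> / ereal (real (ramification_index p j B P))"

definition p_integral :: "'k::field set \<Rightarrow> 'k set \<Rightarrow> ('k \<Rightarrow> 'l::field) \<Rightarrow> 'l set \<Rightarrow> 'l \<Rightarrow> bool" where
  "p_integral A p j B \<alpha> \<longleftrightarrow> (\<forall>P\<in>primes_over A p j B. 0 \<le> prime_val B P \<alpha>)"

definition generated_by_root :: "('k::field \<Rightarrow> 'l::field) \<Rightarrow> 'l \<Rightarrow> bool" where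
  "generated_by_root j \<theta> \<longleftrightarrow>
     (\<forall>x. \<exists>g h. poly (map_poly j h) \<theta> \<noteq> 0 \<and> x = poly (map_poly j g) \<theta> / poly (map_poly j h) \<theta>)"

subsection \<open>Discretely valued fields and completions\<close>

text \<open>The value \<open>v 0\<close> of an integer-valued valuation is irrelevant (it stands for infinity).\<close>

definition discrete_valuation :: "('a::field \<Rightarrow> int) \<Rightarrow> bool" where
  "discrete_valuation v \<longleftrightarrow>
     (\<forall>x y. x \<noteq> 0 \<and> y \<noteq> 0 \<longrightarrow> v (x * y) = v x + v y) \<and>
     (\<forall>x y. x \<noteq> 0 \<and> y \<noteq> 0 \<and> x + y \<noteq> 0 \<longrightarrow> min (v x) (v y) \<le> v (x + y)) \<and>
     (\<exists>x. x \<noteq> 0 \<and> v x = 1)"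

definition valuation_ring :: "('a::field \<Rightarrow> int) \<Rightarrow> 'a set" where
  "valuation_ring v = {x. x = 0 \<or> 0 \<le> v x}"

definition maximal_ideal :: "('a::field \<Rightarrow> int) \<Rightarrow> 'a set" where
  "maximal_ideal v = {x. x = 0 \<or> 0 < v x}"

definition close :: "('a::field \<Rightarrow> int) \<Rightarrow> int \<Rightarrow> 'a \<Rightarrow> 'a \<Rightarrow> bool" where
  "close v N x y \<longleftrightarrow> x = y \<or> N \<le> v (x - y)"

text \<open>\<open>\<iota>\<close> exhibits the valued field with valuation \<open>v\<close> as the completion at \<open>p\<close>
  of the field of fractions of \<open>A\<close>: \<open>v\<close> extends the \<open>p\<close>-adic valuation, the
  image of \<open>\<iota>\<close> is dense, and Cauchy sequences converge.\<close>

definition is_completion ::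
  "'k::field set \<Rightarrow> 'k set \<Rightarrow> ('k \<Rightarrow> 'c::field) \<Rightarrow> ('c \<Rightarrow> int) \<Rightarrow> bool" where
  "is_completion A p \<iota> v \<longleftrightarrow>
     field_embedding \<iota> \<and> discrete_valuation v \<and>
     (\<forall>x. x \<noteq> 0 \<longrightarrow> ereal (real_of_int (v (\<iota> x))) = prime_val A p x) \<and>
     (\<forall>x N. \<exists>y. close v N x (\<iota> y)) \<and>
     (\<forall>u::nat \<Rightarrow> 'c. (\<forall>N. \<exists>M. \<forall>m\<ge>M. \<forall>n\<ge>M. close v N (u m) (u n)) \<longrightarrow>
        (\<exists>x. \<forall>N. \<exists>M. \<forall>n\<ge>M. close v N (u n) x))"

section \<open>Quotients and expansions\<close>

definition phi_quotient :: "'a::field poly \<Rightarrow> 'a poly \<Rightarrow> nat \<Rightarrow> 'a poly" where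
  "phi_quotient \<phi> f s = f div \<phi> ^ s"

definition phi_coeff :: "'a::field poly \<Rightarrow> 'a poly \<Rightarrow> nat \<Rightarrow> 'a poly" where
  "phi_coeff \<phi> g s = (g div \<phi> ^ s) mod \<phi>"

lemma phi_coeff_degree:
  assumes "Polynomial.degree \<phi> > 0"
  shows "Polynomial.degree (phi_coeff \<phi> g s) < Polynomial.degree \<phi>"
proof -
  have "\<phi> \<noteq> 0" using assms by auto
  then show ?thesis using assms degree_mod_less[of \<phi> "g div \<phi> ^ s"] by (auto simp: phi_coeff_def)
qed

lemma phi_expansion_partial:
  "g = (\<Sum>s<n. phi_coeff \<phi> g s * \<phi> ^ s) + (g div \<phi> ^ n) * \<phi> ^ n"
proof (induction n)
  case (Suc n)
  have "g div \<phi> ^ n = (g div \<phi> ^ Suc n) * \<phi> + phi_coeff \<phi> g n"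
    unfolding phi_coeff_def power_Suc2
    by (metis div_mult_mod_eq poly_div_mult_right)
  then have "(g div \<phi> ^ n) * \<phi> ^ n = phi_coeff \<phi> g n * \<phi> ^ n + (g div \<phi> ^ Suc n) * \<phi> ^ Suc n"
    by (simp add: distrib_right mult.assoc)
  with Suc show ?case by (simp add: algebra_simps)
qed simp

lemma div_power_eq_0:
  fixes \<phi> g :: "'a::field poly"
  assumes "Polynomial.degree \<phi> > 0" and "Polynomial.degree g < s"
  shows "g div \<phi> ^ s = 0"
proof -
  have "\<phi> \<noteq> 0" using assms(1) by auto
  then have "Polynomial.degree (\<phi> ^ s) = s * Polynomial.degree \<phi>" by (simp add: degree_power_eq)
  moreover have "s \<le> s * Polynomial.degree \<phi>" using assms(1) by simp
  ultimately have "Polynomial.degree g < Polynomial.degree (\<phi> ^ s)" using assms(2) by linarith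
  then show ?thesis by (rule div_poly_less)
qed

lemma phi_coeff_eq_0:
  "Polynomial.degree \<phi> > 0 \<Longrightarrow> Polynomial.degree g < s \<Longrightarrow> phi_coeff \<phi> g s = 0"
  by (simp add: phi_coeff_def div_power_eq_0)

lemma phi_expansion:
  assumes "Polynomial.degree \<phi> > 0"
  shows "g = (\<Sum>s\<le>Polynomial.degree g. phi_coeff \<phi> g s * \<phi> ^ s)"
  using phi_expansion_partial[of g \<phi> "Suc (Polynomial.degree g)"]
    div_power_eq_0[OF assms, of g "Suc (Polynomial.degree g)"]
  by (simp add: lessThan_Suc_atMost)

section \<open>Newton polygons\<close>

text \<open>Polygons are subsets of the plane; all of them have compact image under the first
  projection.\<close>

definition lower_hull :: "(real \<times> real) set \<Rightarrow> (real \<times> real) set" where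
  "lower_hull S = {(x, y). (x, y) \<in> convex hull S \<and> (\<forall>y'. (x, y') \<in> convex hull S \<longrightarrow> y \<le> y')}"

definition left_abscissa :: "(real \<times> real) set \<Rightarrow> real" where
  "left_abscissa N = Inf (fst ` N)"

definition right_abscissa :: "(real \<times> real) set \<Rightarrow> real" where
  "right_abscissa N = Sup (fst ` N)"

text \<open>The length of a polygon is by convention its right abscissa.\<close>

abbreviation polygon_length :: "(real \<times> real) set \<Rightarrow> real" where
  "polygon_length N \<equiv> right_abscissa N"

definition component :: "real \<Rightarrow> (real \<times> real) set \<Rightarrow> (real \<times> real) set" where
  "component \<mu> N = {(x, y). (x, y) \<in> N \<and> (\<forall>(x', y')\<in>N. y - \<mu> * x \<le> y' - \<mu> * x')}"

text \<open>The sides of slope \<open>\<mu>\<close> are the \<open>\<mu>\<close>-components that are not a single point.\<close>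

definition neg_part :: "(real \<times> real) set \<Rightarrow> (real \<times> real) set" where
  "neg_part N = {q\<in>N. fst q = left_abscissa N} \<union>
     \<Union>{component \<mu> N | \<mu>. \<mu> < 0 \<and> left_abscissa (component \<mu> N) < right_abscissa (component \<mu> N)}"

section \<open>Types\<close>

text \<open>A type over the valuation ring of a discretely valued field \<open>'c\<close>, together with the
  auxiliary choices on which the attached operators depend. Level \<open>i\<close> consists of
  \<open>t_phi i\<close>, the slope \<open>- t_h i / t_e i\<close> and \<open>t_psi i\<close> (for \<open>i = 0\<close> only
  \<open>t_psi 0\<close>); entries beyond the order of the type are ignored.

  All the finite fields attached to a type are realized as subfields of a field \<open>'w\<close>: the map
  \<open>t_red\<close> identifies the residue field with a subfield of \<open>'w\<close>, and \<open>t_z i\<close> is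
  a root of \<open>t_psi i\<close> in \<open>'w\<close>, so that \<open>F\<^sub>i[y]/(\<psi>\<^sub>i)\<close> is identified with
  \<open>F\<^sub>i[z\<^sub>i]\<close> by mapping the class of \<open>y\<close> to \<open>z\<^sub>i\<close>
  (lemma \<open>poly_root_iff_dvd\<close> above).\<close>

record (overloaded) ('c::zero, 'w::zero) type_data =
  t_val :: "'c \<Rightarrow> int"
  t_unif :: 'c
  t_red :: "'c \<Rightarrow> 'w"
  t_phi :: "nat \<Rightarrow> 'c poly"
  t_h :: "nat \<Rightarrow> nat"
  t_e :: "nat \<Rightarrow> nat"
  t_psi :: "nat \<Rightarrow> 'w poly"
  t_z :: "nat \<Rightarrow> 'w"
  t_l :: "nat \<Rightarrow> int"
  t_l' :: "nat \<Rightarrow> int"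

definition local_data :: "('c::field, 'w::field) type_data \<Rightarrow> bool" where
  "local_data T \<longleftrightarrow> (let O\<^sub>v = valuation_ring (t_val T) in
     discrete_valuation (t_val T) \<and> t_unif T \<noteq> 0 \<and> t_val T (t_unif T) = 1 \<and>
     t_red T \<in> ring_hom (ring_on O\<^sub>v) ring_of_type_algebra \<and>
     {x\<in>O\<^sub>v. t_red T x = 0} = maximal_ideal (t_val T))"

text \<open>The invariants \<open>e\<^sub>i\<close>, \<open>m\<^sub>i\<close>, \<open>\<lambda>\<^sub>i\<close>, \<open>F\<^sub>i\<close>, with \<open>e\<^sub>0 = m\<^sub>0 = 1\<close>.\<close>

definition ram :: "('c::field, 'w::field) type_data \<Rightarrow> nat \<Rightarrow> nat" where
  "ram T i = (if i = 0 then 1 else t_e T i)"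

primrec mdeg :: "('c::field, 'w::field) type_data \<Rightarrow> nat \<Rightarrow> nat" where
  "mdeg T 0 = 1"
| "mdeg T (Suc i) = ram T i * Polynomial.degree (t_psi T i) * mdeg T i"

definition slope :: "('c::field, 'w::field) type_data \<Rightarrow> nat \<Rightarrow> real" where
  "slope T i = - real (t_h T i) / real (t_e T i)"

primrec res_field :: "('c::field, 'w::field) type_data \<Rightarrow> nat \<Rightarrow> 'w set" where
  "res_field T 0 = t_red T ` valuation_ring (t_val T)"
| "res_field T (Suc i) = {poly g (t_z T i) | g. g \<in> poly_over (res_field T i)}"

text \<open>The valuations \<open>v\<^sub>i\<close>, \<open>i \<ge> 1\<close>, on non-zero polynomials; the values at index 0 and at
  the zero polynomial are never used.\<close>

definition gauss_val :: "('c::field \<Rightarrow> int) \<Rightarrow> 'c poly \<Rightarrow> int" where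
  "gauss_val v g = Min (v ` {c \<in> set (coeffs g). c \<noteq> 0})"

primrec tv :: "('c::field, 'w::field) type_data \<Rightarrow> nat \<Rightarrow> 'c poly \<Rightarrow> int" where
  "tv T 0 = (\<lambda>g. 0)"
| "tv T (Suc i) = (if i = 0 then gauss_val (t_val T) else
     (\<lambda>g. Min {int (t_e T i) * tv T i (phi_coeff (t_phi T i) g s * t_phi T i ^ s) + int s * int (t_h T i)
          | s. phi_coeff (t_phi T i) g s \<noteq> 0}))"

text \<open>The numbers \<open>V\<^sub>i\<close>.\<close>

definition phi_val :: "('c::field, 'w::field) type_data \<Rightarrow> nat \<Rightarrow> int" where
  "phi_val T i = (if i = 0 then 0 else tv T i (t_phi T i))"

definition newton_point :: "('c::field, 'w::field) type_data \<Rightarrow> nat \<Rightarrow> 'c poly \<Rightarrow> nat \<Rightarrow> real \<times> real" where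
  "newton_point T i g s =
     (real s, real_of_int (tv T i (phi_coeff (t_phi T i) g s * t_phi T i ^ s)))"

definition NP :: "('c::field, 'w::field) type_data \<Rightarrow> nat \<Rightarrow> 'c poly \<Rightarrow> (real \<times> real) set" where
  "NP T i g = lower_hull (newton_point T i g ` {s. phi_coeff (t_phi T i) g s \<noteq> 0})"

definition NP_neg :: "('c::field, 'w::field) type_data \<Rightarrow> nat \<Rightarrow> 'c poly \<Rightarrow> (real \<times> real) set" where
  "NP_neg T i g = neg_part (NP T i g)"

definition slope_component :: "('c::field, 'w::field) type_data \<Rightarrow> nat \<Rightarrow> 'c poly \<Rightarrow> (real \<times> real) set" where
  "slope_component T i g = component (slope T i) (NP T i g)"

text \<open>The end points of a component have integral abscissas, and the length of its projection is a
  multiple of \<open>t_e T i\<close>, so the roundings are harmless. The same holds for the division by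
  \<open>t_e T i\<close> in the exponent \<open>t\<^sub>i(s)\<close> below.\<close>

definition comp_start :: "('c::field, 'w::field) type_data \<Rightarrow> nat \<Rightarrow> 'c poly \<Rightarrow> nat" where
  "comp_start T i g = nat \<lfloor>left_abscissa (slope_component T i g)\<rfloor>"

definition comp_degree :: "('c::field, 'w::field) type_data \<Rightarrow> nat \<Rightarrow> 'c poly \<Rightarrow> nat" where
  "comp_degree T i g =
     nat \<lfloor>(right_abscissa (slope_component T i g) - left_abscissa (slope_component T i g)) / real (t_e T i)\<rfloor>"

text \<open>\<open>t\<^sub>i(s)\<close>, which refers to the coefficient and the valuation of level \<open>i + 1\<close>.\<close>

definition z_exp :: "('c::field, 'w::field) type_data \<Rightarrow> nat \<Rightarrow> 'c poly \<Rightarrow> nat \<Rightarrow> int" where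
  "z_exp T i g s = (if i = 0 then 0 else
     (let a = phi_coeff (t_phi T (Suc i)) g s in
      (int (comp_start T i a) - t_l T i * tv T (Suc i) (a * t_phi T (Suc i) ^ s)) div int (t_e T i)))"

definition res_coeff ::
  "('c::field, 'w::field) type_data \<Rightarrow> nat \<Rightarrow> ('c poly \<Rightarrow> 'w poly) \<Rightarrow> 'c poly \<Rightarrow> nat \<Rightarrow> 'w" where
  "res_coeff T i R g s = (let a = phi_coeff (t_phi T (Suc i)) g s in
     if a \<noteq> 0 \<and> newton_point T (Suc i) g s \<in> NP_neg T (Suc i) g
     then t_z T i powi z_exp T i g s * poly (R a) (t_z T i) else 0)"

text \<open>The residual polynomials \<open>R\<^sub>i\<close>; in \<open>res_coeff\<close>, the parameter \<open>R\<close> stands for \<open>R\<^sub>i\<close>.\<close>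

primrec respol :: "('c::field, 'w::field) type_data \<Rightarrow> nat \<Rightarrow> 'c poly \<Rightarrow> 'w poly" where
  "respol T 0 = (\<lambda>g. map_poly (t_red T) (Polynomial.smult (t_unif T powi (- gauss_val (t_val T) g)) g))"
| "respol T (Suc i) = (\<lambda>g. \<Sum>j\<le>comp_degree T (Suc i) g.
     Polynomial.monom (res_coeff T i (respol T i) g (comp_start T (Suc i) g + j * t_e T (Suc i))) j)"

definition representative :: "('c::field, 'w::field) type_data \<Rightarrow> nat \<Rightarrow> 'c poly \<Rightarrow> bool" where
  "representative T i \<phi> \<longleftrightarrow>
     monic \<phi> \<and> \<phi> \<in> poly_over (valuation_ring (t_val T)) \<and>
     Polynomial.degree \<phi> = mdeg T (Suc i) \<and>
     (\<exists>c\<in>res_field T i. c \<noteq> 0 \<and> respol T i \<phi> = Polynomial.smult c (t_psi T i))"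

text \<open>\<open>is_type T i\<close>: the levels up to \<open>i\<close> form a type of order \<open>i\<close>.\<close>

primrec is_type :: "('c::field, 'w::field) type_data \<Rightarrow> nat \<Rightarrow> bool" where
  "is_type T 0 \<longleftrightarrow> local_data T \<and>
     monic (t_psi T 0) \<and> irreducible_in (res_field T 0) (t_psi T 0) \<and> poly (t_psi T 0) (t_z T 0) = 0"
| "is_type T (Suc i) \<longleftrightarrow> is_type T i \<and>
     representative T i (t_phi T (Suc i)) \<and>
     0 < t_h T (Suc i) \<and> 0 < t_e T (Suc i) \<and> coprime (t_h T (Suc i)) (t_e T (Suc i)) \<and>
     t_l T (Suc i) * int (t_h T (Suc i)) - t_l' T (Suc i) * int (t_e T (Suc i)) = 1 \<and>
     monic (t_psi T (Suc i)) \<and> irreducible_in (res_field T (Suc i)) (t_psi T (Suc i)) \<and>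
     t_psi T (Suc i) \<noteq> [:0, 1:] \<and> poly (t_psi T (Suc i)) (t_z T (Suc i)) = 0"

text \<open>The exponent of \<open>\<psi>\<^sub>i\<close> in \<open>R\<^sub>i(g)\<close>, for \<open>g \<noteq> 0\<close>.\<close>

definition type_ord :: "('c::field, 'w::field) type_data \<Rightarrow> nat \<Rightarrow> 'c poly \<Rightarrow> nat" where
  "type_ord T i g = (GREATEST n. \<exists>q\<in>poly_over (res_field T i). respol T i g = t_psi T i ^ n * q)"

definition type_dvd :: "('c::field, 'w::field) type_data \<Rightarrow> nat \<Rightarrow> 'c poly \<Rightarrow> bool" where
  "type_dvd T i g \<longleftrightarrow> 0 < type_ord T i g"

end

theory Submission imports Defs begin

text \<open>Let \<open>w(g)\<close> be the value of \<open>g(\<theta>)\<close> under \<open>w\<^sub>P\<close>, and let \<open>u\<^sub>i = v\<^sub>i / (e\<^sub>0 \<cdots> e\<^sub>i\<^sub>-\<^sub>1)\<close>. By induction on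
  \<open>i\<close> there is \<open>G \<ge> 0\<close> with \<open>w(a) \<ge> u\<^sub>i(a) - G\<close> for all \<open>a\<close> of degree less than \<open>m\<^sub>i\<close>, where either \<open>G = 0\<close>
  or \<open>G = u\<^sub>i(\<phi>\<^sub>i) - w(\<phi>\<^sub>i)\<close>. A supporting line of negative slope through \<open>(s, y\<^sub>s)\<close> says that the coefficients
  of \<open>f = \<Sum> a\<^sub>k \<phi>\<^sub>r\<^sup>k\<close> satisfy \<open>u\<^sub>r(a\<^sub>k) \<ge> H\<^sub>s + (k - s) \<mu>\<close> for some \<open>\<mu> \<le> - u\<^sub>r(\<phi>\<^sub>r)\<close>. If \<open>w(\<phi>\<^sub>r) \<ge> - \<mu>\<close>, then
  \<open>G = 0\<close> and each term of \<open>Q\<^sub>s = \<Sum> a\<^sub>k \<phi>\<^sub>r\<^sup>k\<^sup>-\<^sup>s\<close> (over \<open>k \<ge> s\<close>) has value at least \<open>H\<^sub>s\<close>; otherwise the same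
  holds for the terms \<open>k < s\<close>, whose sum at \<open>\<theta>\<close> is \<open>- Q\<^sub>s(\<theta>)\<close> because \<open>f(\<theta>) = 0\<close>.

  About the \<open>u\<^sub>i\<close> this uses only \<open>u\<^sub>i(g h) \<ge> u\<^sub>i(g) + u\<^sub>i(h)\<close>, with equality for \<open>h = \<phi>\<^sub>i\<close>. The residual polynomials
  therefore enter through their degrees alone: they show that the leading monomial of the
  \<open>\<phi>\<^sub>i\<close>-expansion of \<open>\<phi>\<^sub>i\<^sub>+\<^sub>1\<close> has the minimal value, which makes division by \<open>\<phi>\<^sub>i\<^sub>+\<^sub>1\<close> respect \<open>u\<^sub>i\<^sub>+\<^sub>1\<close>.\<close>

section \<open>Key polynomials, augmented valuations and values at a root\<close>

section \<open>Expansions\<close>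

text \<open>The polygon lives over the completion and the conclusion in the larger field. They meet
  on polynomials over the base field: every \<phi>_i has coefficients there, so its expansions
  commute with \<open>\<iota>\<close>, and each v_i can be pulled back. The dichotomy for G is what
  lets the induction close. A bare bound with some loss would spoil H_s. But a loss occurs only if
  \<phi>_i(\<theta>) has too small a value, and then by exactly G; powers of \<phi>_i(\<theta>) are
  then so cheap that comparison with them absorbs the loss. A second obstacle is that
  \<open>prime_val\<close> and \<open>ramification_index\<close> are defined through powers of
  ideals of B, and B is given as an integral closure. So the localization of B at P has to be shown
  to be a discrete valuation ring whose valuation cuts out the powers of P. The source of this is
  that every x of the larger field satisfies a linear relation between 1, x, ..., x^N, with N
  independent of x.\<close>

lemma phi_coeff_zero [simp]: "phi_coeff \<phi> 0 s = 0"
  by (simp add: phi_coeff_def)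

lemma phi_coeff_add: "phi_coeff \<phi> (g + h) s = phi_coeff \<phi> g s + phi_coeff \<phi> h s"
  by (simp add: phi_coeff_def poly_div_add_left poly_mod_add_left)

lemma phi_coeff_uminus: "phi_coeff \<phi> (- g) s = - phi_coeff \<phi> g s"
  by (simp add: phi_coeff_def poly_div_minus_left poly_mod_minus_left)

lemma phi_coeff_mult_power:
  fixes \<phi> :: "'a::field poly"
  assumes "Polynomial.degree \<phi> > 0"
  shows "phi_coeff \<phi> (g * \<phi> ^ k) (k + i) = phi_coeff \<phi> g i"
    "s < k \<Longrightarrow> phi_coeff \<phi> (g * \<phi> ^ k) s = 0"
proof -
  have [simp]: "\<phi> \<noteq> 0" using assms by auto
  show "phi_coeff \<phi> (g * \<phi> ^ k) (k + i) = phi_coeff \<phi> g i"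
    by (simp add: phi_coeff_def power_add poly_div_mult_right)
  assume "s < k"
  then have "g * \<phi> ^ k = (g * \<phi> ^ (k - Suc s) * \<phi>) * \<phi> ^ s"
    by (simp add: mult.assoc flip: power_add power_Suc)
  then show "phi_coeff \<phi> (g * \<phi> ^ k) s = 0"
    by (metis phi_coeff_def mod_mult_self2_is_0 nonzero_mult_div_cancel_right power_not_zero \<open>\<phi> \<noteq> 0\<close>)
qed

lemma phi_coeff_low_degree:
  fixes \<phi> :: "'a::field poly"
  assumes "Polynomial.degree g < k * Polynomial.degree \<phi>" and "k \<le> s"
  shows "phi_coeff \<phi> g s = 0"
proof -
  have "\<phi> \<noteq> 0" using assms by auto
  then have "Polynomial.degree (\<phi> ^ s) = s * Polynomial.degree \<phi>" by (simp add: degree_power_eq)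
  moreover have "k * Polynomial.degree \<phi> \<le> s * Polynomial.degree \<phi>" using assms(2) by simp
  ultimately have "g div \<phi> ^ s = 0" using assms(1) by (intro div_poly_less) linarith
  then show ?thesis by (simp add: phi_coeff_def)
qed

lemma phi_expansion_lessThan:
  fixes \<phi> :: "'a::field poly"
  assumes "Polynomial.degree g < k * Polynomial.degree \<phi>"
  shows "g = (\<Sum>s<k. phi_coeff \<phi> g s * \<phi> ^ s)"
proof -
  have "\<phi> \<noteq> 0" using assms by auto
  then have "Polynomial.degree (\<phi> ^ k) = k * Polynomial.degree \<phi>" by (simp add: degree_power_eq)
  then have "g div \<phi> ^ k = 0" using assms by (intro div_poly_less) simp
  then show ?thesis using phi_expansion_partial[of g \<phi> k] by simp
qed

lemma degree_diff_power:
  assumes "monic \<phi>'" "monic \<phi>" "Polynomial.degree \<phi> > 0"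
    and deg: "Polynomial.degree \<phi>' = d * Polynomial.degree \<phi>" and d: "d > 0"
  shows "Polynomial.degree (\<phi>' - \<phi> ^ d) < d * Polynomial.degree \<phi>"
proof -
  have "\<phi> \<noteq> 0" using assms by auto
  then have dp: "Polynomial.degree (\<phi> ^ d) = d * Polynomial.degree \<phi>" by (simp add: degree_power_eq)
  have "d * Polynomial.degree \<phi> > 0" using d assms(3) by simp
  moreover have "Polynomial.coeff (\<phi>' - \<phi> ^ d) (d * Polynomial.degree \<phi>) = 0"
    using assms(1,2) deg dp lead_coeff_power[of \<phi> d] by (simp add: monic_def)
  moreover have "Polynomial.degree (\<phi>' - \<phi> ^ d) \<le> d * Polynomial.degree \<phi>"
    using deg dp by (simp add: degree_diff_le)
  ultimately show ?thesis by (metis degree_0 leading_coeff_0_iff le_neq_implies_less)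
qed

lemma phi_coeff_top:
  assumes "monic \<phi>'" "monic \<phi>" "Polynomial.degree \<phi> > 0"
    and deg: "Polynomial.degree \<phi>' = d * Polynomial.degree \<phi>" and d: "d > 0"
  shows "phi_coeff \<phi> \<phi>' d = 1"
proof -
  have ne: "\<phi> \<noteq> 0" using assms by auto
  then have lt: "Polynomial.degree (\<phi>' - \<phi> ^ d) < Polynomial.degree (\<phi> ^ d)"
    using degree_diff_power[OF assms] by (simp add: degree_power_eq)
  have "\<phi>' div \<phi> ^ d = (\<phi> ^ d + (\<phi>' - \<phi> ^ d)) div \<phi> ^ d" by simp
  also have "\<dots> = 1" using ne by (simp only: poly_div_add_left div_poly_less[OF lt]) simp
  finally show ?thesis using assms(3) by (simp add: phi_coeff_def mod_poly_less)
qed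

section \<open>Augmented valuations\<close>

text \<open>The value at \<open>0\<close> of a real-valued \<open>u\<close> is junk; \<open>vge u g x\<close> means \<open>u g \<ge> x\<close> with \<open>u 0 = \<infinity>\<close>.\<close>

definition vge :: "('b::zero \<Rightarrow> real) \<Rightarrow> 'b \<Rightarrow> real \<Rightarrow> bool" where
  "vge u g x \<longleftrightarrow> g = 0 \<or> x \<le> u g"

lemma vge_0 [simp]: "vge u 0 x" by (simp add: vge_def)

lemma vge_refl: "vge u g (u g)" by (simp add: vge_def)

lemma vge_mono: "vge u g x \<Longrightarrow> y \<le> x \<Longrightarrow> vge u g y" by (auto simp: vge_def)

text \<open>Equality in the product rule is deliberately not required: the multiplicativity of the augmented
  valuations would need the irreducibility of the residual polynomials.\<close>

definition quasi_val :: "('b::ring_1 \<Rightarrow> real) \<Rightarrow> bool" where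
  "quasi_val u \<longleftrightarrow> (\<forall>g h x. vge u g x \<longrightarrow> vge u h x \<longrightarrow> vge u (g - h) x) \<and>
     (\<forall>g h x y. vge u g x \<longrightarrow> vge u h y \<longrightarrow> vge u (g * h) (x + y))"

lemma quasi_val_diff: "quasi_val u \<Longrightarrow> vge u g x \<Longrightarrow> vge u h x \<Longrightarrow> vge u (g - h) x"
  and quasi_val_mult: "quasi_val u \<Longrightarrow> vge u g x \<Longrightarrow> vge u h y \<Longrightarrow> vge u (g * h) (x + y)"
  by (auto simp: quasi_val_def)

lemma quasi_val_uminus: "quasi_val u \<Longrightarrow> vge u g x \<Longrightarrow> vge u (- g) x"
  using quasi_val_diff[of u 0 x g] by simp

lemma quasi_val_add: "quasi_val u \<Longrightarrow> vge u g x \<Longrightarrow> vge u h x \<Longrightarrow> vge u (g + h) x"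
  using quasi_val_diff[of u g x "- h"] quasi_val_uminus[of u h x] by simp

lemma quasi_val_sum: "quasi_val u \<Longrightarrow> (\<And>i. i \<in> I \<Longrightarrow> vge u (g i) x) \<Longrightarrow> vge u (sum g I) x"
  by (induction I rule: infinite_finite_induct) (auto intro: quasi_val_add)

lemma quasi_val_power:
  assumes "quasi_val u" "vge u 1 0" "vge u g x"
  shows "vge u (g ^ n) (real n * x)"
proof (induction n)
  case (Suc n)
  show ?case using quasi_val_mult[OF assms(1,3) Suc] by (simp add: algebra_simps)
qed (use assms in simp)

text \<open>If \<open>c\<close> had value below \<open>x\<close>, then c = (c + \<delta>) - \<delta>
  would be a difference of two elements of value larger than that of \<open>c\<close>.\<close>

lemma quasi_val_cancel:
  assumes u: "quasi_val u" and sum: "vge u (c + \<delta>) x" and \<delta>: "\<And>y. vge u c y \<Longrightarrow> vge u \<delta> (y + \<epsilon>)"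
    and \<epsilon>: "\<epsilon> > 0"
  shows "vge u c x"
proof (rule ccontr)
  assume "\<not> vge u c x"
  then have c: "c \<noteq> 0" "u c < x" by (auto simp: vge_def)
  have "vge u ((c + \<delta>) - \<delta>) (min x (u c + \<epsilon>))"
    using vge_mono[OF sum] vge_mono[OF \<delta>[OF vge_refl]] by (intro quasi_val_diff[OF u]) auto
  then show False using c \<epsilon> by (auto simp: vge_def)
qed

text \<open>A form of MacLane's key polynomials: \<open>q\<close> and \<rho> are quotient and
  remainder, so the condition says that division by \<phi> costs at most \<open>u \<phi>\<close>.
  Quantifying over \<open>q\<close> and \<rho> suits the induction on \<open>q\<close> in
  \<open>key_augmentation\<close>.\<close>

definition key_poly :: "('a::field poly \<Rightarrow> real) \<Rightarrow> 'a poly \<Rightarrow> bool" where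
  "key_poly u \<phi> \<longleftrightarrow> monic \<phi> \<and> Polynomial.degree \<phi> > 0 \<and>
     (\<forall>q \<rho> x. Polynomial.degree \<rho> < Polynomial.degree \<phi> \<longrightarrow> vge u (q * \<phi> + \<rho>) x \<longrightarrow> vge u q (x - u \<phi>))"

text \<open>MacLane's augmented valuation, which assigns \<phi> the new value \<nu>. At
  \<open>g = 0\<close> it is the \<open>Min\<close> of an empty set, hidden by
  \<open>vge\<close>.\<close>

definition augmentation :: "('a::field poly \<Rightarrow> real) \<Rightarrow> 'a poly \<Rightarrow> real \<Rightarrow> 'a poly \<Rightarrow> real" where
  "augmentation u \<phi> \<nu> g = Min {u (phi_coeff \<phi> g s) + real s * \<nu> | s. phi_coeff \<phi> g s \<noteq> 0}"

lemma finite_phi_coeff_support: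
  assumes "Polynomial.degree \<phi> > 0"
  shows "finite {s. phi_coeff \<phi> g s \<noteq> 0}"
  by (rule finite_subset[of _ "{..Polynomial.degree g}"])
    (use phi_coeff_eq_0[OF assms] not_le in auto)

lemma phi_coeff_support_nonempty:
  assumes "Polynomial.degree \<phi> > 0" "g \<noteq> 0"
  shows "{s. phi_coeff \<phi> g s \<noteq> 0} \<noteq> {}"
proof
  assume "{s. phi_coeff \<phi> g s \<noteq> 0} = {}"
  then have "phi_coeff \<phi> g s = 0" for s by auto
  then show False using phi_expansion[OF assms(1), of g] assms(2) by simp
qed

lemma vge_augmentation:
  assumes "Polynomial.degree \<phi> > 0"
  shows "vge (augmentation u \<phi> \<nu>) g x \<longleftrightarrow> (\<forall>s. vge u (phi_coeff \<phi> g s) (x - real s * \<nu>))"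
proof (cases "g = 0")
  case False
  let ?S = "{s. phi_coeff \<phi> g s \<noteq> 0}"
  have "{u (phi_coeff \<phi> g s) + real s * \<nu> | s. phi_coeff \<phi> g s \<noteq> 0} =
      (\<lambda>s. u (phi_coeff \<phi> g s) + real s * \<nu>) ` ?S" by auto
  then have "x \<le> augmentation u \<phi> \<nu> g \<longleftrightarrow> (\<forall>s\<in>?S. x \<le> u (phi_coeff \<phi> g s) + real s * \<nu>)"
    using finite_phi_coeff_support[OF assms, of g] phi_coeff_support_nonempty[OF assms False]
    by (simp add: augmentation_def)
  then show ?thesis using False by (auto simp: vge_def algebra_simps)
qed simp

locale key_pair =
  fixes u :: "'a::field poly \<Rightarrow> real" and \<phi> :: "'a poly"
  assumes quasi: "quasi_val u" and key: "key_poly u \<phi>"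
begin

lemma degree_pos: "Polynomial.degree \<phi> > 0" and monic: "Polynomial.lead_coeff \<phi> = 1"
  using key by (auto simp: key_poly_def monic_def)

lemma nonzero [simp]: "\<phi> \<noteq> 0" using degree_pos by auto

lemma vge_div: "vge u g x \<Longrightarrow> vge u (g div \<phi>) (x - u \<phi>)"
  using key degree_mod_less[of \<phi> g] degree_pos unfolding key_poly_def
  by (metis div_mult_mod_eq nonzero degree_0)

lemma vge_mod:
  assumes "vge u g x"
  shows "vge u (g mod \<phi>) x"
proof -
  have "vge u (g - (g div \<phi>) * \<phi>) x"
    using quasi_val_mult[OF quasi vge_div[OF assms] vge_refl[of u \<phi>]] assms
    by (intro quasi_val_diff[OF quasi]) auto
  then show ?thesis by (simp add: minus_div_mult_eq_mod)
qed

text \<open>The product rule gives one inequality, division of \<open>q * \<phi>\<close> by \<phi>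
  the other.\<close>

lemma value_mult: "q \<noteq> 0 \<Longrightarrow> u (q * \<phi>) = u q + u \<phi>"
  using quasi_val_mult[OF quasi vge_refl[of u q] vge_refl[of u \<phi>]] vge_div[OF vge_refl[of u "q * \<phi>"]]
  by (auto simp: vge_def)

lemma value_mult_power: "q \<noteq> 0 \<Longrightarrow> u (q * \<phi> ^ s) = u q + real s * u \<phi>"
proof (induction s)
  case (Suc s)
  have "q * \<phi> ^ Suc s = q * \<phi> ^ s * \<phi>" by (simp add: mult_ac)
  then show ?case using Suc value_mult[of "q * \<phi> ^ s"] by (simp add: algebra_simps)
qed simp

lemma value_1: "u 1 = 0" using value_mult[of 1] by simp

end

locale augmented = key_pair +
  fixes \<nu> :: real
  assumes larger: "\<nu> > u \<phi>"
begin

abbreviation u' :: "'a poly \<Rightarrow> real" where "u' \<equiv> augmentation u \<phi> \<nu>"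

lemmas vge_u' = vge_augmentation[OF degree_pos, of u \<nu>]

text \<open>As \<open>a\<close> may have large degree, its own expansion spills into higher powers
  of \<phi>. Each further power costs \<open>u \<phi>\<close> in the division but earns \<nu>, which
  is larger.\<close>

lemma vge_u'_term:
  assumes "vge u a x"
  shows "vge u' (a * \<phi> ^ s) (x + real s * \<nu>)"
  unfolding vge_u'
proof
  fix k
  show "vge u (phi_coeff \<phi> (a * \<phi> ^ s) k) (x + real s * \<nu> - real k * \<nu>)"
  proof (cases "s \<le> k")
    case True
    then obtain i where k: "k = s + i" using le_Suc_ex by blast
    have "vge u (a div \<phi> ^ i) (x - real i * u \<phi>)"
    proof (induction i)
      case (Suc i)
      have "a div \<phi> ^ Suc i = a div \<phi> ^ i div \<phi>" by (simp add: power_Suc2 poly_div_mult_right del: power_Suc)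
      then show ?case using vge_div[OF Suc] by (simp add: algebra_simps)
    qed (use assms in simp)
    from vge_mod[OF this] have "vge u (phi_coeff \<phi> a i) (x - real i * u \<phi>)" by (simp add: phi_coeff_def)
    moreover have "x - real i * \<nu> \<le> x - real i * u \<phi>" using larger by (simp add: mult_left_mono)
    ultimately have "vge u (phi_coeff \<phi> a i) (x - real i * \<nu>)" by (rule vge_mono)
    then show ?thesis unfolding k phi_coeff_mult_power(1)[OF degree_pos] by (simp add: algebra_simps)
  qed (simp add: phi_coeff_mult_power[OF degree_pos])
qed

lemma quasi_u': "quasi_val u'"
proof -
  have diff: "vge u' (g - h) x" if "vge u' g x" "vge u' h x" for g h x
    using that phi_coeff_add[of \<phi> g "- h"] phi_coeff_uminus[of \<phi> h] quasi_val_diff[OF quasi]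
    unfolding vge_u' by simp
  have sum: "vge u' (sum g I) x" if "\<And>i. i \<in> I \<Longrightarrow> vge u' (g i) x" for g :: "nat \<Rightarrow> _" and I x
    using that
  proof (induction I rule: infinite_finite_induct)
    case (insert i I)
    have "vge u' (g i - (0 - sum g I)) x" using insert by (intro diff) auto
    then show ?case using insert by simp
  qed simp_all
  have "vge u' (g * h) (x + y)" if "vge u' g x" "vge u' h y" for g h x y
  proof -
    \<comment> \<open>The product of two coefficients can reach the degree of \<phi>;
      \<open>vge_u'_term\<close> takes care of the carry.\<close>
    have "vge u' (phi_coeff \<phi> g s * phi_coeff \<phi> h t * \<phi> ^ (s + t)) (x + y)" for s t
      using vge_u'_term[OF quasi_val_mult[OF quasi that[unfolded vge_u', rule_format]], of s t "s + t"]
      by (simp add: algebra_simps)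
    then have "vge u' (\<Sum>s\<le>Polynomial.degree g. \<Sum>t\<le>Polynomial.degree h.
        phi_coeff \<phi> g s * phi_coeff \<phi> h t * \<phi> ^ (s + t)) (x + y)"
      by (intro sum) auto
    also have "(\<Sum>s\<le>Polynomial.degree g. \<Sum>t\<le>Polynomial.degree h.
        phi_coeff \<phi> g s * phi_coeff \<phi> h t * \<phi> ^ (s + t)) = g * h"
      by (subst phi_expansion[OF degree_pos, of g], subst (3) phi_expansion[OF degree_pos, of h])
        (simp add: sum_product power_add mult_ac)
    finally show ?thesis .
  qed
  with diff show ?thesis by (auto simp: quasi_val_def)
qed

text \<open>The hypothesis on coefficients says that the leading term \<phi>^d of \<phi>' has
  minimal value. The coefficients of \<open>q\<close> can then be read off
  \<open>q * \<phi>' + \<rho>\<close> from the top: each one appears there up to an error of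
  strictly larger value.\<close>

lemma key_augmentation:
  assumes monic': "monic \<phi>'" and deg: "Polynomial.degree \<phi>' = d * Polynomial.degree \<phi>" and d: "d > 0"
    and coeffs: "\<And>s. s < d \<Longrightarrow> vge u (phi_coeff \<phi> \<phi>' s) ((real d - real s) * \<nu>)"
  shows "u' \<phi>' = real d * \<nu>" "key_poly u' \<phi>'"
proof -
  let ?m = "Polynomial.degree \<phi>"
  have deg_b: "Polynomial.degree (\<phi>' - \<phi> ^ d) < d * ?m"
    using key by (intro degree_diff_power monic' degree_pos deg d) (simp add: key_poly_def)
  define b where "b = \<phi>' - \<phi> ^ d"
  have \<phi>': "\<phi>' = \<phi> ^ d + b" by (simp add: b_def)
  have pow: "phi_coeff \<phi> (\<phi> ^ d) s = (if s = d then 1 else 0)" for s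
  proof (cases "s < d")
    case True then show ?thesis using phi_coeff_mult_power(2)[OF degree_pos, of s d 1] by simp
  next
    case False
    then obtain i where "s = d + i" by (metis le_Suc_ex not_less)
    moreover have "phi_coeff \<phi> 1 i = (if i = 0 then 1 else 0)"
      using degree_pos phi_coeff_low_degree[of 1 1 \<phi> i] by (auto simp: phi_coeff_def mod_poly_less)
    ultimately show ?thesis using phi_coeff_mult_power(1)[OF degree_pos, of 1 d i] by simp
  qed
  have b0: "phi_coeff \<phi> b s = 0" if "s \<ge> d" for s
    using phi_coeff_low_degree[OF deg_b that] by (simp add: b_def)
  have b1: "phi_coeff \<phi> b s = phi_coeff \<phi> \<phi>' s" if "s < d" for s
    using that by (simp add: \<phi>' phi_coeff_add pow)
  have top: "phi_coeff \<phi> \<phi>' d = 1" by (simp add: \<phi>' phi_coeff_add pow b0)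
  have b: "vge u (phi_coeff \<phi> b s) ((real d - real s) * \<nu>)" for s
    using coeffs[of s] b0[of s] b1[of s] by (cases "s < d") auto
  have ge: "vge u' \<phi>' (real d * \<nu>)"
    unfolding vge_u' \<phi>' phi_coeff_add
  proof
    fix s show "vge u (phi_coeff \<phi> (\<phi> ^ d) s + phi_coeff \<phi> b s) (real d * \<nu> - real s * \<nu>)"
      using b[of s] b0[of s] value_1 pow[of s]
      by (cases "s = d") (auto simp: algebra_simps vge_def)
  qed
  have ne: "\<phi>' \<noteq> 0" using monic' by (auto simp: monic_def)
  have "vge u' \<phi>' (u' \<phi>')" by (rule vge_refl)
  then have "vge u (phi_coeff \<phi> \<phi>' d) (u' \<phi>' - real d * \<nu>)" unfolding vge_u' by blast
  then have "u' \<phi>' \<le> real d * \<nu>" by (simp add: top vge_def value_1)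
  with ge ne show val: "u' \<phi>' = real d * \<nu>" by (auto simp: vge_def)
  \<comment> \<open>Induction on a bound \<open>k\<close> for the number of \<phi>-coefficients of
    \<open>q\<close>; each round bounds the top one, \<open>c\<close>, and subtracts its
    contribution.\<close>
  have main: "vge u' q (x - real d * \<nu>)"
    if "vge u' (q * \<phi>' + \<rho>) x" "Polynomial.degree \<rho> < d * ?m" "Polynomial.degree q < k * ?m"
    for q \<rho> x k using that
  proof (induction k arbitrary: q)
    case (Suc k)
    define c where "c = phi_coeff \<phi> q k"
    define q' where "q' = q - c * \<phi> ^ k"
    have degc: "Polynomial.degree c < ?m" unfolding c_def by (rule phi_coeff_degree[OF degree_pos])
    have q: "q = q' + c * \<phi> ^ k" by (simp add: q'_def)
    have degq': "q' = 0 \<or> Polynomial.degree q' < k * ?m"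
    proof -
      have "q' = (\<Sum>s<k. phi_coeff \<phi> q s * \<phi> ^ s)"
        using phi_expansion_lessThan[OF Suc.prems(3)] unfolding q'_def c_def sum.lessThan_Suc
        by (metis add_diff_cancel_right')
      moreover have "Polynomial.degree (phi_coeff \<phi> q s * \<phi> ^ s) < k * ?m" if "s < k" for s
      proof -
        have "Polynomial.degree (phi_coeff \<phi> q s * \<phi> ^ s) \<le>
          Polynomial.degree (phi_coeff \<phi> q s) + s * ?m"
          by (rule order_trans[OF degree_mult_le]) (simp add: degree_power_eq)
        also have "\<dots> < ?m + s * ?m" using phi_coeff_degree[OF degree_pos] by simp
        also have "\<dots> \<le> k * ?m" using that mult_le_mono1[of "Suc s" k ?m] by simp
        finally show ?thesis .
      qed
      ultimately show ?thesis
        using degree_pos by (cases "k = 0") (auto intro!: degree_sum_less)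
    qed
    \<comment> \<open>The carry that the lower part \<open>b\<close> of \<phi>', multiplied by
      \<open>c\<close>, sends into the position where \<open>c\<close> itself is expected.\<close>
    define \<delta> where "\<delta> = phi_coeff \<phi> (c * b) d"
    have low: "phi_coeff \<phi> (q' * \<phi>' + \<rho>) (k + d) = 0"
    proof -
      have "phi_coeff \<phi> (q' * \<phi>') (k + d) = 0"
      proof (cases "q' = 0")
        case False
        then have "Polynomial.degree (q' * \<phi>') < (k + d) * ?m"
          using degq' degree_mult_eq[OF False ne] by (simp add: deg algebra_simps)
        then show ?thesis by (rule phi_coeff_low_degree) simp
      qed simp
      moreover have "phi_coeff \<phi> \<rho> (k + d) = 0"
        by (rule phi_coeff_low_degree[OF Suc.prems(2)]) simp
      ultimately show ?thesis by (simp add: phi_coeff_add)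
    qed
    have "q * \<phi>' + \<rho> = (q' * \<phi>' + \<rho>) + (c * \<phi> ^ (k + d) + (c * b) * \<phi> ^ k)"
      unfolding q by (simp add: \<phi>' algebra_simps power_add)
    moreover have "phi_coeff \<phi> (c * \<phi> ^ (k + d)) (k + d) = c"
      using phi_coeff_mult_power(1)[OF degree_pos, of c "k + d" 0] degc
      by (simp add: phi_coeff_def mod_poly_less)
    moreover have "phi_coeff \<phi> ((c * b) * \<phi> ^ k) (k + d) = \<delta>"
      unfolding \<delta>_def by (rule phi_coeff_mult_power(1)[OF degree_pos])
    ultimately have coeff: "phi_coeff \<phi> (q * \<phi>' + \<rho>) (k + d) = c + \<delta>"
      using low by (simp add: phi_coeff_add)
    have \<delta>: "vge u \<delta> (y + (\<nu> - u \<phi>))" if y: "vge u c y" for y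
    proof -
      \<comment> \<open>Only the coefficient of \<phi>^(d-1) in \<open>b\<close> can carry into
        position \<open>d\<close>; the lower terms times \<open>c\<close> have too small a degree.
        Being a quotient by \<phi>, the carry gains \<nu> - \<open>u \<phi>\<close> over
        \<open>c\<close>.\<close>
      define b' where "b' = phi_coeff \<phi> b (d - 1)"
      have bexp: "b = (\<Sum>s<d-1. phi_coeff \<phi> b s * \<phi> ^ s) + b' * \<phi> ^ (d - 1)"
        using phi_expansion_lessThan[OF deg_b] d unfolding b_def[symmetric] b'_def
        by (cases d) auto
      have z: "phi_coeff \<phi> (c * (\<Sum>s<d-1. phi_coeff \<phi> b s * \<phi> ^ s)) d = 0"
      proof -
        have "Polynomial.degree (\<Sum>s<d-1. phi_coeff \<phi> b s * \<phi> ^ s) \<le> (d - 1) * ?m"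
        proof (rule degree_sum_le)
          fix s assume "s \<in> {..<d-1}"
          then have s: "Suc s \<le> d - 1" by simp
          have "Polynomial.degree (phi_coeff \<phi> b s * \<phi> ^ s) \<le>
            Polynomial.degree (phi_coeff \<phi> b s) + s * ?m"
            by (rule order_trans[OF degree_mult_le]) (simp add: degree_power_eq)
          also have "\<dots> \<le> ?m + s * ?m" using phi_coeff_degree[OF degree_pos, of b s] by simp
          also have "\<dots> \<le> (d - 1) * ?m" using mult_le_mono1[OF s, of ?m] by simp
          finally show "Polynomial.degree (phi_coeff \<phi> b s * \<phi> ^ s) \<le> (d - 1) * ?m" .
        qed simp
        then have "Polynomial.degree (c * (\<Sum>s<d-1. phi_coeff \<phi> b s * \<phi> ^ s)) < ?m + (d - 1) * ?m"
          using degc degree_mult_le[of c "\<Sum>s<d-1. phi_coeff \<phi> b s * \<phi> ^ s"] by linarith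
        also have "\<dots> = d * ?m" using d by (cases d) auto
        finally show ?thesis by (rule phi_coeff_low_degree) simp
      qed
      have "\<delta> = phi_coeff \<phi> (c * b' * \<phi> ^ (d - 1)) d"
        unfolding \<delta>_def by (subst bexp) (simp only: distrib_left phi_coeff_add z add_0 mult.assoc)
      also have "\<dots> = phi_coeff \<phi> (c * b') 1"
        using phi_coeff_mult_power(1)[OF degree_pos, of "c * b'" "d - 1" 1] d by simp
      finally have "\<delta> = (c * b') div \<phi> mod \<phi>" by (simp add: phi_coeff_def)
      moreover have "vge u b' \<nu>" using b[of "d - 1"] d by (simp add: b'_def of_nat_diff)
      ultimately show ?thesis
        using vge_mod[OF vge_div[OF quasi_val_mult[OF quasi y]]] by (simp add: algebra_simps)
    qed
    have "vge u (c + \<delta>) (x - real (k + d) * \<nu>)"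
      using Suc.prems(1) coeff unfolding vge_u' by metis
    then have c: "vge u c (x - real (k + d) * \<nu>)"
      by (rule quasi_val_cancel[OF quasi _ \<delta>]) (use larger in auto)
    from vge_u'_term[OF this, of k] have ck: "vge u' (c * \<phi> ^ k) (x - real d * \<nu>)"
      by (simp add: algebra_simps)
    have "vge u' (q * \<phi>' + \<rho> - c * \<phi> ^ k * \<phi>') x"
      using quasi_val_mult[OF quasi_u' ck ge] Suc.prems(1) by (intro quasi_val_diff[OF quasi_u']) auto
    also have "q * \<phi>' + \<rho> - c * \<phi> ^ k * \<phi>' = q' * \<phi>' + \<rho>" by (simp add: q'_def algebra_simps)
    finally have "vge u' q' (x - real d * \<nu>)"
      using Suc.IH[of q'] Suc.prems(2) degq' by (cases "q' = 0") auto
    then show ?case unfolding q by (intro quasi_val_add[OF quasi_u'] ck)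
  qed simp
  have degk: "Polynomial.degree q < Suc (Polynomial.degree q) * ?m" for q
    using degree_pos by (metis lessI less_le_trans mult.right_neutral mult_le_mono2 Suc_leI One_nat_def)
  show "key_poly u' \<phi>'"
    using main[OF _ _ degk] d degree_pos unfolding key_poly_def by (simp add: val monic' deg)
qed

end

section \<open>Values at a root compared with augmented valuations\<close>

locale evaluation =
  fixes ev :: "'a::field poly \<Rightarrow> 'l::field" and W :: "'l \<Rightarrow> real"
  assumes ev_add: "ev (g + h) = ev g + ev h" and ev_mult: "ev (g * h) = ev g * ev h"
    and ev_1: "ev 1 = 1"
    and quasi_W: "quasi_val W" and W_mult: "x \<noteq> 0 \<Longrightarrow> y \<noteq> 0 \<Longrightarrow> W (x * y) = W x + W y"
begin

lemma ev_0: "ev 0 = 0"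
  using ev_add[of 0 0] by (metis add_0 add_cancel_right_right)

lemma ev_sum: "ev (sum g I) = (\<Sum>i\<in>I. ev (g i))"
  by (induction I rule: infinite_finite_induct) (auto simp: ev_0 ev_add)

lemma ev_power: "ev (g ^ n) = ev g ^ n"
  by (induction n) (auto simp: ev_1 ev_mult)

lemma W_1: "W 1 = 0"
  using W_mult[of 1 1] by simp

lemma W_power: "x \<noteq> 0 \<Longrightarrow> W (x ^ n) = real n * W x"
  by (induction n) (auto simp: W_1 W_mult algebra_simps)

lemma vge_W_power: "vge W x y \<Longrightarrow> vge W (x ^ n) (real n * y)"
  by (rule quasi_val_power[OF quasi_W]) (auto simp: vge_def W_1)

lemma vge_W_cancel:
  assumes "vge W (x * y) z" "y \<noteq> 0"
  shows "vge W x (z - W y)"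
  using assms W_mult[of x y] by (cases "x = 0") (auto simp: vge_def)

text \<open>\<open>G\<close> measures how far the valuation at the root falls below \<open>u\<close>; when it does fall below, the
  defect at \<open>\<phi>\<close> itself dominates the defects at polynomials of smaller degree.\<close>

definition excess :: "('a poly \<Rightarrow> real) \<Rightarrow> 'a poly \<Rightarrow> real \<Rightarrow> bool" where
  "excess u \<phi> G \<longleftrightarrow> 0 \<le> G \<and>
     (\<forall>a x. Polynomial.degree a < Polynomial.degree \<phi> \<longrightarrow> vge u a x \<longrightarrow> vge W (ev a) (x - G)) \<and>
     (G = 0 \<or> ev \<phi> \<noteq> 0 \<and> W (ev \<phi>) = u \<phi> - G)"

lemma quotient_bound:
  assumes deg: "Polynomial.degree \<phi> > 0" and G: "excess u \<phi> G" and root: "ev f = 0"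
    and \<mu>: "\<mu> \<le> - u \<phi>"
    and line: "\<And>k. vge u (phi_coeff \<phi> f k) (H + (real k - real s) * \<mu>)"
  shows "vge W (ev (f div \<phi> ^ s)) H"
proof -
  have [simp]: "\<phi> \<noteq> 0" using deg by auto
  have coeff: "vge W (ev (phi_coeff \<phi> f k)) (H + (real k - real s) * \<mu> - G)" for k
    using G line phi_coeff_degree[OF deg] unfolding excess_def by blast
  show ?thesis
  proof (cases "vge W (ev \<phi>) (- \<mu>)")
    case True
    \<comment> \<open>A nonzero \<open>G\<close> would force \<open>ev \<phi>\<close> to be nonzero
      of value below \<open>u \<phi>\<close>, hence below -\<mu>.\<close>
    then have "G = 0" using G \<mu> by (auto simp: excess_def vge_def)
    define q where "q = f div \<phi> ^ s"
    have qc: "phi_coeff \<phi> q i = phi_coeff \<phi> f (s + i)" for i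
      by (simp add: q_def phi_coeff_def power_add flip: poly_div_mult_right)
    have "vge W (ev (phi_coeff \<phi> q i) * ev \<phi> ^ i) H" for i
      using quasi_val_mult[OF quasi_W coeff[of "s + i"] vge_W_power[OF True, of i]] \<open>G = 0\<close>
      by (simp add: qc algebra_simps)
    then have "vge W (ev (\<Sum>i\<le>Polynomial.degree q. phi_coeff \<phi> q i * \<phi> ^ i)) H"
      unfolding ev_sum ev_mult ev_power by (intro quasi_val_sum[OF quasi_W])
    then show ?thesis using phi_expansion[OF deg, of q] unfolding q_def by metis
  next
    case False
    then have ne: "ev \<phi> \<noteq> 0" and lt: "W (ev \<phi>) < - \<mu>" by (auto simp: vge_def)
    \<comment> \<open>Used with n = s - k: the defect \<open>G\<close> enters each term once, while
      a single step from \<open>k\<close> towards \<open>s\<close> already gains -\<mu> -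
      \<open>W (ev \<phi>)\<close>, which is at least \<open>G\<close>.\<close>
    have G': "G \<le> real n * (- \<mu> - W (ev \<phi>))" if "n > 0" for n
    proof (cases "G = 0")
      case False
      then have "G \<le> - \<mu> - W (ev \<phi>)" using G \<mu> by (auto simp: excess_def)
      also have "\<dots> \<le> real n * (- \<mu> - W (ev \<phi>))" using that lt by simp
      finally show ?thesis .
    qed (use lt in simp)
    have "vge W (ev (phi_coeff \<phi> f k) * ev \<phi> ^ k) (H + real s * W (ev \<phi>))" if "k < s" for k
    proof (rule vge_mono[OF quasi_val_mult[OF quasi_W coeff[of k] vge_W_power[OF vge_refl, of "ev \<phi>" k]]])
      show "H + real s * W (ev \<phi>) \<le> H + (real k - real s) * \<mu> - G + real k * W (ev \<phi>)"
        using G'[of "s - k"] that by (simp add: of_nat_diff algebra_simps)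
    qed
    then have sum: "vge W (ev (\<Sum>k<s. phi_coeff \<phi> f k * \<phi> ^ k)) (H + real s * W (ev \<phi>))"
      unfolding ev_sum ev_mult ev_power by (intro quasi_val_sum[OF quasi_W]) auto
    have "0 = ev (\<Sum>k<s. phi_coeff \<phi> f k * \<phi> ^ k) + ev (f div \<phi> ^ s) * ev \<phi> ^ s"
      using arg_cong[OF phi_expansion_partial[of f \<phi> s], of ev]
      by (simp only: root ev_add ev_mult ev_power)
    then have "ev (f div \<phi> ^ s) * ev \<phi> ^ s = - ev (\<Sum>k<s. phi_coeff \<phi> f k * \<phi> ^ k)"
      by (simp add: eq_neg_iff_add_eq_0 add.commute)
    then have "vge W (ev (f div \<phi> ^ s) * ev \<phi> ^ s) (H + real s * W (ev \<phi>))"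
      using quasi_val_uminus[OF quasi_W sum] by simp
    from vge_W_cancel[OF this] ne show ?thesis by (simp add: W_power)
  qed
qed

text \<open>If \<phi>(\<theta>) reaches the value \<nu>, every term of an expansion has its
  predicted value and the new defect is 0. If it falls short by \<Delta>, a term with \<phi>^s loses
  at most s \<Delta> + G. As G < \<Delta>, the term \<phi>^d alone decides the value of
  \<phi>'(\<theta>), which falls short by exactly d \<Delta>; this is the new defect.\<close>

lemma excess_augmentation:
  assumes aug: "augmented u \<phi> \<nu>" and G: "excess u \<phi> G"
    and monic': "monic \<phi>'" and deg: "Polynomial.degree \<phi>' = d * Polynomial.degree \<phi>" and d: "d > 0"
    and coeffs: "\<And>s. s < d \<Longrightarrow> vge u (phi_coeff \<phi> \<phi>' s) ((real d - real s) * \<nu>)"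
  shows "\<exists>G'. excess (augmentation u \<phi> \<nu>) \<phi>' G'"
proof -
  interpret augmented u \<phi> \<nu> by (rule aug)
  have Gc: "vge W (ev (phi_coeff \<phi> a s)) (x - G)" if "vge u (phi_coeff \<phi> a s) x" for a s x
    using G that phi_coeff_degree[OF degree_pos] unfolding excess_def by blast
  have expand: "vge W (ev a) x"
    if "\<And>s. s < k \<Longrightarrow> vge W (ev (phi_coeff \<phi> a s) * ev \<phi> ^ s) x"
      and "Polynomial.degree a < k * Polynomial.degree \<phi>" for a x k
  proof -
    have "vge W (ev (\<Sum>s<k. phi_coeff \<phi> a s * \<phi> ^ s)) x"
      unfolding ev_sum ev_mult ev_power using that(1) by (intro quasi_val_sum[OF quasi_W]) auto
    then show ?thesis using phi_expansion_lessThan[OF that(2)] by metis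
  qed
  show ?thesis
  proof (cases "vge W (ev \<phi>) \<nu>")
    case True
    then have "G = 0" using G larger by (auto simp: excess_def vge_def)
    have "vge W (ev a) x" if a: "Polynomial.degree a < d * Polynomial.degree \<phi>" and x: "vge u' a x" for a x
    proof (rule expand[OF _ a])
      fix s
      have "vge u (phi_coeff \<phi> a s) (x - real s * \<nu>)" using x vge_u' by blast
      from quasi_val_mult[OF quasi_W Gc[OF this] vge_W_power[OF True, of s]]
      show "vge W (ev (phi_coeff \<phi> a s) * ev \<phi> ^ s) x" by (simp add: \<open>G = 0\<close>)
    qed
    then have "excess u' \<phi>' 0" by (simp add: excess_def deg)
    then show ?thesis ..
  next
    case False
    define \<Delta> where "\<Delta> = \<nu> - W (ev \<phi>)"
    have ne: "ev \<phi> \<noteq> 0" and pos: "\<Delta> > 0" using False by (auto simp: vge_def \<Delta>_def)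
    \<comment> \<open>Either \<open>G\<close> is 0, or \<phi>(\<theta>) has value
      \<open>u \<phi>\<close> - G, and \<nu> exceeds \<open>u \<phi>\<close>.\<close>
    have lt: "G < \<Delta>" using G larger pos by (auto simp: excess_def \<Delta>_def)
    have trm: "vge W (ev (phi_coeff \<phi> a s) * ev \<phi> ^ s) (x - (real d - 1) * \<Delta> - G)"
      if x: "vge u (phi_coeff \<phi> a s) (x - real s * \<nu>)" and s: "s < d" for a s x
    proof (rule vge_mono[OF quasi_val_mult[OF quasi_W Gc[OF x] vge_W_power[OF vge_refl, of "ev \<phi>" s]]])
      have "real s * \<Delta> \<le> (real d - 1) * \<Delta>" using s pos by (intro mult_right_mono) auto
      then show "x - (real d - 1) * \<Delta> - G \<le> x - real s * \<nu> - G + real s * W (ev \<phi>)"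
        by (simp add: \<Delta>_def algebra_simps)
    qed
    have low: "vge W (ev a) (x - real d * \<Delta>)"
      if a: "Polynomial.degree a < d * Polynomial.degree \<phi>" and x: "vge u' a x" for a x
    proof (rule expand[OF vge_mono[OF trm] a])
      show "vge u (phi_coeff \<phi> a s) (x - real s * \<nu>)" for s using x vge_u' by blast
      show "x - real d * \<Delta> \<le> x - (real d - 1) * \<Delta> - G" using lt by (simp add: algebra_simps)
    qed
    note val' = key_augmentation(1)[OF monic' deg d coeffs]
    have top: "phi_coeff \<phi> \<phi>' d = 1"
      using key by (intro phi_coeff_top monic' degree_pos deg d) (simp add: key_poly_def)
    have "d * Polynomial.degree \<phi> < Suc d * Polynomial.degree \<phi>" using degree_pos by simp
    then have exp: "\<phi>' = (\<Sum>s<d. phi_coeff \<phi> \<phi>' s * \<phi> ^ s) + \<phi> ^ d"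
      using phi_expansion_lessThan[of \<phi>' "Suc d" \<phi>] top deg by simp
    define R where "R = (\<Sum>s<d. ev (phi_coeff \<phi> \<phi>' s) * ev \<phi> ^ s)"
    have ev\<phi>': "ev \<phi>' = R + ev \<phi> ^ d"
      using arg_cong[OF exp, of ev] by (simp only: ev_sum ev_add ev_mult ev_power R_def)
    \<comment> \<open>The lower terms have predicted value d \<nu> and lose at most (d - 1) \<Delta>
      + G, so they exceed the value of \<phi>(\<theta>)^d by \<Delta> - G > 0.\<close>
    have R: "vge W R (real d * W (ev \<phi>) + (\<Delta> - G))"
      unfolding R_def
    proof (rule quasi_val_sum[OF quasi_W])
      fix s assume "s \<in> {..<d}"
      then have "vge W (ev (phi_coeff \<phi> \<phi>' s) * ev \<phi> ^ s) (real d * \<nu> - (real d - 1) * \<Delta> - G)"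
        using coeffs[of s] by (intro trm) (auto simp: algebra_simps)
      then show "vge W (ev (phi_coeff \<phi> \<phi>' s) * ev \<phi> ^ s) (real d * W (ev \<phi>) + (\<Delta> - G))"
        by (simp add: \<Delta>_def algebra_simps)
    qed
    have "vge W (ev \<phi> ^ d) (real d * W (ev \<phi>))" by (rule vge_W_power[OF vge_refl])
    from quasi_val_add[OF quasi_W vge_mono[OF R] this] lt
    have ge: "vge W (ev \<phi>') (real d * W (ev \<phi>))" by (simp add: ev\<phi>')
    have le: "\<not> vge W (ev \<phi>') (real d * W (ev \<phi>) + (\<Delta> - G))"
    proof
      assume "vge W (ev \<phi>') (real d * W (ev \<phi>) + (\<Delta> - G))"
      from quasi_val_diff[OF quasi_W this R] show False
        using ne lt by (simp add: ev\<phi>' vge_def W_power)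
    qed
    have "vge W (ev \<phi> ^ d) (min (real d * W (ev \<phi>) + (\<Delta> - G)) (W (ev \<phi>')))" (is "vge W _ ?m")
    proof -
      have "vge W (ev \<phi>' - R) ?m"
        using vge_mono[OF R] vge_mono[OF vge_refl[of W "ev \<phi>'"]] by (intro quasi_val_diff[OF quasi_W]) auto
      then show ?thesis by (simp add: ev\<phi>')
    qed
    then have W': "W (ev \<phi>') = real d * W (ev \<phi>)" "ev \<phi>' \<noteq> 0"
      using ge le ne lt by (auto simp: vge_def W_power)
    have "W (ev \<phi>') = u' \<phi>' - real d * \<Delta>" using W'(1) val' by (simp add: \<Delta>_def algebra_simps)
    then have "excess u' \<phi>' (real d * \<Delta>)" using low W'(2) pos by (simp add: excess_def deg)
    then show ?thesis ..
  qed
qed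

end

section \<open>From polygons and types to key polynomials\<close>

section \<open>Polynomials under field embeddings\<close>

lemma field_embedding_hom:
  assumes "field_embedding j"
  shows "j (x + y) = j x + j y" "j (x * y) = j x * j y" "j 1 = 1"
proof -
  have h: "j \<in> ring_hom ring_of_type_algebra ring_of_type_algebra"
    using assms unfolding field_embedding_def .
  show "j (x + y) = j x + j y" using ring_hom_add[OF h, of x y] by simp
  show "j (x * y) = j x * j y" using ring_hom_mult[OF h, of x y] by simp
  show "j 1 = 1" using ring_hom_one[OF h] by simp
qed

locale embedding =
  fixes j :: "'k::field \<Rightarrow> 'l::field"
  assumes emb: "field_embedding j"
begin

lemma hom: "j (x + y) = j x + j y" "j (x * y) = j x * j y" "j 1 = 1"
  by (rule field_embedding_hom[OF emb])+

lemma hom_0 [simp]: "j 0 = 0"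
  using hom(1)[of 0 0] by (metis add_0 add_cancel_right_right)

lemma hom_uminus: "j (- x) = - j x"
  using hom(1)[of x "- x"] by (simp add: eq_neg_iff_add_eq_0 add.commute)

lemma hom_diff: "j (x - y) = j x - j y"
  using hom(1)[of x "- y"] hom_uminus[of y] by simp

lemma hom_eq_0 [simp]: "j x = 0 \<longleftrightarrow> x = 0"
proof
  assume "j x = 0"
  then show "x = 0" using hom(2)[of x "inverse x"] hom(3) by (cases "x = 0") auto
qed simp

lemma hom_inj: "j x = j y \<longleftrightarrow> x = y"
  using hom_eq_0[of "x - y"] by (simp add: hom_diff)

lemma hom_divide: "j (x / y) = j x / j y"
  using hom(2)[of "x / y" y] by (cases "y = 0") (auto simp: field_simps)

lemma hom_power: "j (x ^ n) = j x ^ n"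
  by (induction n) (auto simp: hom)

lemma hom_power_int: "j (x powi n) = j x powi n"
proof -
  have "j (inverse y) = inverse (j y)" for y
    using hom_divide[of 1 y] by (simp only: hom(3) inverse_eq_divide)
  then show ?thesis by (simp add: power_int_def hom_power)
qed

lemma hom_sum: "j (sum g I) = (\<Sum>i\<in>I. j (g i))"
  by (induction I rule: infinite_finite_induct) (auto simp: hom)

abbreviation jp :: "'k poly \<Rightarrow> 'l poly" where "jp \<equiv> map_poly j"

lemma coeff_jp [simp]: "Polynomial.coeff (jp g) n = j (Polynomial.coeff g n)"
  by (simp add: coeff_map_poly)

lemma degree_jp [simp]: "Polynomial.degree (jp g) = Polynomial.degree g"
  by (rule degree_map_poly) simp

lemma jp_eq_0 [simp]: "jp g = 0 \<longleftrightarrow> g = 0"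
  by (rule map_poly_eq_0_iff) auto

lemma jp_add: "jp (g + h) = jp g + jp h"
  by (rule poly_eqI) (simp add: hom)

lemma jp_mult: "jp (g * h) = jp g * jp h"
  by (rule poly_eqI) (simp add: coeff_mult hom hom_sum)

lemma jp_power: "jp (g ^ n) = jp g ^ n"
  by (induction n) (auto simp: hom jp_mult)

lemma jp_div_mod: "jp (g div h) = jp g div jp h" "jp (g mod h) = jp g mod jp h"
proof -
  have "jp (g div h) = jp g div jp h \<and> jp (g mod h) = jp g mod jp h"
  proof (cases "h = 0")
    case False
    have eq: "jp g = jp (g div h) * jp h + jp (g mod h)" by (simp flip: jp_mult jp_add)
    show ?thesis
    proof (cases "g mod h = 0")
      case True
      with eq False show ?thesis by simp
    next
      case nz: False
      then have "Polynomial.degree (jp (g mod h)) < Polynomial.degree (jp h)"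
        using degree_mod_less[OF False, of g] by auto
      with False show ?thesis
        by (simp add: eq div_poly_less mod_poly_less poly_div_add_left poly_mod_add_left)
    qed
  qed simp
  then show "jp (g div h) = jp g div jp h" "jp (g mod h) = jp g mod jp h" by auto
qed

text \<open>Allows the polygons over the completion to be computed from expansions over the base
  field.\<close>

lemma jp_phi_coeff: "phi_coeff (jp \<phi>) (jp g) s = jp (phi_coeff \<phi> g s)"
  by (simp add: phi_coeff_def jp_div_mod jp_power)

end

section \<open>Newton polygons\<close>

lemma hull_above_line:
  fixes S :: "(real \<times> real) set"
  assumes "\<And>x y. (x, y) \<in> S \<Longrightarrow> \<gamma> \<le> y - \<mu> * x" and "(x, y) \<in> convex hull S"
  shows "\<gamma> \<le> y - \<mu> * x"
proof -
  have "S \<subseteq> {p. inner (- \<mu>, 1) p \<ge> \<gamma>}"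
  proof
    fix p assume "p \<in> S"
    then show "p \<in> {p. inner (- \<mu>, 1) p \<ge> \<gamma>}"
      using assms(1)[of "fst p" "snd p"] by (simp add: inner_prod_def)
  qed
  then have "convex hull S \<subseteq> {p. inner (- \<mu>, 1) p \<ge> \<gamma>}"
    by (rule hull_minimal) (rule convex_halfspace_ge)
  then have "(x, y) \<in> {p. inner (- \<mu>, 1) p \<ge> \<gamma>}" using assms(2) by (rule subsetD)
  then show ?thesis by simp
qed

locale point_cloud =
  fixes I :: "nat set" and F :: "nat \<Rightarrow> real"
  assumes finite_I: "finite I"
begin

definition cloud :: "(real \<times> real) set" where
  "cloud = (\<lambda>k. (real k, F k)) ` I"

lemma lower_hullD: "(x, y) \<in> lower_hull S \<Longrightarrow> (x, y) \<in> convex hull S"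
  by (simp add: lower_hull_def)

lemma in_cloud: "k \<in> I \<Longrightarrow> (real k, F k) \<in> cloud"
  by (simp add: cloud_def)

lemma above_line:
  assumes "\<And>k. k \<in> I \<Longrightarrow> \<gamma> \<le> F k - \<mu> * real k" and "(x, y) \<in> convex hull cloud"
  shows "\<gamma> \<le> y - \<mu> * x"
  by (rule hull_above_line[OF _ assms(2)]) (use assms(1) in \<open>auto simp: cloud_def\<close>)

lemma abscissa_bounds:
  assumes "\<And>k. k \<in> I \<Longrightarrow> a \<le> real k" "\<And>k. k \<in> I \<Longrightarrow> real k \<le> b" "(x, y) \<in> convex hull cloud"
  shows "a \<le> x" "x \<le> b"
proof -
  have "cloud \<subseteq> {a..b} \<times> UNIV"
  proof
    fix p assume "p \<in> cloud"
    then obtain k where "k \<in> I" "p = (real k, F k)" by (auto simp only: cloud_def)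
    with assms(1,2) show "p \<in> {a..b} \<times> UNIV" by simp
  qed
  then have "convex hull cloud \<subseteq> {a..b} \<times> UNIV"
    by (rule hull_minimal) (rule convex_Times[OF convex_real_interval(5) convex_UNIV])
  then have "(x, y) \<in> {a..b} \<times> UNIV" using assms(3) by (rule subsetD)
  then show "a \<le> x" "x \<le> b" by simp_all
qed

lemma vertex_of_line:
  assumes "k \<in> I" and min: "\<And>i. i \<in> I \<Longrightarrow> F k - \<mu> * real k \<le> F i - \<mu> * real i"
  shows "(real k, F k) \<in> component \<mu> (lower_hull cloud)"
proof -
  have above: "F k - \<mu> * real k \<le> y - \<mu> * x" if "(x, y) \<in> convex hull cloud" for x y
    by (rule above_line[OF min that])
  have "(real k, F k) \<in> convex hull cloud" by (rule hull_inc[OF in_cloud[OF assms(1)]])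
  moreover have "F k \<le> y" if "(real k, y) \<in> convex hull cloud" for y
    using above[OF that] by simp
  ultimately have "(real k, F k) \<in> lower_hull cloud" by (simp add: lower_hull_def)
  moreover have "\<forall>(x, y)\<in>lower_hull cloud. F k - \<mu> * real k \<le> y - \<mu> * x"
    using above lower_hullD by blast
  ultimately show ?thesis by (simp add: component_def)
qed

lemma component_hullD: "(x, y) \<in> component \<mu> (lower_hull S) \<Longrightarrow> (x, y) \<in> convex hull S"
  by (simp add: component_def lower_hull_def)

lemma minimal_vertex:
  assumes "I \<noteq> {}"
  shows "\<exists>k\<in>I. \<forall>i\<in>I. F k - \<mu> * real k \<le> F i - \<mu> * real i"
proof -
  have "Min ((\<lambda>i. F i - \<mu> * real i) ` I) \<in> (\<lambda>i. F i - \<mu> * real i) ` I"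
    using finite_I assms by (intro Min_in) auto
  then obtain k where k: "k \<in> I" "Min ((\<lambda>i. F i - \<mu> * real i) ` I) = F k - \<mu> * real k" by auto
  have "F k - \<mu> * real k \<le> F i - \<mu> * real i" if "i \<in> I" for i
    unfolding k(2)[symmetric] using finite_I that by (intro Min_le) auto
  with k(1) show ?thesis by blast
qed

text \<open>All abscissas lie in [0, d], so a component of length at least \<open>d\<close> has to
  reach abscissa \<open>d\<close>, and the point there must lie on its line.\<close>

lemma long_component_right_end:
  assumes d: "d \<in> I" "\<And>k. k \<in> I \<Longrightarrow> k \<le> d"
    and long: "real d \<le> right_abscissa (component \<mu> (lower_hull cloud)) -
      left_abscissa (component \<mu> (lower_hull cloud))"
    and k: "k \<in> I"
  shows "F d - \<mu> * real d \<le> F k - \<mu> * real k"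
proof -
  let ?C = "component \<mu> (lower_hull cloud)"
  obtain k0 where k0: "k0 \<in> I" and min: "\<And>i. i \<in> I \<Longrightarrow> F k0 - \<mu> * real k0 \<le> F i - \<mu> * real i"
    using minimal_vertex[of \<mu>] d(1) by blast
  define M where "M = F k0 - \<mu> * real k0"
  have p0: "(real k0, F k0) \<in> ?C" by (rule vertex_of_line[OF k0 min])
  then have ne: "fst ` ?C \<noteq> {}" by blast
  have C_val: "y - \<mu> * x \<le> M" if "(x, y) \<in> ?C" for x y
    using that p0 unfolding component_def M_def by blast
  have "0 \<le> left_abscissa ?C" unfolding left_abscissa_def
  proof (rule cInf_greatest[OF ne])
    fix x assume "x \<in> fst ` ?C"
    then obtain y where "(x, y) \<in> ?C" by (metis imageE prod.collapse)
    then have "(x, y) \<in> convex hull cloud" by (rule component_hullD)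
    then show "0 \<le> x" by (rule abscissa_bounds(1)[of 0 "real d", rotated 2]) (use d(2) in auto)
  qed
  with long have right: "real d \<le> right_abscissa ?C" by simp
  have "F d - \<mu> * real d \<le> M"
  proof (rule ccontr)
    define \<delta> where "\<delta> = F d - \<mu> * real d - M"
    assume "\<not> ?thesis"
    then have \<delta>: "\<delta> > 0" by (simp add: \<delta>_def)
    \<comment> \<open>If the point over \<open>d\<close> lies \<delta> above the line, turn the line
      about its point over d - 1 until it meets that point. Abscissas are integers, so no point
      falls below the new line, and the component ends at d - 1 or earlier.\<close>
    have tilt: "M - \<delta> * (real d - 1) \<le> F i - (\<mu> + \<delta>) * real i" if "i \<in> I" for i
    proof (cases "i = d")
      case False
      then have "real i \<le> real d - 1" using d(2)[OF that] by linarith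
      then have "\<delta> * real i \<le> \<delta> * (real d - 1)" using \<delta> by simp
      with min[OF that] show ?thesis by (simp add: M_def algebra_simps)
    qed (simp add: \<delta>_def algebra_simps)
    have "right_abscissa ?C \<le> real d - 1" unfolding right_abscissa_def
    proof (rule cSup_least[OF ne])
      fix x assume "x \<in> fst ` ?C"
      then obtain y where xy: "(x, y) \<in> ?C" by (metis imageE prod.collapse)
      have "M - \<delta> * (real d - 1) \<le> y - (\<mu> + \<delta>) * x"
        by (rule above_line[OF tilt component_hullD[OF xy]])
      with C_val[OF xy] have "\<delta> * x \<le> \<delta> * (real d - 1)" by (simp add: algebra_simps)
      with \<delta> show "x \<le> real d - 1" by simp
    qed
    with right show False by simp
  qed
  with min[OF k] show ?thesis by (simp add: M_def)
qed

text \<open>A point on a side takes the line of that side. The left end point need not lie on a side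
  of negative slope; since no point lies further left, a steep enough line serves there.\<close>

lemma neg_part_supporting_line:
  assumes p: "(x, y) \<in> neg_part (lower_hull cloud)" and "I \<noteq> {}"
  obtains \<mu> where "\<mu> < 0" "\<And>k. k \<in> I \<Longrightarrow> y + \<mu> * (real k - x) \<le> F k"
proof -
  let ?N = "lower_hull cloud"
  consider (left) "(x, y) \<in> ?N" "x = left_abscissa ?N" | (side) \<mu> where "\<mu> < 0" "(x, y) \<in> component \<mu> ?N"
    using p unfolding neg_part_def by fastforce
  then show thesis
  proof cases
    case side
    have "y + \<mu> * (real k - x) \<le> F k" if "k \<in> I" for k
    proof -
      obtain k0 where k0: "k0 \<in> I" and min: "\<And>i. i \<in> I \<Longrightarrow> F k0 - \<mu> * real k0 \<le> F i - \<mu> * real i"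
        using minimal_vertex[of \<mu>] \<open>I \<noteq> {}\<close> by blast
      have "(real k0, F k0) \<in> ?N" using vertex_of_line[OF k0 min] by (simp add: component_def)
      then have "y - \<mu> * x \<le> F k0 - \<mu> * real k0" using side(2) unfolding component_def by blast
      with min[OF that] show ?thesis by (simp add: algebra_simps)
    qed
    with side(1) show thesis by (rule that)
  next
    case left
    define k0 where "k0 = Min I"
    have k0: "k0 \<in> I" "\<And>k. k \<in> I \<Longrightarrow> k0 \<le> k" using finite_I \<open>I \<noteq> {}\<close> by (auto simp: k0_def)
    \<comment> \<open>A line through (x, y) falling by \<open>c\<close> per unit passes below all
      points with abscissa at least x + 1; the added 1 keeps \<open>c\<close> positive.\<close>
    define c where "c = Max ((\<lambda>k. \<bar>y - F k\<bar>) ` I) + 1"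
    have c: "y - F k \<le> c - 1" if "k \<in> I" for k
    proof -
      have "\<bar>y - F k\<bar> \<le> c - 1" unfolding c_def using finite_I that by simp
      then show ?thesis by linarith
    qed
    have c_pos: "c > 0"
    proof -
      have "\<bar>y - F k0\<bar> \<le> c - 1" unfolding c_def using finite_I k0(1) by simp
      then show ?thesis by linarith
    qed
    have xk: "x = real k0"
    proof (rule antisym)
      have ge: "real k0 \<le> x'" if "(x', y') \<in> ?N" for x' y'
        by (rule abscissa_bounds(1)[of _ "real (Max I)", OF _ _ lower_hullD[OF that]])
          (use finite_I k0(2) in auto)
      show "real k0 \<le> x" by (rule ge[OF left(1)])
      \<comment> \<open>Puts the leftmost point on the hull, so that its abscissa is the infimum
        \<open>left_abscissa\<close>.\<close>
      have steep: "F k0 + c' * real k0 \<le> F i + c' * real i"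
        if "i \<in> I" "c' = Max ((\<lambda>k. \<bar>F k0 - F k\<bar>) ` I)" for i c'
      proof (cases "i = k0")
        case False
        with k0(2)[OF that(1)] have "1 \<le> real i - real k0" by linarith
        moreover have "\<bar>F k0 - F i\<bar> \<le> c'" using finite_I that by simp
        ultimately have "c' * 1 \<le> c' * (real i - real k0)" by (intro mult_left_mono) auto
        with \<open>\<bar>F k0 - F i\<bar> \<le> c'\<close> show ?thesis by (simp add: algebra_simps)
      qed simp
      have "(real k0, F k0) \<in> component (- Max ((\<lambda>k. \<bar>F k0 - F k\<bar>) ` I)) ?N"
        using steep by (intro vertex_of_line[OF k0(1)]) simp
      then have "(real k0, F k0) \<in> ?N" by (simp add: component_def)
      then have "real k0 \<in> fst ` ?N" by (rule image_eqI[rotated]) simp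
      moreover have "bdd_below (fst ` ?N)" using ge by (intro bdd_belowI[of _ "real k0"]) fastforce
      ultimately show "x \<le> real k0" unfolding left(2) left_abscissa_def by (rule cInf_lower)
    qed
    have "y + (- c) * (real k - x) \<le> F k" if "k \<in> I" for k
    proof (cases "k = k0")
      case True
      have "(x, F k0) \<in> convex hull cloud" unfolding xk by (rule hull_inc[OF in_cloud[OF k0(1)]])
      then have "y \<le> F k0" using left(1) by (simp add: lower_hull_def)
      with True xk show ?thesis by simp
    next
      case False
      with k0(2)[OF that] xk have "1 \<le> real k - x" by linarith
      then have "c * 1 \<le> c * (real k - x)" using c_pos by (intro mult_left_mono) auto
      with c[OF that] show ?thesis by simp
    qed
    with c_pos show thesis by (intro that[of "- c"]) auto
  qed
qed

end

section \<open>Discrete valuations and the Gauss valuation\<close>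

locale discrete_val =
  fixes v :: "'k::field \<Rightarrow> int"
  assumes disc: "discrete_valuation v"
begin

lemma val_mult: "x \<noteq> 0 \<Longrightarrow> y \<noteq> 0 \<Longrightarrow> v (x * y) = v x + v y"
  and val_add: "x \<noteq> 0 \<Longrightarrow> y \<noteq> 0 \<Longrightarrow> x + y \<noteq> 0 \<Longrightarrow> min (v x) (v y) \<le> v (x + y)"
  using disc by (auto simp: discrete_valuation_def)

lemma val_1: "v 1 = 0"
  using val_mult[of 1 1] by simp

lemma val_uminus: "v (- x) = v x"
proof -
  have "v (- 1) = 0" using val_mult[of "-1" "-1"] val_1 by simp
  then show ?thesis using val_mult[of "-1" x] by (cases "x = 0") auto
qed

abbreviation rv :: "'k \<Rightarrow> real" where "rv x \<equiv> real_of_int (v x)"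

lemma vge_add: "vge rv x z \<Longrightarrow> vge rv y z \<Longrightarrow> vge rv (x + y) z"
  using val_add[of x y] by (cases "x = 0"; cases "y = 0"; cases "x + y = 0") (auto simp: vge_def min_def split: if_splits)

lemma quasi_rv: "quasi_val rv"
proof -
  have "vge rv (- y) z" if "vge rv y z" for y z using that by (auto simp: vge_def val_uminus)
  then have "vge rv (x - y) z" if "vge rv x z" "vge rv y z" for x y z
    using vge_add[OF that(1), of "- y"] that(2) by simp
  moreover have "vge rv (x * y) (a + b)" if "vge rv x a" "vge rv y b" for x y a b
    using that val_mult[of x y] by (cases "x = 0"; cases "y = 0") (auto simp: vge_def)
  ultimately show ?thesis by (simp add: quasi_val_def)
qed

definition gauss :: "'k poly \<Rightarrow> real" where "gauss g = real_of_int (gauss_val v g)"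

lemma vge_gauss: "vge gauss g x \<longleftrightarrow> (\<forall>n. vge rv (Polynomial.coeff g n) x)"
proof (cases "g = 0")
  case False
  let ?C = "{c \<in> set (coeffs g). c \<noteq> 0}"
  have C: "?C = {Polynomial.coeff g n | n. Polynomial.coeff g n \<noteq> 0}"
  proof (rule subset_antisym; rule subsetI)
    fix c
    show "c \<in> {Polynomial.coeff g n | n. Polynomial.coeff g n \<noteq> 0}" if "c \<in> ?C"
    proof -
      have "c \<in> range (Polynomial.coeff g)" "c \<noteq> 0" using that by (simp_all add: range_coeff)
      then show ?thesis by blast
    qed
    show "c \<in> ?C" if c: "c \<in> {Polynomial.coeff g n | n. Polynomial.coeff g n \<noteq> 0}"
    proof -
      obtain n where n: "c = Polynomial.coeff g n" "c \<noteq> 0" using c by blast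
      have "Polynomial.coeff g n \<in> insert 0 (set (coeffs g))" by (subst range_coeff[symmetric]) (rule rangeI)
      with n show ?thesis by simp
    qed
  qed
  have "\<exists>n. Polynomial.coeff g n \<noteq> 0" using False by (intro exI[of _ "Polynomial.degree g"]) simp
  then have ne: "?C \<noteq> {}" unfolding C by blast
  \<comment> \<open>The minimum is an integer, so the real bound may be rounded up first.\<close>
  have "x \<le> gauss g \<longleftrightarrow> \<lceil>x\<rceil> \<le> Min (v ` ?C)" unfolding gauss_def gauss_val_def by (simp add: ceiling_le_iff)
  also have "\<dots> \<longleftrightarrow> (\<forall>c\<in>?C. \<lceil>x\<rceil> \<le> v c)" using ne by (subst Min_ge_iff) auto
  also have "\<dots> \<longleftrightarrow> (\<forall>n. vge rv (Polynomial.coeff g n) x)"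
    unfolding C by (auto simp: vge_def ceiling_le_iff)
  finally show ?thesis using False by (simp add: vge_def)
qed simp

lemma quasi_gauss: "quasi_val gauss"
  unfolding quasi_val_def vge_gauss coeff_mult coeff_diff
  by (intro conjI allI impI quasi_val_diff[OF quasi_rv] quasi_val_sum[OF quasi_rv]
      quasi_val_mult[OF quasi_rv]) auto

lemma gauss_monic:
  assumes "monic \<phi>" and int: "\<phi> \<in> poly_over (valuation_ring v)"
  shows "gauss \<phi> = 0" "vge gauss \<phi> 0"
proof -
  have ne: "\<phi> \<noteq> 0" using assms(1) by (auto simp: monic_def)
  have "0 \<in> valuation_ring v" by (simp add: valuation_ring_def)
  then show *: "vge gauss \<phi> 0"
    using int by (simp add: vge_gauss poly_over_iff) (auto simp: vge_def valuation_ring_def)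
  have "vge rv (Polynomial.lead_coeff \<phi>) (gauss \<phi>)" using vge_gauss vge_refl by blast
  then have "gauss \<phi> \<le> 0" using assms(1) by (simp add: monic_def vge_def val_1 del: leading_coeff_0_iff)
  with * ne show "gauss \<phi> = 0" by (auto simp: vge_def)
qed

text \<open>The coefficients of \<open>q\<close> are bounded from the top. With m the degree of the
  monic \<phi>, coefficient n of \<open>q\<close> is coefficient n + m of
  \<open>q * \<phi> + \<rho>\<close>, out of reach of \<rho>, minus products of higher coefficients
  of \<open>q\<close> with integral coefficients of \<phi>.\<close>

lemma key_gauss:
  assumes monic: "monic \<phi>" and int: "\<phi> \<in> poly_over (valuation_ring v)"
    and deg: "Polynomial.degree \<phi> > 0"
  shows "key_pair gauss \<phi>"
proof
  let ?m = "Polynomial.degree \<phi>"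
  show "quasi_val gauss" by (rule quasi_gauss)
  have \<phi>: "vge rv (Polynomial.coeff \<phi> n) 0" for n using gauss_monic(2)[OF monic int] vge_gauss by blast
  have "vge gauss q x" if \<rho>: "Polynomial.degree \<rho> < ?m" and ge: "vge gauss (q * \<phi> + \<rho>) x" for q \<rho> x
  proof -
    have "vge rv (Polynomial.coeff q n) x" for n
    proof (induction "Polynomial.degree q - n" arbitrary: n rule: less_induct)
      case less
      show ?case
      proof (cases "n \<le> Polynomial.degree q")
        case True
        let ?f = "\<lambda>i. Polynomial.coeff q i * Polynomial.coeff \<phi> (n + ?m - i)"
        have "Polynomial.coeff (q * \<phi> + \<rho>) (n + ?m) = (\<Sum>i\<le>n + ?m. ?f i)"
          using \<rho> by (simp add: coeff_mult coeff_eq_0)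
        also have "\<dots> = (\<Sum>i\<in>{..n + ?m} - {n}. ?f i) + ?f n"
          by (subst sum.remove[of _ n]) (auto simp: add.commute)
        finally have "Polynomial.coeff q n =
            Polynomial.coeff (q * \<phi> + \<rho>) (n + ?m) - (\<Sum>i\<in>{..n + ?m} - {n}. ?f i)"
          using monic by (simp add: monic_def)
        moreover have "vge rv (\<Sum>i\<in>{..n + ?m} - {n}. ?f i) x"
        proof (rule quasi_val_sum[OF quasi_rv])
          fix i assume i: "i \<in> {..n + ?m} - {n}"
          show "vge rv (?f i) x"
          proof (cases "i < n")
            case False
            then have "Polynomial.degree q - i < Polynomial.degree q - n \<or> Polynomial.coeff q i = 0"
              using i by (cases "i \<le> Polynomial.degree q") (auto simp: coeff_eq_0)
            then have "vge rv (Polynomial.coeff q i) x" using less by auto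
            from quasi_val_mult[OF quasi_rv this \<phi>] show ?thesis by simp
          qed (simp add: coeff_eq_0)
        qed
        moreover have "vge rv (Polynomial.coeff (q * \<phi> + \<rho>) (n + ?m)) x" using ge vge_gauss by blast
        ultimately show ?thesis by (simp only: quasi_val_diff[OF quasi_rv])
      qed (simp add: coeff_eq_0)
    qed
    then show ?thesis by (simp add: vge_gauss)
  qed
  then show "key_poly gauss \<phi>"
    using gauss_monic(1)[OF monic int] monic deg by (auto simp: key_poly_def)
qed

end

section \<open>The valuations of a type\<close>

lemma psi_degree_pos:
  assumes "monic \<psi>" "irreducible_in D \<psi>"
  shows "Polynomial.degree \<psi> > 0"
proof (rule ccontr)
  assume "\<not> ?thesis"
  then have "\<psi> = 1"
    using assms(1) unfolding monic_def by (metis coeff_pCons_0 degree_eq_zeroE gr0I one_pCons)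
  with assms(2) show False by (auto simp: irreducible_in_def unit_in_def)
qed

lemma is_type_mono: "is_type T n \<Longrightarrow> i \<le> n \<Longrightarrow> is_type T i"
  by (induction n) (auto simp: le_Suc_eq)

lemma is_type_psi:
  assumes "is_type T i"
  shows "Polynomial.degree (t_psi T i) > 0"
  using assms psi_degree_pos by (cases i) auto

lemma is_type_ram_pos: "is_type T i \<Longrightarrow> ram T i > 0"
  by (cases i) (auto simp: ram_def)

lemma is_type_mdeg_pos: "is_type T i \<Longrightarrow> mdeg T (Suc i) > 0"
proof (induction i)
  case 0
  then show ?case using is_type_psi[of T 0] is_type_ram_pos[of T 0] by simp
next
  case (Suc i)
  then show ?case using is_type_psi[OF Suc.prems] is_type_ram_pos[OF Suc.prems] by simp
qed

lemma Min_scaled: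
  fixes F G :: "nat \<Rightarrow> real"
  assumes "finite S" "S \<noteq> {}" "c > 0" "\<And>s. s \<in> S \<Longrightarrow> F s = c * G s"
  shows "Min (F ` S) = c * Min (G ` S)"
proof -
  have "mono ((*) c)" using assms(3) by (auto intro!: monoI)
  then have "c * Min (G ` S) = Min ((*) c ` G ` S)" using assms by (intro mono_Min_commute) auto
  also have "(*) c ` G ` S = F ` S" using assms(4) by (force simp: image_image)
  finally show ?thesis by simp
qed

text \<open>\<open>\<iota>\<close> leads to the completion, where the type lives, and
  \<open>ev\<close> to the larger field, where \<open>W\<close> is to be bounded.
  \<open>gauss_le\<close> is the base case of the comparison.\<close>

locale type_over = embedding \<iota> + evaluation ev W
  for \<iota> :: "'k::field \<Rightarrow> 'c::field" and ev :: "'k poly \<Rightarrow> 'l::field" and W +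
  fixes T :: "('c, 'w::field) type_data" and \<phi> :: "nat \<Rightarrow> 'k poly" and r :: nat
  assumes r: "r \<ge> 1" and type: "is_type T (r - 1)" and repr: "representative T (r - 1) (t_phi T r)"
    and phi: "\<And>i. 1 \<le> i \<Longrightarrow> i \<le> r \<Longrightarrow> t_phi T i = map_poly \<iota> (\<phi> i)"
    and disc_T: "discrete_valuation (\<lambda>x. t_val T (\<iota> x))"
    and gauss_le: "\<And>a x. vge (discrete_val.gauss (\<lambda>x. t_val T (\<iota> x))) a x \<Longrightarrow> vge W (ev a) x"
begin

sublocale discrete_val "\<lambda>x. t_val T (\<iota> x)"
  by unfold_locales (rule disc_T)

lemma representatives:
  assumes "1 \<le> i" "i \<le> r"
  shows "representative T (i - 1) (t_phi T i)"
proof (cases "i = r")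
  case False
  then have "is_type T i" using is_type_mono[OF type, of i] assms by simp
  then show ?thesis using assms by (cases i) auto
qed (use repr in simp)

lemma phi_props:
  assumes "1 \<le> i" "i \<le> r"
  shows "monic (\<phi> i)" "\<phi> i \<in> poly_over (valuation_ring (\<lambda>x. t_val T (\<iota> x)))"
    "Polynomial.degree (\<phi> i) = mdeg T i" "Polynomial.degree (\<phi> i) > 0"
proof -
  note rep = representatives[OF assms, unfolded representative_def phi[OF assms]]
  have "\<iota> (Polynomial.lead_coeff (\<phi> i)) = \<iota> 1" using rep unfolding monic_def hom(3) degree_jp coeff_jp by blast
  then show "monic (\<phi> i)" unfolding hom_inj monic_def .
  have z: "0 \<in> valuation_ring (t_val T)" "0 \<in> valuation_ring (\<lambda>x. t_val T (\<iota> x))"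
    by (auto simp: valuation_ring_def)
  show "\<phi> i \<in> poly_over (valuation_ring (\<lambda>x. t_val T (\<iota> x)))"
    using rep z by (auto simp: poly_over_iff valuation_ring_def)
  show "Polynomial.degree (\<phi> i) = mdeg T i" using rep assms by simp
  then show "Polynomial.degree (\<phi> i) > 0"
    using is_type_mdeg_pos[OF is_type_mono[OF type, of "i - 1"]] assms by simp
qed

definition E :: "nat \<Rightarrow> nat" where "E i = (\<Prod>k<i. ram T k)"

lemma E_pos: "i \<le> r \<Longrightarrow> E i > 0"
  using is_type_ram_pos[OF is_type_mono[OF type]] r unfolding E_def by (intro prod_pos) auto

definition support :: "nat \<Rightarrow> 'k poly \<Rightarrow> nat set" where
  "support i g = {s. phi_coeff (\<phi> i) g s \<noteq> 0}"

definition height :: "nat \<Rightarrow> 'k poly \<Rightarrow> nat \<Rightarrow> real" where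
  "height i g s = real_of_int (tv T i (jp (phi_coeff (\<phi> i) g s * \<phi> i ^ s)))"

lemma NP_cloud:
  assumes "1 \<le> i" "i \<le> r"
  shows "point_cloud (support i g)"
    "NP T i (jp g) = lower_hull (point_cloud.cloud (support i g) (height i g))"
proof -
  show pc: "point_cloud (support i g)"
    using finite_phi_coeff_support[OF phi_props(4)[OF assms]] by (simp add: support_def point_cloud_def)
  show "NP T i (jp g) = lower_hull (point_cloud.cloud (support i g) (height i g))"
    unfolding point_cloud.cloud_def[OF pc]
    by (simp add: NP_def newton_point_def phi[OF assms] jp_phi_coeff support_def height_def jp_mult jp_power)
qed

text \<open>A residual polynomial of degree \<open>f\<^sub>i\<close> forces the \<open>\<lambda>\<^sub>i\<close>-component to have length
  \<open>e\<^sub>i f\<^sub>i = m\<^sub>i\<^sub>+\<^sub>1 / m\<^sub>i\<close>, hence to contain the right end point of the polygon.\<close>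

lemma representative_right_end:
  assumes i: "1 \<le> i" "Suc i \<le> r" and d: "d = t_e T i * Polynomial.degree (t_psi T i)"
    and s: "phi_coeff (\<phi> i) (\<phi> (Suc i)) s \<noteq> 0"
  shows "height i (\<phi> (Suc i)) d - slope T i * real d \<le>
    height i (\<phi> (Suc i)) s - slope T i * real s"
proof -
  have i': "i \<le> r" using i by simp
  have type_i: "is_type T i" by (rule is_type_mono[OF type]) (use i in simp)
  then obtain i0 where i0: "i = Suc i0" using i by (cases i) auto
  have e: "t_e T i > 0" using type_i by (simp add: i0)
  have f: "Polynomial.degree (t_psi T i) > 0" by (rule is_type_psi[OF type_i])
  have d_pos: "d > 0" using e f d by simp
  note p = phi_props[OF i(1) i'] and p' = phi_props[of "Suc i", OF _ i(2), simplified]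
  have deg: "Polynomial.degree (\<phi> (Suc i)) = d * Polynomial.degree (\<phi> i)"
    using p'(3) p(3) i by (simp add: d ram_def)
  interpret pc: point_cloud "support i (\<phi> (Suc i))" "height i (\<phi> (Suc i))"
    by (rule NP_cloud(1)[OF i(1) i'])
  obtain c where c: "c \<noteq> 0" "respol T i (t_phi T (Suc i)) = Polynomial.smult c (t_psi T i)"
    using representatives[of "Suc i"] i by (auto simp: representative_def)
  let ?g = "t_phi T (Suc i)"
  \<comment> \<open>Whatever its coefficients, the residual polynomial has no monomial beyond
    \<open>comp_degree\<close>, so its known degree bounds \<open>comp_degree\<close> from
    below.\<close>
  have "Polynomial.degree (respol T i ?g) \<le> comp_degree T i ?g"
    unfolding i0 by (simp, rule degree_sum_le)
      (auto intro!: order_trans[OF degree_monom_le])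
  then have cd: "Polynomial.degree (t_psi T i) \<le> comp_degree T i ?g" using c by simp
  let ?C = "component (slope T i) (lower_hull pc.cloud)"
  have "slope_component T i ?g = ?C"
    using phi[of "Suc i"] i NP_cloud(2)[OF i(1) i'] by (simp add: slope_component_def)
  then have "Polynomial.degree (t_psi T i) \<le>
      nat \<lfloor>(right_abscissa ?C - left_abscissa ?C) / real (t_e T i)\<rfloor>"
    using cd by (simp add: comp_degree_def)
  \<comment> \<open>Positivity of this degree rules out that \<open>nat\<close> has cut off a
    negative number.\<close>
  then have "real (Polynomial.degree (t_psi T i)) \<le> (right_abscissa ?C - left_abscissa ?C) / real (t_e T i)"
    using f by linarith
  then have long: "real d \<le> right_abscissa ?C - left_abscissa ?C"
    using e by (simp add: d field_simps)
  have "d \<in> support i (\<phi> (Suc i))"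
    using phi_coeff_top[OF p'(1) p(1,4) deg d_pos] by (simp add: support_def)
  moreover have "k \<le> d" if "k \<in> support i (\<phi> (Suc i))" for k
  proof (rule ccontr)
    assume "\<not> k \<le> d"
    moreover have "Polynomial.degree (\<phi> (Suc i)) < Suc d * Polynomial.degree (\<phi> i)" using deg p(4) by simp
    ultimately have "phi_coeff (\<phi> i) (\<phi> (Suc i)) k = 0" by (intro phi_coeff_low_degree[of _ "Suc d"]) auto
    with that show False by (simp add: support_def)
  qed
  ultimately show ?thesis using s by (intro pc.long_component_right_end[OF _ _ long]) (auto simp: support_def)
qed

text \<open>Each level rescales the integer valuations of the type; dividing by \<open>E i\<close>
  makes \<open>u\<close> extend the valuation of the base field, as w_P does.\<close>

definition scaled_val :: "nat \<Rightarrow> ('k poly \<Rightarrow> real) \<Rightarrow> bool" where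
  "scaled_val i u \<longleftrightarrow> (\<forall>g. g \<noteq> 0 \<longrightarrow> real_of_int (tv T i (jp g)) = real (E i) * u g)"

lemma scaled_height:
  assumes "key_pair u (\<phi> i)" "scaled_val i u" "phi_coeff (\<phi> i) g s \<noteq> 0"
  shows "height i g s = real (E i) * (u (phi_coeff (\<phi> i) g s) + real s * u (\<phi> i))"
proof -
  interpret key_pair u "\<phi> i" by (rule assms(1))
  show ?thesis
    using assms(2,3) value_mult_power[OF assms(3), of s] by (simp add: height_def scaled_val_def)
qed

lemma val_chain:
  assumes "1 \<le> i" "i \<le> r"
  shows "\<exists>u G. key_pair u (\<phi> i) \<and> scaled_val i u \<and> excess u (\<phi> i) G"
  using assms
proof (induction i rule: dec_induct)
  case base
  note p = phi_props[OF order_refl base]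
  have "gauss_val (t_val T) (jp g) = gauss_val (\<lambda>x. t_val T (\<iota> x)) g" for g
  proof -
    have "coeffs (jp g) = map \<iota> (coeffs g)" by (rule coeffs_map_poly') simp
    then have "{c \<in> set (coeffs (jp g)). c \<noteq> 0} = \<iota> ` {c \<in> set (coeffs g). c \<noteq> 0}" by auto
    then show ?thesis by (simp add: gauss_val_def image_image)
  qed
  then have "scaled_val 1 gauss" by (simp add: scaled_val_def E_def ram_def gauss_def)
  moreover have "excess gauss (\<phi> 1) 0" using gauss_le by (simp add: excess_def)
  ultimately show ?case using key_gauss[OF p(1,2,4)] by blast
next
  case (step i)
  then obtain u G where u: "key_pair u (\<phi> i)" "scaled_val i u" and G: "excess u (\<phi> i) G" by auto
  interpret key_pair u "\<phi> i" by (rule u(1))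
  have type_i: "is_type T i" by (rule is_type_mono[OF type]) (use step in simp)
  then obtain i0 where i0: "i = Suc i0" using step by (cases i) auto
  define d where "d = t_e T i * Polynomial.degree (t_psi T i)"
  have pos: "t_e T i > 0" "t_h T i > 0" using type_i by (auto simp: i0)
  have d_pos: "d > 0" using pos(1) is_type_psi[OF type_i] by (simp add: d_def)
  have E_i: "E i > 0" by (rule E_pos) (use step in simp)
  have E_Suc: "E (Suc i) = E i * t_e T i" by (simp add: E_def ram_def i0)
  \<comment> \<open>v_{i+1}(\<phi>_i) = e_i V_i + h_i, divided by \<open>E (Suc i)\<close>.\<close>
  define \<nu> where "\<nu> = u (\<phi> i) + real (t_h T i) / (real (E i) * real (t_e T i))"
  interpret augmented u "\<phi> i" \<nu> by unfold_locales (use pos E_i in \<open>simp add: \<nu>_def\<close>)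
  have i': "i \<le> r" "1 \<le> i" using step by auto
  note p = phi_props[OF i'(2,1)] and p' = phi_props[of "Suc i", OF _ step.prems, simplified]
  have deg: "Polynomial.degree (\<phi> (Suc i)) = d * Polynomial.degree (\<phi> i)"
    using p'(3) p(3) by (simp add: d_def ram_def i0)
  have coeffs: "vge u (phi_coeff (\<phi> i) (\<phi> (Suc i)) s) ((real d - real s) * \<nu>)" if "s < d" for s
  proof (cases "phi_coeff (\<phi> i) (\<phi> (Suc i)) s = 0")
    case False
    have top: "phi_coeff (\<phi> i) (\<phi> (Suc i)) d = 1" by (rule phi_coeff_top[OF p'(1) p(1,4) deg d_pos])
    \<comment> \<open>The inequality between the points over \<open>d\<close> and \<open>s\<close>,
      whose slope term is then moved into \<nu>; the coefficient over \<open>d\<close> is 1 and has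
      value 0.\<close>
    have "real (E i) * (real d * u (\<phi> i)) + real (t_h T i) / real (t_e T i) * real d \<le>
        real (E i) * (u (phi_coeff (\<phi> i) (\<phi> (Suc i)) s) + real s * u (\<phi> i)) +
        real (t_h T i) / real (t_e T i) * real s"
      using representative_right_end[OF i'(2) step.prems d_def False]
        scaled_height[OF u False] scaled_height[OF u, of "\<phi> (Suc i)" d]
      by (simp add: top value_1 slope_def)
    also have "real (E i) * (real d * u (\<phi> i)) + real (t_h T i) / real (t_e T i) * real d =
        real (E i) * (real d * \<nu>)" using E_i by (simp add: \<nu>_def field_simps)
    also have "real (E i) * (u (phi_coeff (\<phi> i) (\<phi> (Suc i)) s) + real s * u (\<phi> i)) +
        real (t_h T i) / real (t_e T i) * real s =
        real (E i) * (u (phi_coeff (\<phi> i) (\<phi> (Suc i)) s) + real s * \<nu>)"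
      using E_i by (simp add: \<nu>_def field_simps)
    finally have "real d * \<nu> \<le> u (phi_coeff (\<phi> i) (\<phi> (Suc i)) s) + real s * \<nu>"
      using E_i by simp
    then show ?thesis by (simp add: vge_def algebra_simps)
  qed simp
  have "scaled_val (Suc i) u'"
    unfolding scaled_val_def
  proof (intro allI impI)
    fix g :: "'k poly" assume g: "g \<noteq> 0"
    let ?S = "support i g"
    let ?F = "\<lambda>s. int (t_e T i) * tv T i (jp (phi_coeff (\<phi> i) g s * \<phi> i ^ s)) + int s * int (t_h T i)"
    let ?G = "\<lambda>s. u (phi_coeff (\<phi> i) g s) + real s * \<nu>"
    have S: "finite ?S" "?S \<noteq> {}"
      using finite_phi_coeff_support[OF p(4)] phi_coeff_support_nonempty[OF p(4) g]
      by (auto simp: support_def)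
    have "tv T (Suc i) (jp g) = Min (?F ` ?S)"
      using i'(2) by (auto simp: phi[OF i'(2,1)] jp_phi_coeff jp_mult jp_power support_def
        intro!: arg_cong[of _ _ Min])
    then have "real_of_int (tv T (Suc i) (jp g)) = Min (real_of_int ` ?F ` ?S)"
      using S mono_Min_commute[of real_of_int "?F ` ?S"] by (simp add: mono_def)
    also have "\<dots> = Min ((\<lambda>s. real_of_int (?F s)) ` ?S)" by (simp add: image_image)
    also have "\<dots> = real (E (Suc i)) * Min (?G ` ?S)"
    proof (rule Min_scaled[OF S])
      show "real (E (Suc i)) > 0" using E_i pos E_Suc by simp
      fix s assume "s \<in> ?S"
      then have "height i g s = real (E i) * (u (phi_coeff (\<phi> i) g s) + real s * u (\<phi> i))"
        by (intro scaled_height[OF u]) (simp add: support_def)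
      then have "real_of_int (?F s) = real (t_e T i) * (real (E i) *
          (u (phi_coeff (\<phi> i) g s) + real s * u (\<phi> i))) + real s * real (t_h T i)"
        by (simp add: height_def)
      also have "\<dots> = real (E (Suc i)) * ?G s"
      proof -
        have "e' * (E' * (a + t * b)) + t * h = E' * e' * (a + t * (b + h / (E' * e')))"
          if "e' > 0" "E' > 0" for e' E' a b t h :: real
        proof -
          define q where "q = h / (E' * e')"
          have "h = E' * e' * q" using that by (simp add: q_def)
          then show ?thesis unfolding q_def[symmetric] by (simp add: algebra_simps)
        qed
        then show ?thesis using pos E_i by (simp add: E_Suc \<nu>_def)
      qed
      finally show "real_of_int (?F s) = real (E (Suc i)) * ?G s" .
    qed
    also have "Min (?G ` ?S) = u' g"
      unfolding augmentation_def support_def by (rule arg_cong[of _ _ Min]) auto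
    finally show "real_of_int (tv T (Suc i) (jp g)) = real (E (Suc i)) * u' g" .
  qed
  moreover have "key_pair u' (\<phi> (Suc i))"
    by unfold_locales (rule quasi_u', rule key_augmentation(2)[OF p'(1) deg d_pos coeffs])
  moreover have "\<exists>G'. excess u' (\<phi> (Suc i)) G'"
    by (rule excess_augmentation[OF augmented_axioms G p'(1) deg d_pos coeffs])
  ultimately show ?case by blast
qed

theorem quotient_value:
  assumes root: "ev f = 0" and f: "f \<noteq> 0" and y: "(real s, y) \<in> NP_neg T r (map_poly \<iota> f)"
  shows "vge W (ev (phi_quotient (\<phi> r) f s)) ((y - real s * real_of_int (phi_val T r)) / real (E r))"
proof -
  obtain u G where u: "key_pair u (\<phi> r)" "scaled_val r u" and G: "excess u (\<phi> r) G"
    using val_chain[OF r order_refl] by auto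
  interpret key_pair u "\<phi> r" by (rule u(1))
  interpret pc: point_cloud "support r f" "height r f" by (rule NP_cloud(1)[OF r order_refl])
  have Er: "real (E r) > 0" using E_pos[of r] by simp
  have "support r f \<noteq> {}" using phi_coeff_support_nonempty[OF degree_pos f] by (simp add: support_def)
  then obtain \<mu> where \<mu>: "\<mu> < 0" "\<And>k. k \<in> support r f \<Longrightarrow> y + \<mu> * (real k - real s) \<le> height r f k"
    using pc.neg_part_supporting_line[of "real s" y] y by (metis NP_neg_def NP_cloud(2)[OF r order_refl])
  have V: "real_of_int (phi_val T r) = real (E r) * u (\<phi> r)"
    using u(2) r phi[OF r order_refl] by (simp add: phi_val_def scaled_val_def)
  let ?H = "(y - real s * real_of_int (phi_val T r)) / real (E r)"
  \<comment> \<open>The heights belong to a_k \<phi>^k. After division by \<open>E r\<close>, taking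
    off \<open>u (\<phi> r)\<close> per unit of abscissa turns the line into one for the
    a_k.\<close>
  let ?\<mu> = "\<mu> / real (E r) - u (\<phi> r)"
  have "vge u (phi_coeff (\<phi> r) f k) (?H + (real k - real s) * ?\<mu>)" for k
  proof (cases "phi_coeff (\<phi> r) f k = 0")
    case False
    then have "y + \<mu> * (real k - real s) \<le> real (E r) * (u (phi_coeff (\<phi> r) f k) + real k * u (\<phi> r))"
      using \<mu>(2)[of k] scaled_height[OF u False] by (simp add: support_def)
    then have "(y + \<mu> * (real k - real s)) / real (E r) \<le> u (phi_coeff (\<phi> r) f k) + real k * u (\<phi> r)"
      using Er by (simp add: field_simps)
    moreover have "?H + (real k - real s) * ?\<mu> = (y + \<mu> * (real k - real s)) / real (E r) - real k * u (\<phi> r)"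
      unfolding V using Er by (simp add: field_simps)
    ultimately show ?thesis by (simp add: vge_def)
  qed simp
  moreover have "?\<mu> \<le> - u (\<phi> r)" using \<mu>(1) Er by (simp add: divide_nonpos_pos)
  ultimately show ?thesis unfolding phi_quotient_def by (intro quotient_bound[OF degree_pos G root])
qed

end

section \<open>The discrete valuation attached to a prime of the integral closure\<close>

section \<open>Discrete valuation rings as localizations\<close>

lemma ring_on_simps [simp]:
  "carrier (ring_on D) = D"
  "monoid.mult (ring_on D) = (*)"
  "one (ring_on D) = 1"
  "ring.zero (ring_on D) = 0"
  "add (ring_on D) = (+)"
  by (simp_all add: ring_on_def)

locale prime_of_subring =
  fixes D P :: "'a::field set"
  assumes prime: "primeideal P (ring_on D)"
begin

lemma cring_D: "cring (ring_on D)"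
  using prime by (simp add: primeideal_def)

lemma ideal_P: "ideal P (ring_on D)"
  using prime by (simp add: primeideal_def)

lemma D_closed: "0 \<in> D" "1 \<in> D" "x \<in> D \<Longrightarrow> y \<in> D \<Longrightarrow> x + y \<in> D" "x \<in> D \<Longrightarrow> y \<in> D \<Longrightarrow> x * y \<in> D"
  and D_uminus: "x \<in> D \<Longrightarrow> - x \<in> D"
proof -
  interpret cring "ring_on D" by (rule cring_D)
  show "0 \<in> D" "1 \<in> D" "x \<in> D \<Longrightarrow> y \<in> D \<Longrightarrow> x + y \<in> D" "x \<in> D \<Longrightarrow> y \<in> D \<Longrightarrow> x * y \<in> D"
    using zero_closed one_closed a_closed[of x y] m_closed[of x y] by simp_all
  assume x: "x \<in> D"
  have "a_inv (ring_on D) x \<in> D" "x + a_inv (ring_on D) x = 0"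
    using a_inv_closed[of x] r_neg[of x] x by simp_all
  then show "- x \<in> D" by (metis add_eq_0_iff)
qed

lemma D_diff: "x \<in> D \<Longrightarrow> y \<in> D \<Longrightarrow> x - y \<in> D"
  using D_closed(3)[of x "- y"] D_uminus[of y] by simp

lemma D_power: "x \<in> D \<Longrightarrow> x ^ n \<in> D"
  by (induction n) (auto intro: D_closed)

lemma P_subset: "x \<in> P \<Longrightarrow> x \<in> D"
  using ideal.Icarr[OF ideal_P] by simp

lemma P_closed: "0 \<in> P" "x \<in> P \<Longrightarrow> y \<in> P \<Longrightarrow> x + y \<in> P" "x \<in> P \<Longrightarrow> y \<in> D \<Longrightarrow> x * y \<in> P"
  using additive_subgroup.zero_closed[OF ideal.axioms(1)[OF ideal_P]]
    additive_subgroup.a_closed[OF ideal.axioms(1)[OF ideal_P], of x y]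
    ideal.I_r_closed[OF ideal_P, of x y] by simp_all

lemma one_notin: "1 \<notin> P"
proof
  assume "1 \<in> P"
  then have "D \<subseteq> P" using P_closed(3)[of 1] by auto
  then have "P = D" using P_subset by blast
  then show False using primeideal.I_notcarr[OF prime] by simp
qed

lemma compl_mult: "x \<in> D - P \<Longrightarrow> y \<in> D - P \<Longrightarrow> x * y \<in> D - P"
  using primeideal.I_prime[OF prime, of x y] D_closed(4)[of x y] by auto

lemma compl_one: "1 \<in> D - P" using one_notin D_closed by auto

lemma compl_nonzero: "x \<in> D - P \<Longrightarrow> x \<noteq> 0" using P_closed(1) by auto

lemma P_uminus: "x \<in> P \<Longrightarrow> - x \<in> P"
  using P_closed(3)[of x "- 1"] D_uminus[OF D_closed(2)] by simp

lemma P_prime: "x * y \<in> P \<Longrightarrow> x \<in> D \<Longrightarrow> y \<in> D \<Longrightarrow> x \<in> P \<or> y \<in> P"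
  using compl_mult[of x y] by auto

definition units :: "'a set" where "units = {a / b | a b. a \<in> D - P \<and> b \<in> D - P}"

definition local_ring :: "'a set" where "local_ring = {a / b | a b. a \<in> D \<and> b \<in> D - P}"

definition local_max :: "'a set" where "local_max = {a / b | a b. a \<in> P \<and> b \<in> D - P}"

lemma unitsI: "a \<in> D - P \<Longrightarrow> b \<in> D - P \<Longrightarrow> a / b \<in> units"
  and local_ringI: "a \<in> D \<Longrightarrow> b \<in> D - P \<Longrightarrow> a / b \<in> local_ring"
  and local_maxI: "a \<in> P \<Longrightarrow> b \<in> D - P \<Longrightarrow> a / b \<in> local_max"
  unfolding units_def local_ring_def local_max_def by blast+

lemma units_mult: "x \<in> units \<Longrightarrow> y \<in> units \<Longrightarrow> x * y \<in> units"
proof -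
  assume "x \<in> units" "y \<in> units"
  then obtain a b c d where "a \<in> D - P" "b \<in> D - P" "c \<in> D - P" "d \<in> D - P" "x = a / b" "y = c / d"
    unfolding units_def by blast
  then show ?thesis using unitsI[OF compl_mult compl_mult] by simp
qed

lemma units_inverse: "x \<in> units \<Longrightarrow> inverse x \<in> units"
proof -
  assume "x \<in> units"
  then obtain a b where "a \<in> D - P" "b \<in> D - P" "x = a / b" unfolding units_def by blast
  moreover from this have "inverse x = b / a" by simp
  ultimately show ?thesis unfolding units_def by blast
qed

lemma units_divide: "x \<in> units \<Longrightarrow> y \<in> units \<Longrightarrow> x / y \<in> units"
  using units_mult[OF _ units_inverse, of x y] by (simp add: divide_inverse)

lemma units_one: "1 \<in> units"
  using unitsI[OF compl_one compl_one] by simp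

lemma units_nonzero: "x \<in> units \<Longrightarrow> x \<noteq> 0"
  using compl_nonzero unfolding units_def by auto

lemma units_power: "x \<in> units \<Longrightarrow> x ^ n \<in> units"
  by (induction n) (auto intro: units_one units_mult)

lemma compl_units: "x \<in> D - P \<Longrightarrow> x \<in> units"
  using unitsI[OF _ compl_one] by simp

lemma local_max_iff: "x \<in> D \<Longrightarrow> x \<in> local_max \<longleftrightarrow> x \<in> P"
proof
  assume "x \<in> D" "x \<in> local_max"
  then obtain a b where ab: "a \<in> P" "b \<in> D - P" "x = a / b" unfolding local_max_def by blast
  then have "x * b \<in> P" using compl_nonzero by auto
  then show "x \<in> P" using P_prime \<open>x \<in> D\<close> ab by blast
next
  assume "x \<in> P"
  then show "x \<in> local_max" using local_maxI[OF _ compl_one] by simp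
qed

lemma local_ring_cases: "x \<in> local_ring \<longleftrightarrow> x \<in> units \<or> x \<in> local_max"
  unfolding local_ring_def units_def local_max_def using P_subset by blast

lemma units_not_max: "x \<in> units \<Longrightarrow> x \<notin> local_max"
proof
  assume "x \<in> units" "x \<in> local_max"
  then obtain a b c d where *: "a \<in> D - P" "b \<in> D - P" "c \<in> P" "d \<in> D - P" "x = a / b" "x = c / d"
    unfolding local_max_def units_def by blast
  then have "a * d = c * b" using compl_nonzero by (auto simp: frac_eq_eq)
  moreover have "c * b \<in> P" using * P_closed by auto
  moreover have "a * d \<in> D - P" using compl_mult * by blast
  ultimately show False by auto
qed

lemma local_ring_mult: "x \<in> local_ring \<Longrightarrow> y \<in> local_ring \<Longrightarrow> x * y \<in> local_ring"
proof -
  assume "x \<in> local_ring" "y \<in> local_ring"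
  then obtain a b c d where "a \<in> D" "b \<in> D - P" "c \<in> D" "d \<in> D - P" "x = a / b" "y = c / d"
    unfolding local_ring_def by blast
  then show ?thesis using local_ringI[OF D_closed(4) compl_mult] by simp
qed

lemma local_max_mult: "x \<in> local_max \<Longrightarrow> y \<in> local_ring \<Longrightarrow> x * y \<in> local_max"
proof -
  assume "x \<in> local_max" "y \<in> local_ring"
  then obtain a b c d where "a \<in> P" "b \<in> D - P" "c \<in> D" "d \<in> D - P" "x = a / b" "y = c / d"
    unfolding local_ring_def local_max_def by blast
  then show ?thesis using local_maxI[OF P_closed(3) compl_mult] by simp
qed

lemma local_max_add: "x \<in> local_max \<Longrightarrow> y \<in> local_max \<Longrightarrow> x + y \<in> local_max"
proof -
  assume "x \<in> local_max" "y \<in> local_max"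
  then obtain a b c d where *: "a \<in> P" "b \<in> D - P" "c \<in> P" "d \<in> D - P" "x = a / b" "y = c / d"
    unfolding local_max_def by blast
  then have "x + y = (a * d + c * b) / (b * d)" using compl_nonzero by (auto simp: field_simps)
  moreover have "a * d + c * b \<in> P" using * P_closed by auto
  ultimately show ?thesis using compl_mult * unfolding local_max_def by blast
qed

lemma local_ring_add: "x \<in> local_ring \<Longrightarrow> y \<in> local_ring \<Longrightarrow> x + y \<in> local_ring"
proof -
  assume "x \<in> local_ring" "y \<in> local_ring"
  then obtain a b c d where *: "a \<in> D" "b \<in> D - P" "c \<in> D" "d \<in> D - P" "x = a / b" "y = c / d"
    unfolding local_ring_def by blast
  then have "x + y = (a * d + c * b) / (b * d)" using compl_nonzero by (auto simp: field_simps)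
  moreover have "a * d + c * b \<in> D" using * D_closed by auto
  ultimately show ?thesis using compl_mult * unfolding local_ring_def by blast
qed

lemma power_P: "x \<in> P \<Longrightarrow> n > 0 \<Longrightarrow> x ^ n \<in> P"
  using P_closed(3)[of x "x ^ (n - 1)"] D_power[OF P_subset, of x "n - 1"] by (cases n) auto

text \<open>Makes the exponent of a uniformizer unique: positive powers of an element of
  \<open>P\<close> lie in the maximal ideal, and negative powers are their inverses.\<close>

lemma powi_unit:
  assumes x: "x \<in> P" and unit: "x powi k \<in> units"
  shows "k = 0"
proof -
  have "x ^ n \<notin> units" if "n > 0" for n
    using units_not_max local_max_iff[OF P_subset] power_P[OF x that] by blast
  moreover have "x ^ nat (- k) \<in> units" if "k < 0"
    using units_inverse[OF unit] that by (simp add: power_int_def power_inverse)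
  ultimately show ?thesis
    using unit by (cases k "0 :: int" rule: linorder_cases) (auto simp: power_int_def)
qed

lemma ideal_power_0: "ideal_power D P 0 = D"
  by (simp add: ideal_power_def ideals_set_def nat_pow_def)

lemma ideal_power_Suc: "ideal_power D P (Suc n) = ideal_prod (ring_on D) (ideal_power D P n) P"
  by (simp add: ideal_power_def ideals_set_def nat_pow_def)

lemma ideal_ideal_power: "ideal (ideal_power D P n) (ring_on D)"
proof (induction n)
  case 0
  show ?case using ring.oneideal[OF cring.axioms(1)[OF cring_D]] by (simp add: ideal_power_0)
next
  case (Suc n)
  then show ?case unfolding ideal_power_Suc
    by (rule ring.ideal_prod_is_ideal[OF cring.axioms(1)[OF cring_D] _ ideal_P])
qed

lemma ideal_power_add:
  "x \<in> ideal_power D P n \<Longrightarrow> y \<in> ideal_power D P n \<Longrightarrow> x + y \<in> ideal_power D P n"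
  using ideal_prod.sum[of x "ring_on D" "ideal_power D P (n - 1)" P y]
  by (cases n) (auto simp: ideal_power_0 ideal_power_Suc intro: D_closed)

lemma ideal_power_mult_P:
  "x \<in> ideal_power D P n \<Longrightarrow> y \<in> P \<Longrightarrow> x * y \<in> ideal_power D P (Suc n)"
  using ideal_prod.prod[of x "ideal_power D P n" y P "ring_on D"] by (simp add: ideal_power_Suc)

lemma ideal_power_mult:
  assumes "x \<in> ideal_power D P n" "y \<in> D"
  shows "x * y \<in> ideal_power D P n"
proof (cases n)
  case 0
  then show ?thesis using assms by (simp add: ideal_power_0 D_closed)
next
  case (Suc m)
  have "x \<in> ideal_prod (ring_on D) (ideal_power D P m) P" using assms(1) by (simp add: Suc ideal_power_Suc)
  then show ?thesis
  proof (induction x rule: ideal_prod.induct)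
    case (prod i k)
    then have "i * (k * y) \<in> ideal_power D P n"
      using ideal_power_mult_P P_closed(3)[OF _ assms(2)] Suc by blast
    then show ?case by (simp add: mult.assoc)
  next
    case (sum s1 s2)
    then show ?case using ideal_power_add by (simp add: distrib_right)
  qed
qed

end

text \<open>P + (s) is the whole ring. Maximality is passed on in this elementwise form, which
  \<open>max_B\<close> establishes for the integral closure.\<close>

lemma maximal_inverse:
  fixes D P :: "'a::field set"
  assumes max: "maximalideal P (ring_on D)" and cring: "cring (ring_on D)" and s: "s \<in> D - P"
  shows "\<exists>b\<in>D. 1 - s * b \<in> P"
proof -
  interpret cring "ring_on D" by (rule cring)
  have P: "ideal P (ring_on D)" using max by (simp add: maximalideal_def)
  define J where "J = P <+>\<^bsub>ring_on D\<^esub> PIdl\<^bsub>ring_on D\<^esub> s"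
  have sI: "ideal (PIdl\<^bsub>ring_on D\<^esub> s) (ring_on D)" using s by (intro cgenideal_ideal) simp
  have J: "ideal J (ring_on D)" unfolding J_def by (rule add_ideals[OF P sI])
  have J_eq: "J = {x + b * s | x b. x \<in> P \<and> b \<in> D}"
    unfolding J_def set_add_def' cgenideal_def by auto
  have 0: "0 \<in> P" using additive_subgroup.zero_closed[OF ideal.axioms(1)[OF P]] by simp
  have D01: "0 \<in> D" "1 \<in> D" using zero_closed one_closed by simp_all
  have "P \<subseteq> J" unfolding J_eq using D01 by force
  moreover have "J \<subseteq> D" using ideal.Icarr[OF J] by auto
  ultimately have "J = P \<or> J = D" using maximalideal.I_maximal[OF max J] by simp
  moreover have "s \<in> J" unfolding J_eq using 0 D01 by force
  ultimately have "1 \<in> J" using s D01 by auto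
  then obtain x b where "x \<in> P" "b \<in> D" "1 = x + b * s" unfolding J_eq by blast
  moreover from this have "x = 1 - s * b" by (metis add_diff_cancel_right' mult.commute)
  ultimately show ?thesis by blast
qed

text \<open>The factorization is an axiom because it is reached in two ways: for \<open>A\<close>
  from ascending chains of ideals, for the integral closure from the values \<nu> constructed in
  \<open>prime_extension\<close>.\<close>

locale dvr_prime = prime_of_subring +
  fixes t :: "'a"
  assumes t: "t \<in> P" "t \<noteq> 0"
    and fractions: "\<And>x. \<exists>a\<in>D. \<exists>b\<in>D. b \<noteq> 0 \<and> x = a / b"
    and decomposition: "\<And>a. a \<in> D \<Longrightarrow> a \<noteq> 0 \<Longrightarrow> \<exists>n. \<exists>u\<in>units. a = t ^ n * u"
begin

definition val :: "'a \<Rightarrow> int" where "val x = (THE k. \<exists>u\<in>units. x = t powi k * u)"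

lemma val_eq:
  assumes "u \<in> units" "x = t powi k * u"
  shows "val x = k"
  unfolding val_def
proof (rule the_equality)
  show "\<exists>u\<in>units. x = t powi k * u" using assms by blast
  fix k' assume "\<exists>u\<in>units. x = t powi k' * u"
  then obtain u' where u': "u' \<in> units" "x = t powi k' * u'" by blast
  have "t powi (k - k') = u' / u"
    using u' assms t(2) units_nonzero[OF assms(1)] by (simp add: power_int_diff field_simps)
  then have "t powi (k - k') \<in> units" using units_divide[OF u'(1) assms(1)] by simp
  from powi_unit[OF t(1) this] show "k' = k" by simp
qed

lemma val_decomp:
  assumes "x \<noteq> 0"
  shows "\<exists>u\<in>units. x = t powi val x * u"
proof -
  obtain a b where ab: "a \<in> D" "b \<in> D" "b \<noteq> 0" "x = a / b" using fractions by blast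
  then obtain n u m w where *: "u \<in> units" "a = t ^ n * u" "w \<in> units" "b = t ^ m * w"
    using decomposition[of a] decomposition[of b] assms by auto
  have "x = t powi (int n - int m) * (u / w)"
    using ab * t(2) by (simp add: power_int_diff)
  moreover from val_eq[OF units_divide[OF *(1,3)] this] have "val x = int n - int m" .
  ultimately have "x = t powi val x * (u / w)" by metis
  then show ?thesis using units_divide[OF *(1,3)] by blast
qed

lemma val_times: "x \<noteq> 0 \<Longrightarrow> y \<noteq> 0 \<Longrightarrow> val (x * y) = val x + val y"
proof -
  assume "x \<noteq> 0" "y \<noteq> 0"
  then obtain u w where uw: "u \<in> units" "x = t powi val x * u" "w \<in> units" "y = t powi val y * w"
    using val_decomp by metis
  have "x * y = t powi (val x + val y) * (u * w)"
    by (subst uw(2), subst uw(4)) (simp add: power_int_add t(2))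
  then show ?thesis by (rule val_eq[OF units_mult[OF uw(1,3)]])
qed

lemma val_t: "val t = 1"
  by (rule val_eq[OF units_one]) simp

lemma val_units: "u \<in> units \<Longrightarrow> val u = 0"
  by (rule val_eq) auto

lemma val_nonneg_D: "a \<in> D \<Longrightarrow> a \<noteq> 0 \<Longrightarrow> val a \<ge> 0"
  using decomposition[of a] val_eq[of _ a "int _"] by fastforce

lemma val_nonneg_iff: "x \<noteq> 0 \<Longrightarrow> val x \<ge> 0 \<longleftrightarrow> x \<in> local_ring"
proof
  assume "x \<noteq> 0" "val x \<ge> 0"
  then obtain u where u: "u \<in> units" "x = t powi val x * u" using val_decomp by blast
  have "t ^ nat (val x) \<in> local_ring"
    using local_ringI[OF D_power[OF P_subset[OF t(1)]] compl_one] by simp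
  moreover have "u \<in> local_ring" using u local_ring_cases by blast
  moreover have "x = t ^ nat (val x) * u" using u(2) \<open>val x \<ge> 0\<close> by (simp add: power_int_def)
  ultimately show "x \<in> local_ring" using local_ring_mult by metis
next
  assume "x \<noteq> 0" "x \<in> local_ring"
  then obtain a b where ab: "a \<in> D" "b \<in> D - P" "x = a / b" unfolding local_ring_def by blast
  then have "x * b = a" "b \<noteq> 0" "a \<noteq> 0" using compl_nonzero[of b] \<open>x \<noteq> 0\<close> by auto
  then have "val x = val a" using val_times[OF \<open>x \<noteq> 0\<close>, of b] val_units[OF compl_units[OF ab(2)]] by simp
  then show "val x \<ge> 0" using val_nonneg_D ab(1) \<open>a \<noteq> 0\<close> by simp
qed

lemma val_pos_iff: "x \<in> D \<Longrightarrow> x \<noteq> 0 \<Longrightarrow> val x > 0 \<longleftrightarrow> x \<in> P"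
proof
  assume x: "x \<in> D" "x \<noteq> 0" "val x > 0"
  show "x \<in> P"
  proof (rule ccontr)
    assume "x \<notin> P"
    then show False using x val_units[OF compl_units[of x]] by simp
  qed
next
  assume x: "x \<in> D" "x \<noteq> 0" "x \<in> P"
  show "val x > 0"
  proof (rule ccontr)
    assume "\<not> val x > 0"
    then have "val x = 0" using val_nonneg_D[OF x(1,2)] by simp
    then have "x \<in> units" using val_decomp[OF x(2)] by auto
    then show False using units_not_max local_max_iff[OF x(1)] x(3) by blast
  qed
qed

lemma discrete_val_val: "discrete_valuation val"
proof -
  have *: "val x \<le> val (x + y)" if "x \<noteq> 0" "y \<noteq> 0" "x + y \<noteq> 0" "val x \<le> val y" for x y
  proof -
    have "val y = val x + val (y / x)" using val_times[of x "y / x"] that by simp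
    then have "y / x \<in> local_ring" using val_nonneg_iff[of "y / x"] that by simp
    then have "1 + y / x \<in> local_ring" using local_ring_add units_one local_ring_cases by blast
    moreover have xy: "x + y = x * (1 + y / x)" using that by (simp add: field_simps)
    moreover from this have "1 + y / x \<noteq> 0" using that by auto
    ultimately show ?thesis using val_nonneg_iff[of "1 + y / x"] val_times[of x "1 + y / x"] that(1) by simp
  qed
  have "min (val x) (val y) \<le> val (x + y)" if "x \<noteq> 0" "y \<noteq> 0" "x + y \<noteq> 0" for x y
    using *[of x y] *[of y x] that by (cases "val x \<le> val y") (auto simp: add.commute)
  then show ?thesis unfolding discrete_valuation_def using val_times val_t t(2) by blast
qed

text \<open>A value at least \<open>n\<close> gives divisibility by t^n only in the localization.
  The denominator can be removed because elements outside the maximal ideal \<open>P\<close> are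
  invertible modulo every power of \<open>P\<close>.\<close>

lemma ideal_power_iff:
  assumes max: "\<And>s. s \<in> D - P \<Longrightarrow> \<exists>b\<in>D. 1 - s * b \<in> P"
  shows "a \<in> ideal_power D P n \<longleftrightarrow> a \<in> D \<and> (a = 0 \<or> int n \<le> val a)"
proof
  interpret discrete_val val by unfold_locales (rule discrete_val_val)
  show "a \<in> ideal_power D P n \<Longrightarrow> a \<in> D \<and> (a = 0 \<or> int n \<le> val a)"
  proof (induction n arbitrary: a)
    case 0
    then show ?case using val_nonneg_D by (auto simp: ideal_power_0)
  next
    case (Suc n)
    then have "a \<in> ideal_prod (ring_on D) (ideal_power D P n) P" by (simp add: ideal_power_Suc)
    then show ?case
    proof (induction a rule: ideal_prod.induct)
      case (prod i k)
      then have i: "i \<in> D" "i = 0 \<or> int n \<le> val i" using Suc.IH by auto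
      have k: "k \<in> D" "k = 0 \<or> 1 \<le> val k" using prod(2) P_subset val_pos_iff[of k] by fastforce+
      show ?case using i k D_closed(4) val_times[of i k] by (cases "i = 0"; cases "k = 0") auto
    next
      case (sum s1 s2)
      then show ?case using D_closed(1,3) val_add[of s1 s2]
        by (cases "s1 = 0"; cases "s2 = 0"; cases "s1 + s2 = 0") (auto simp: min_def split: if_splits)
    qed
  qed
  assume a: "a \<in> D \<and> (a = 0 \<or> int n \<le> val a)"
  have tn: "t ^ n \<in> ideal_power D P n" for n
  proof (induction n)
    case (Suc n)
    then show ?case using ideal_power_mult_P[OF Suc t(1)] by (simp add: mult.commute)
  qed (simp add: ideal_power_0 D_closed)
  \<comment> \<open>An inverse modulo P^n and one modulo P combine: the product of their errors lies
    in the next power.\<close>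
  have inv: "\<exists>b\<in>D. 1 - c * b \<in> ideal_power D P n" if c: "c \<in> D - P" for c n
  proof (induction n)
    case 0
    show ?case using D_closed by (intro bexI[of _ 0]) (auto simp: ideal_power_0)
  next
    case (Suc n)
    then obtain b where b: "b \<in> D" "1 - c * b \<in> ideal_power D P n" by blast
    obtain b' where b': "b' \<in> D" "1 - c * b' \<in> P" using max[OF c] by blast
    have "(1 - c * b) * (1 - c * b') \<in> ideal_power D P (Suc n)" using ideal_power_mult_P b b' by blast
    moreover have "(1 - c * b) * (1 - c * b') = 1 - c * (b + b' - c * b * b')" by (simp add: algebra_simps)
    moreover have "b + b' - c * b * b' \<in> D" using b b' c by (intro D_diff D_closed) auto
    ultimately show ?case by metis
  qed
  have t_mult: "t ^ n * d \<in> ideal_power D P n" if "d \<in> D" for d by (rule ideal_power_mult[OF tn that])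
  show "a \<in> ideal_power D P n"
  proof (cases "a = 0")
    case True
    then show ?thesis using t_mult[OF D_closed(1)] by simp
  next
    case False
    have "val (a / t ^ n) = val a - int n"
    proof -
      have "val (t ^ n) = int n" by (rule val_eq[OF units_one]) simp
      then show ?thesis using val_times[of "a / t ^ n" "t ^ n"] False t(2) by simp
    qed
    then have "a / t ^ n \<in> local_ring" using val_nonneg_iff[of "a / t ^ n"] a False t(2) by simp
    then obtain d c where dc: "d \<in> D" "c \<in> D - P" "a / t ^ n = d / c" unfolding local_ring_def by blast
    then have ca: "c * a = t ^ n * d" using t(2) compl_nonzero[OF dc(2)] by (simp add: field_simps)
    obtain b where b: "b \<in> D" "1 - c * b \<in> ideal_power D P n" using inv[OF dc(2)] by blast
    \<comment> \<open>\<open>c * b\<close> is 1 modulo P^n, and \<open>c\<close> clears the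
      denominator of a / t^n.\<close>
    have "a = (1 - c * b) * a + t ^ n * (d * b)" using ca by (simp add: algebra_simps)
    then show ?thesis
      using ideal_power_add[OF ideal_power_mult[OF b(2), of a] t_mult[of "d * b"]] a dc(1) b(1) D_closed(4)
      by simp
  qed
qed

lemma prime_val_eq:
  assumes max: "\<And>s. s \<in> D - P \<Longrightarrow> \<exists>b\<in>D. 1 - s * b \<in> P" and x: "x \<noteq> 0"
  shows "prime_val D P x = ereal (real_of_int (val x))"
proof -
  have ord: "int (ideal_ord D P a) = val a" if "a \<in> D" "a \<noteq> 0" for a
  proof -
    have "a \<in> ideal_power D P n \<longleftrightarrow> int n \<le> val a" for n
      by (subst ideal_power_iff) (use max that in auto)
    then have "ideal_ord D P a = nat (val a)"
      unfolding ideal_ord_def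
      using val_nonneg_D[OF that] by (intro Greatest_equality) auto
    then show ?thesis using val_nonneg_D[OF that] by simp
  qed
  obtain a b where ab: "a \<in> D" "b \<in> D" "b \<noteq> 0" "x = a / b" using fractions by blast
  have val_quot: "val (a / b) = val a - val b" if "a \<noteq> 0" "b \<noteq> 0" for a b
    using val_times[of "a / b" b] that by simp
  have "(THE n. \<exists>a\<in>D. \<exists>b\<in>D. a \<noteq> 0 \<and> b \<noteq> 0 \<and> x = a / b \<and>
      n = int (ideal_ord D P a) - int (ideal_ord D P b)) = val x"
  proof (rule the_equality)
    show "\<exists>a\<in>D. \<exists>b\<in>D. a \<noteq> 0 \<and> b \<noteq> 0 \<and> x = a / b \<and>
        val x = int (ideal_ord D P a) - int (ideal_ord D P b)"
      using ab x by (intro bexI[of _ a] bexI[of _ b]) (auto simp: ord val_quot)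
  qed (auto simp: ord val_quot)
  then show ?thesis using x by (simp add: prime_val_def)
qed

end

text \<open>An element \<open>a\<close> that is not a power of \<pi> times a unit would be divisible
  in the local ring by all powers of \<pi>; the ascending chain condition excludes this.\<close>

lemma dedekind_dvr:
  fixes A p :: "'a::field set"
  assumes noeth: "noetherian_domain (ring_on A)" and prime: "primeideal p (ring_on A)" and nz: "p \<noteq> {0}"
    and frac: "\<And>x. \<exists>a\<in>A. \<exists>b\<in>A. b \<noteq> 0 \<and> x = a / b"
    and \<pi>: "\<pi> \<in> A" "generates_local_maxideal A p \<pi>"
  shows "dvr_prime A p \<pi>"
proof -
  interpret prime_of_subring A p by (rule prime_of_subring.intro[OF prime])
  have gen: "x \<in> local_max \<longleftrightarrow> (\<exists>y\<in>local_ring. x = \<pi> * y)" for x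
  proof -
    have "local_max = {\<pi> * (a / b) | a b. a \<in> A \<and> b \<in> A - p}"
      using \<pi>(2) unfolding generates_local_maxideal_def local_max_def by blast
    then show ?thesis unfolding local_ring_def by blast
  qed
  have one_local: "1 \<in> local_ring" using units_one local_ring_cases by blast
  then have "\<pi> \<in> local_max" using gen by force
  then have \<pi>p: "\<pi> \<in> p" using local_max_iff[OF \<pi>(1)] by blast
  have \<pi>0: "\<pi> \<noteq> 0"
  proof
    assume "\<pi> = 0"
    then have "x = 0" if "x \<in> p" for x using gen[of x] local_max_iff[OF P_subset] that by auto
    with nz P_closed(1) show False by blast
  qed
  have D_local: "a \<in> local_ring" if "a \<in> A" for a using local_ringI[OF that compl_one] by simp
  show ?thesis
  proof (intro dvr_prime.intro dvr_prime_axioms.intro prime_of_subring.intro prime)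
    fix a assume a: "a \<in> A" "a \<noteq> 0"
    show "\<exists>n. \<exists>u\<in>units. a = \<pi> ^ n * u"
    proof (rule ccontr)
      assume bad: "\<not> ?thesis"
      have div: "a / \<pi> ^ n \<in> local_ring" for n
      proof (induction n)
        case (Suc n)
        have "a / \<pi> ^ n \<notin> units"
        proof
          assume "a / \<pi> ^ n \<in> units"
          moreover have "a = \<pi> ^ n * (a / \<pi> ^ n)" using \<pi>0 by simp
          ultimately show False using bad by blast
        qed
        then have "a / \<pi> ^ n \<in> local_max" using Suc local_ring_cases by blast
        then obtain y where "y \<in> local_ring" "a / \<pi> ^ n = \<pi> * y" using gen by blast
        moreover from this have "a / \<pi> ^ Suc n = y" using \<pi>0 by (simp add: field_simps)
        ultimately show ?case by simp
      qed (use D_local a in simp)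
      \<comment> \<open>The part in \<open>A\<close> of the fractional ideal generated by a /
        \<pi>^n over the local ring; as ideals of \<open>A\<close> these fall under its chain
        condition.\<close>
      define J where "J n = {x \<in> A. x * \<pi> ^ n / a \<in> local_ring}" for n
      interpret R: noetherian_domain "ring_on A" by (rule noeth)
      have uminus: "a_inv (ring_on A) x = - x" if "x \<in> A" for x
        using R.minus_equality[of "- x" x] that D_uminus[OF that] by simp
      have ideal_J: "ideal (J n) (ring_on A)" for n
      proof (rule idealI)
        show "ring (ring_on A)" by (rule R.ring_axioms)
        show "subgroup (J n) (add_monoid (ring_on A))"
        proof (rule R.add.subgroupI)
          show "J n \<subseteq> carrier (ring_on A)" by (auto simp: J_def)
          show "J n \<noteq> {}" using D_closed(1) D_local[OF D_closed(1)] by (auto simp: J_def)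
          show "a_inv (ring_on A) x \<in> J n" if "x \<in> J n" for x
          proof -
            have "x \<in> A" "x * \<pi> ^ n / a \<in> local_ring" using that by (auto simp: J_def)
            moreover from this have "(- 1) * (x * \<pi> ^ n / a) \<in> local_ring"
              using local_ring_mult D_local[OF D_uminus[OF D_closed(2)]] by blast
            ultimately show ?thesis unfolding uminus[OF \<open>x \<in> A\<close>] using D_uminus by (simp add: J_def)
          qed
          show "x \<oplus>\<^bsub>ring_on A\<^esub> y \<in> J n" if "x \<in> J n" "y \<in> J n" for x y
            using that local_ring_add[of "x * \<pi> ^ n / a" "y * \<pi> ^ n / a"] D_closed(3)
            by (simp add: J_def add_divide_distrib distrib_right)
        qed
        fix x y assume x: "x \<in> J n" and y: "y \<in> carrier (ring_on A)"
        have "y * (x * \<pi> ^ n / a) \<in> local_ring"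
          by (rule local_ring_mult[OF D_local]) (use x y in \<open>simp_all add: J_def\<close>)
        then show "y \<otimes>\<^bsub>ring_on A\<^esub> x \<in> J n" "x \<otimes>\<^bsub>ring_on A\<^esub> y \<in> J n"
          using x y D_closed(4) by (simp_all add: J_def mult_ac)
      qed
      have J_Suc: "J n \<le> J (Suc n)" for n
      proof
        fix x assume x: "x \<in> J n"
        have "\<pi> * (x * \<pi> ^ n / a) \<in> local_ring"
          by (rule local_ring_mult[OF D_local[OF \<pi>(1)]]) (use x in \<open>simp add: J_def\<close>)
        then show "x \<in> J (Suc n)" using x by (simp add: J_def mult_ac)
      qed
      have mono: "J m \<subseteq> J n" if "m \<le> n" for m n by (rule lift_Suc_mono_le[of J, OF J_Suc that])
      have "subset.chain {I. ideal I (ring_on A)} (range J)"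
        unfolding pred_on.chain_def
      proof (intro conjI ballI)
        show "range J \<subseteq> {I. ideal I (ring_on A)}" using ideal_J by blast
        fix I I' assume "I \<in> range J" "I' \<in> range J"
        then obtain m n where "I = J m" "I' = J n" by blast
        then show "(\<subset>)\<^sup>=\<^sup>= I I' \<or> (\<subset>)\<^sup>=\<^sup>= I' I" using mono[of m n] mono[of n m] by (cases "m \<le> n") auto
      qed
      then have "\<Union>(range J) \<in> range J" by (intro R.ideal_chain_is_trivial) auto
      then obtain N where N: "\<Union>(range J) = J N" by blast
      \<comment> \<open>\<open>d\<close> lies in \<open>J (Suc N)\<close> with d \<pi>^(N+1) / a
        equal to the unit \<open>c\<close>. Since the chain is stable at N, \<open>c\<close> becomes
        a multiple of \<pi>.\<close>
      obtain d c where dc: "d \<in> A" "c \<in> A - p" "a / \<pi> ^ Suc N = d / c"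
        using div[of "Suc N"] unfolding local_ring_def by blast
      have c0: "c \<noteq> 0" by (rule compl_nonzero[OF dc(2)])
      have eq: "d * \<pi> ^ Suc N / a = c" using dc(3) a(2) \<pi>0 c0 by (simp add: field_simps)
      then have "d \<in> J (Suc N)" using dc(1,2) D_local unfolding J_def by auto
      then have "d * \<pi> ^ N / a \<in> local_ring" using N unfolding J_def by blast
      moreover have "c = \<pi> * (d * \<pi> ^ N / a)" using eq by (simp add: mult_ac)
      ultimately have "c \<in> local_max" using gen by blast
      then show False using units_not_max compl_units[OF dc(2)] by blast
    qed
  qed (use \<pi>p \<pi>0 frac in auto)
qed

context dvr_prime
begin

text \<open>Division by an entry of minimal value makes all entries local and one of them 1;
  denominators outside \<open>P\<close> are then cleared without moving that entry into
  \<open>P\<close>. This normalizes the relation in \<open>valuation_ring_dichotomy\<close>.\<close>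

lemma primitive_multiple:
  fixes N :: nat
  assumes "l \<le> N" "c l \<noteq> 0"
  shows "\<exists>q. (\<forall>l\<le>N. q * c l \<in> D) \<and> (\<exists>k\<le>N. q * c k \<in> D - P)"
proof -
  let ?I = "{l. l \<le> N \<and> c l \<noteq> 0}"
  have "finite ?I" by (rule finite_subset[of _ "{..N}"]) auto
  then have "Min ((\<lambda>l. val (c l)) ` ?I) \<in> (\<lambda>l. val (c l)) ` ?I" using assms by (intro Min_in) auto
  then obtain k where k: "k \<in> ?I" "Min ((\<lambda>l. val (c l)) ` ?I) = val (c k)" by blast
  have min: "val (c k) \<le> val (c l)" if "l \<in> ?I" for l
    unfolding k(2)[symmetric] using that \<open>finite ?I\<close> by (intro Min_le) auto
  have quot: "val (x / c k) = val x - val (c k)" if "x \<noteq> 0" for x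
    using val_times[of "x / c k" "c k"] that k by simp
  have "\<exists>s\<in>D - P. s * (c l / c k) \<in> D" if "l \<le> N" for l
  proof (cases "l \<in> ?I")
    case True
    then have "c l / c k \<in> local_ring" using quot[of "c l"] min[OF True] k val_nonneg_iff[of "c l / c k"] by simp
    then obtain a b where ab: "a \<in> D" "b \<in> D - P" "c l / c k = a / b" unfolding local_ring_def by blast
    then have "b * (c l / c k) = a" using compl_nonzero[of b] by simp
    with ab show ?thesis by blast
  next
    case False
    then have "1 * (c l / c k) \<in> D" using that D_closed(1) by simp
    then show ?thesis using compl_one by blast
  qed
  then obtain s where s: "\<And>l. l \<le> N \<Longrightarrow> s l \<in> D - P" "\<And>l. l \<le> N \<Longrightarrow> s l * (c l / c k) \<in> D"
    by metis
  have prod: "prod s L \<in> D - P" if "L \<subseteq> {..N}" for L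
    using that by (induction L rule: infinite_finite_induct) (use compl_one compl_mult s(1) in auto)
  define q where "q = prod s {..N} / c k"
  have "q * c l \<in> D" if "l \<le> N" for l
  proof -
    have "q * c l = prod s ({..N} - {l}) * (s l * (c l / c k))"
      using that by (simp add: q_def prod.remove[of _ l] mult_ac)
    then show ?thesis using D_closed(4)[OF _ s(2)[OF that]] prod[of "{..N} - {l}"] by auto
  qed
  moreover have "q * c k \<in> D - P" using prod[of "{..N}"] k by (simp add: q_def)
  ultimately show ?thesis using k(1) by blast
qed

end

section \<open>Integrality\<close>

definition subring_of_field :: "'a::field set \<Rightarrow> bool" where
  "subring_of_field D \<longleftrightarrow> 1 \<in> D \<and> (\<forall>x\<in>D. \<forall>y\<in>D. x - y \<in> D \<and> x * y \<in> D)"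

lemma subring_of_field_closed:
  assumes "subring_of_field D"
  shows "1 \<in> D" "x \<in> D \<Longrightarrow> y \<in> D \<Longrightarrow> x - y \<in> D" "x \<in> D \<Longrightarrow> y \<in> D \<Longrightarrow> x * y \<in> D"
    "0 \<in> D" "x \<in> D \<Longrightarrow> - x \<in> D" "x \<in> D \<Longrightarrow> y \<in> D \<Longrightarrow> x + y \<in> D"
    "(\<And>i. i \<in> I \<Longrightarrow> g i \<in> D) \<Longrightarrow> sum g I \<in> D"
proof -
  show 1: "1 \<in> D" and d: "x \<in> D \<Longrightarrow> y \<in> D \<Longrightarrow> x - y \<in> D"
    and "x \<in> D \<Longrightarrow> y \<in> D \<Longrightarrow> x * y \<in> D" for x y
    using assms by (auto simp: subring_of_field_def)
  show 0: "0 \<in> D" using d[OF 1 1] by simp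
  show m: "x \<in> D \<Longrightarrow> - x \<in> D" for x using d[OF 0] by simp
  show a: "x \<in> D \<Longrightarrow> y \<in> D \<Longrightarrow> x + y \<in> D" for x y using d[OF _ m, of x y] by simp
  show "(\<And>i. i \<in> I \<Longrightarrow> g i \<in> D) \<Longrightarrow> sum g I \<in> D"
    by (induction I rule: infinite_finite_induct) (auto intro: 0 a)
qed

lemma coeff_mult_top:
  assumes "Polynomial.degree p \<le> m" "Polynomial.degree q \<le> n"
  shows "Polynomial.coeff (p * q) (m + n) = Polynomial.coeff p m * Polynomial.coeff q (n :: nat)"
proof -
  have "Polynomial.coeff (p * q) (m + n) =
      (\<Sum>i\<le>m + n. Polynomial.coeff p i * Polynomial.coeff q (m + n - i))" by (rule coeff_mult)
  also have "\<dots> = (\<Sum>i\<in>{m}. Polynomial.coeff p i * Polynomial.coeff q (m + n - i))"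
  proof (rule sum.mono_neutral_right)
    show "\<forall>i\<in>{..m + n} - {m}. Polynomial.coeff p i * Polynomial.coeff q (m + n - i) = 0"
    proof
      fix i assume "i \<in> {..m + n} - {m}"
      then consider "i > m" | "m + n - i > n" by fastforce
      then show "Polynomial.coeff p i * Polynomial.coeff q (m + n - i) = 0"
        using assms by cases (auto simp: coeff_eq_0)
    qed
  qed auto
  finally show ?thesis by simp
qed

text \<open>Fraction-free Gaussian elimination keeps the shape of the system (degree at most \<open>m\<close>, with the
  identity matrix as coefficient of \<open>X\<^sup>m\<close>); it replaces the characteristic polynomial.\<close>

lemma integral_by_elimination:
  fixes D :: "'a::field set" and n :: nat
  assumes D: "subring_of_field D"
    and "\<And>i k. i < n \<Longrightarrow> k < n \<Longrightarrow> M i k \<in> poly_over D \<and> Polynomial.degree (M i k) \<le> m \<and>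
      Polynomial.coeff (M i k) m = (if i = k then 1 else 0)"
    and "\<And>i. i < n \<Longrightarrow> (\<Sum>k<n. poly (M i k) x * v k) = 0"
    and "k0 < n" "v k0 \<noteq> 0"
  shows "x \<in> integral_closure D"
  using assms(2-)
proof (induction n arbitrary: M m k0)
  case (Suc n)
  note D' = subring_of_field_closed[OF D]
  show ?case
  proof (cases "\<exists>k<n. v k \<noteq> 0")
    case True
    then obtain k1 where k1: "k1 < n" "v k1 \<noteq> 0" by blast
    define M' where "M' i k = M n n * M i k - M i n * M n k" for i k
    show ?thesis
    proof (rule Suc.IH[OF _ _ k1])
      fix i k assume ik: "i < n" "k < n"
      have 1: "M n n \<in> poly_over D" "M i k \<in> poly_over D" "M i n \<in> poly_over D" "M n k \<in> poly_over D"
        and deg: "Polynomial.degree (M n n) \<le> m" "Polynomial.degree (M i k) \<le> m"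
          "Polynomial.degree (M i n) \<le> m" "Polynomial.degree (M n k) \<le> m"
        and top: "Polynomial.coeff (M n n) m = 1" "Polynomial.coeff (M i k) m = (if i = k then 1 else 0)"
          "Polynomial.coeff (M i n) m = 0" "Polynomial.coeff (M n k) m = 0"
        using Suc.prems(1) ik by simp_all
      have "M' i k \<in> poly_over D"
        using 1 by (auto simp: M'_def poly_over_iff[OF D'(4)] coeff_mult intro!: D')
      moreover have "Polynomial.degree (M' i k) \<le> m + m"
        unfolding M'_def using deg by (intro degree_diff_le order_trans[OF degree_mult_le] add_mono)
      moreover have "Polynomial.coeff (M' i k) (m + m) = (if i = k then 1 else 0)"
        unfolding M'_def coeff_diff using deg top by (simp add: coeff_mult_top)
      ultimately show "M' i k \<in> poly_over D \<and> Polynomial.degree (M' i k) \<le> m + m \<and>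
        Polynomial.coeff (M' i k) (m + m) = (if i = k then 1 else 0)" by blast
    next
      fix i assume i: "i < n"
      have row: "(\<Sum>k<n. poly (M i k) x * v k) = - (poly (M i n) x * v n)" if "i < Suc n" for i
        using Suc.prems(2)[OF that] by (simp add: eq_neg_iff_add_eq_0)
      have "(\<Sum>k<n. poly (M' i k) x * v k) =
          poly (M n n) x * (\<Sum>k<n. poly (M i k) x * v k) - poly (M i n) x * (\<Sum>k<n. poly (M n k) x * v k)"
        by (simp add: M'_def sum_distrib_left sum_subtractf algebra_simps)
      also have "\<dots> = 0" using row[of i] row[of n] i by simp
      finally show "(\<Sum>k<n. poly (M' i k) x * v k) = 0" .
    qed
  next
    case False
    then have "v n \<noteq> 0" using Suc.prems(3,4) by (metis less_SucE)
    moreover have "(\<Sum>k<n. poly (M n k) x * v k) = 0" using False by simp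
    ultimately have "poly (M n n) x = 0" using Suc.prems(2)[of n] by simp
    moreover have "monic (M n n)" "M n n \<in> poly_over D"
    proof -
      have *: "Polynomial.degree (M n n) \<le> m" "Polynomial.coeff (M n n) m = 1" and "M n n \<in> poly_over D"
        using Suc.prems(1)[of n n] by auto
      moreover have "Polynomial.degree (M n n) = m" using * le_degree[of "M n n" m] by auto
      ultimately show "monic (M n n)" "M n n \<in> poly_over D" by (auto simp: monic_def)
    qed
    ultimately show ?thesis by (auto simp: integral_closure_def)
  qed
qed simp

text \<open>The determinant trick: \<open>x\<close> preserves the span over \<open>D\<close> of 1,
  ..., \<alpha>^(n-1), and the vector of these powers is in the kernel of x I - M. It is nonzero
  because \<alpha>^0 = 1.\<close>

lemma integral_by_span:
  fixes D :: "'a::field set"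
  assumes D: "subring_of_field D" and n: "n > 0"
    and span: "\<And>i. i < n \<Longrightarrow> \<exists>M. (\<forall>e<n. M e \<in> D) \<and> x * \<alpha> ^ i = (\<Sum>e<n. M e * \<alpha> ^ e)"
  shows "x \<in> integral_closure D"
proof -
  note D' = subring_of_field_closed[OF D]
  obtain M where M: "\<And>i e. i < n \<Longrightarrow> e < n \<Longrightarrow> M i e \<in> D"
    "\<And>i. i < n \<Longrightarrow> x * \<alpha> ^ i = (\<Sum>e<n. M i e * \<alpha> ^ e)"
    using span by metis
  show ?thesis
  proof (rule integral_by_elimination[OF D, where m = 1 and v = "\<lambda>e. \<alpha> ^ e" and n = n and ?k0.0 = 0
        and M = "\<lambda>i e. [:- M i e, if i = e then 1 else 0:]"])
    fix i assume i: "i < n"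
    have "(\<Sum>e<n. poly [:- M i e, if i = e then 1 else 0:] x * \<alpha> ^ e) =
        (\<Sum>e<n. (if i = e then x * \<alpha> ^ e else 0) - M i e * \<alpha> ^ e)"
      by (intro sum.cong) (auto simp: algebra_simps)
    also have "\<dots> = x * \<alpha> ^ i - (\<Sum>e<n. M i e * \<alpha> ^ e)"
      using i by (simp add: sum_subtractf)
    finally show "(\<Sum>e<n. poly [:- M i e, if i = e then 1 else 0:] x * \<alpha> ^ e) = 0" using M(2)[OF i] by simp
  qed (use M(1) D' n in \<open>auto simp: poly_over_iff[OF D'(4)] coeff_pCons split: nat.splits\<close>)
qed

text \<open>The element preserves the span of 1, ..., \<alpha>^(n-1). Times less than \<alpha>^k,
  the truncated sum has exponents below \<open>n\<close> already; otherwise the relation replaces it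
  by minus the complementary sum, with exponents below \<open>n\<close> again. The factor \<alpha>
  for \<delta> = 1 just fits.\<close>

lemma integral_truncation:
  fixes D :: "'a::field set"
  assumes D: "subring_of_field D" and c: "\<And>l. l \<le> n \<Longrightarrow> c l \<in> D"
    and root: "(\<Sum>l\<le>n. c l * \<alpha> ^ l) = 0" and n: "n > 0" and k: "k \<le> n" and \<delta>: "\<delta> \<le> 1"
  shows "(\<Sum>l=k..n. c l * \<alpha> ^ (l - k)) * \<alpha> ^ \<delta> \<in> integral_closure D" (is "?x \<in> _")
proof (rule integral_by_span[OF D n])
  note D' = subring_of_field_closed[OF D]
  have span: "\<exists>M. (\<forall>e<n. M e \<in> D) \<and> (\<Sum>l\<in>S. b l * \<alpha> ^ g l) = (\<Sum>e<n. M e * \<alpha> ^ e)"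
    if S: "finite S" "\<And>l. l \<in> S \<Longrightarrow> b l \<in> D" "\<And>l. l \<in> S \<Longrightarrow> g l < n" for S :: "nat set" and b g
  proof (intro exI conjI allI impI)
    show "(\<Sum>l | l \<in> S \<and> g l = e. b l) \<in> D" for e using S by (intro D'(7)) auto
    have "(\<Sum>l\<in>S. b l * \<alpha> ^ g l) = (\<Sum>e<n. \<Sum>l | l \<in> S \<and> g l = e. b l * \<alpha> ^ g l)"
      using S by (intro sum.group[symmetric]) auto
    also have "\<dots> = (\<Sum>e<n. (\<Sum>l | l \<in> S \<and> g l = e. b l) * \<alpha> ^ e)"
      by (simp add: sum_distrib_right)
    finally show "(\<Sum>l\<in>S. b l * \<alpha> ^ g l) = (\<Sum>e<n. (\<Sum>l | l \<in> S \<and> g l = e. b l) * \<alpha> ^ e)" .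
  qed
  fix i assume i: "i < n"
  define s where "s = i + \<delta>"
  have x: "?x * \<alpha> ^ i = (\<Sum>l=k..n. c l * \<alpha> ^ (l - k + s))"
    unfolding sum_distrib_right by (rule sum.cong[OF refl]) (simp only: s_def power_add mult_ac)
  show "\<exists>M. (\<forall>e<n. M e \<in> D) \<and> ?x * \<alpha> ^ i = (\<Sum>e<n. M e * \<alpha> ^ e)"
  proof (cases "s < k")
    case True
    then have "l - k + s < n" if "l \<in> {k..n}" for l using that k by auto
    then show ?thesis unfolding x using c by (intro span) auto
  next
    case False
    have "?x * \<alpha> ^ i = \<alpha> ^ (s - k) * (\<Sum>l=k..n. c l * \<alpha> ^ l)"
      unfolding x sum_distrib_left
    proof (rule sum.cong[OF refl])
      fix l assume "l \<in> {k..n}"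
      then have "l - k + s = (s - k) + l" using False by simp
      then show "c l * \<alpha> ^ (l - k + s) = \<alpha> ^ (s - k) * (c l * \<alpha> ^ l)" by (simp add: power_add)
    qed
    also have "(\<Sum>l=k..n. c l * \<alpha> ^ l) = - (\<Sum>l<k. c l * \<alpha> ^ l)"
    proof -
      have "{..n} = {..<k} \<union> {k..n}" using k by auto
      then have "(\<Sum>l\<le>n. c l * \<alpha> ^ l) = (\<Sum>l<k. c l * \<alpha> ^ l) + (\<Sum>l=k..n. c l * \<alpha> ^ l)"
        by (simp only:) (rule sum.union_disjoint, auto)
      with root show ?thesis by (simp add: eq_neg_iff_add_eq_0 add.commute)
    qed
    also have "\<alpha> ^ (s - k) * - (\<Sum>l<k. c l * \<alpha> ^ l) = (\<Sum>l<k. (- c l) * \<alpha> ^ (s - k + l))"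
      by (simp add: sum_distrib_left sum_negf power_add mult_ac)
    finally have eq: "?x * \<alpha> ^ i = (\<Sum>l<k. (- c l) * \<alpha> ^ (s - k + l))" .
    have "s - k + l < n" if "l < k" for l using False k i \<delta> that by (simp add: s_def)
    then show ?thesis unfolding eq using c k D'(5) by (intro span) auto
  qed
qed

text \<open>Induction on \<open>N\<close>: a member with nonzero top coefficient clears it from the
  others, of which there are still enough.\<close>

lemma poly_dependence:
  fixes g :: "'i \<Rightarrow> 'k::field poly"
  assumes "finite I" "card I > N" "\<And>i n. i \<in> I \<Longrightarrow> n \<ge> N \<Longrightarrow> Polynomial.coeff (g i) n = 0"
  shows "\<exists>c. (\<exists>i\<in>I. c i \<noteq> 0) \<and> (\<Sum>i\<in>I. Polynomial.smult (c i) (g i)) = 0"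
  using assms
proof (induction N arbitrary: I g)
  case 0
  then have "g i = 0" if "i \<in> I" for i using that by (intro poly_eqI) simp
  moreover have "I \<noteq> {}" using 0 by auto
  ultimately show ?case by (intro exI[of _ "\<lambda>_. 1"]) auto
next
  case (Suc N)
  show ?case
  proof (cases "\<forall>i\<in>I. Polynomial.coeff (g i) N = 0")
    case True
    have "Polynomial.coeff (g i) n = 0" if "i \<in> I" "n \<ge> N" for i n
      using True Suc.prems(3)[OF that(1), of n] that by (cases "n = N") auto
    then show ?thesis using Suc.prems by (intro Suc.IH) auto
  next
    case False
    then obtain q where q: "q \<in> I" "Polynomial.coeff (g q) N \<noteq> 0" by blast
    define a where "a i = Polynomial.coeff (g i) N / Polynomial.coeff (g q) N" for i
    have "\<exists>c. (\<exists>i\<in>I - {q}. c i \<noteq> 0) \<and>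
        (\<Sum>i\<in>I - {q}. Polynomial.smult (c i) (g i - Polynomial.smult (a i) (g q))) = 0"
    proof (rule Suc.IH)
      fix i n assume *: "i \<in> I - {q}" "n \<ge> N"
      show "Polynomial.coeff (g i - Polynomial.smult (a i) (g q)) n = 0"
      proof (cases "n = N")
        case False
        with * show ?thesis using Suc.prems(3)[of i n] Suc.prems(3)[OF q(1), of n] by simp
      qed (use q in \<open>simp add: a_def\<close>)
    qed (use Suc.prems q in auto)
    then obtain c where c: "\<exists>i\<in>I - {q}. c i \<noteq> 0"
      "(\<Sum>i\<in>I - {q}. Polynomial.smult (c i) (g i - Polynomial.smult (a i) (g q))) = 0" by blast
    define c' where "c' i = (if i = q then - (\<Sum>i\<in>I - {q}. c i * a i) else c i)" for i
    have "(\<Sum>i\<in>I. Polynomial.smult (c' i) (g i)) =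
        Polynomial.smult (c' q) (g q) + (\<Sum>i\<in>I - {q}. Polynomial.smult (c i) (g i))"
      using Suc.prems(1) q by (subst sum.remove[of _ q]) (auto simp: c'_def intro!: sum.cong)
    also have "\<dots> = (\<Sum>i\<in>I - {q}. Polynomial.smult (c i) (g i - Polynomial.smult (a i) (g q)))"
      by (simp add: c'_def smult_diff_right sum_subtractf smult_sum)
    finally have "(\<Sum>i\<in>I. Polynomial.smult (c' i) (g i)) = 0" using c(2) by simp
    moreover have "\<exists>i\<in>I. c' i \<noteq> 0" using c(1) by (auto simp: c'_def)
    ultimately show ?thesis by blast
  qed
qed

section \<open>Extending the valuation\<close>

text \<open>\<open>N\<close> is the least degree of a nonzero polynomial vanishing at \<theta>;
  powers of x are polynomials in \<theta> of degree below \<open>N\<close>. That \<open>N\<close>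
  does not depend on x permits the exponent N! in \<nu>.\<close>

lemma algebraic_relation:
  fixes j :: "'k::field \<Rightarrow> 'l::field"
  assumes emb: "field_embedding j" and gen: "generated_by_root j \<theta>"
    and f: "f \<noteq> 0" "poly (map_poly j f) \<theta> = 0"
  shows "\<exists>N>0. \<forall>x. \<exists>c. (\<exists>l\<le>N. c l \<noteq> 0) \<and> (\<Sum>l\<le>N. j (c l) * x ^ l) = 0"
proof -
  interpret embedding j by (rule embedding.intro[OF emb])
  obtain \<mu> where \<mu>: "\<mu> \<noteq> 0" "poly (jp \<mu>) \<theta> = 0"
    and min: "\<And>g. g \<noteq> 0 \<Longrightarrow> poly (jp g) \<theta> = 0 \<Longrightarrow> Polynomial.degree \<mu> \<le> Polynomial.degree g"
    using ex_has_least_nat[of "\<lambda>g. g \<noteq> 0 \<and> poly (jp g) \<theta> = 0" f Polynomial.degree] f by blast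
  define N where "N = Polynomial.degree \<mu>"
  have "N > 0"
  proof (rule ccontr)
    assume "\<not> N > 0"
    then obtain a where "\<mu> = [:a:]" unfolding N_def by (metis degree_eq_zeroE gr0I)
    with \<mu> show False by (simp add: map_poly_pCons)
  qed
  have inverse: "\<exists>g. poly (jp g) \<theta> * poly (jp h) \<theta> = 1" if h: "poly (jp h) \<theta> \<noteq> 0" for h
  proof -
    \<comment> \<open>The nonzero elements of the ideal (h, \<mu>); one of least degree,
      \<open>d\<close>, is a gcd. It divides \<open>h\<close>, so it does not vanish at \<theta>,
      and minimality of \<mu> makes it constant.\<close>
    let ?I = "\<lambda>d. d \<noteq> 0 \<and> (\<exists>a b. d = a * h + b * \<mu>)"
    have "?I \<mu>" using \<mu>(1) by (auto intro: exI[of _ 0] exI[of _ 1])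
    then obtain d where d: "?I d" and d_min: "\<And>e. ?I e \<Longrightarrow> Polynomial.degree d \<le> Polynomial.degree e"
      using ex_has_least_nat[of ?I \<mu> Polynomial.degree] by blast
    then obtain a b where ab: "d = a * h + b * \<mu>" by blast
    have dvd: "d dvd a' * h + b' * \<mu>" (is "d dvd ?e") for a' b'
    proof (rule ccontr)
      assume "\<not> d dvd ?e"
      then have nz: "?e mod d \<noteq> 0" by (simp add: dvd_eq_mod_eq_0)
      define Q where "Q = ?e div d"
      have "Q * d = Q * a * h + Q * b * \<mu>" by (subst ab) (simp add: algebra_simps)
      then have "?e - Q * d = (a' - Q * a) * h + (b' - Q * b) * \<mu>" by (simp add: algebra_simps)
      then have "?e mod d = (a' - Q * a) * h + (b' - Q * b) * \<mu>"
        by (simp add: Q_def minus_div_mult_eq_mod)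
      then have "?I (?e mod d)" using nz by blast
      then show False using d_min[of "?e mod d"] degree_mod_less[of d ?e] d nz by simp
    qed
    obtain q where q: "\<mu> = d * q" using dvd[of 0 1] by (auto elim: dvdE)
    obtain q' where q': "h = d * q'" using dvd[of 1 0] by (auto elim: dvdE)
    have "poly (jp d) \<theta> \<noteq> 0" using h q' by (auto simp: jp_mult)
    then have "poly (jp q) \<theta> = 0" using \<mu>(2) q by (simp add: jp_mult)
    moreover have "q \<noteq> 0" "d \<noteq> 0" using \<mu>(1) q by auto
    ultimately have "Polynomial.degree \<mu> \<le> Polynomial.degree q" using min by blast
    then have "Polynomial.degree d = 0" using q \<open>q \<noteq> 0\<close> \<open>d \<noteq> 0\<close> by (simp add: degree_mult_eq)
    then obtain c where c: "d = [:c:]" "c \<noteq> 0" using \<open>d \<noteq> 0\<close> by (metis degree_eq_zeroE pCons_0_0)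
    have "poly (jp d) \<theta> = poly (jp a) \<theta> * poly (jp h) \<theta> + poly (jp b) \<theta> * poly (jp \<mu>) \<theta>"
      by (simp only: ab jp_add jp_mult poly_add poly_mult)
    then have "poly (jp a) \<theta> * poly (jp h) \<theta> = j c" using \<mu>(2) c(1) by (simp add: map_poly_pCons)
    then have "poly (jp (Polynomial.smult (inverse c) a)) \<theta> * poly (jp h) \<theta> = 1"
      using c hom(2)[of "inverse c" c] by (simp add: map_poly_smult hom mult.assoc)
    then show ?thesis by blast
  qed
  have repr: "\<exists>g. x = poly (jp g) \<theta>" for x
  proof -
    obtain g h where gh: "poly (jp h) \<theta> \<noteq> 0" "x = poly (jp g) \<theta> / poly (jp h) \<theta>"
      using gen unfolding generated_by_root_def by blast
    obtain h' where "poly (jp h') \<theta> * poly (jp h) \<theta> = 1" using inverse[OF gh(1)] by blast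
    then have "poly (jp h') \<theta> = 1 / poly (jp h) \<theta>" using gh(1) by (simp add: eq_divide_eq)
    then have "x = poly (jp (g * h')) \<theta>" by (simp add: jp_mult gh(2))
    then show ?thesis by blast
  qed
  have "\<exists>c. (\<exists>l\<le>N. c l \<noteq> 0) \<and> (\<Sum>l\<le>N. j (c l) * x ^ l) = 0" for x
  proof -
    obtain g where g: "x = poly (jp g) \<theta>" using repr by blast
    define b where "b l = g ^ l mod \<mu>" for l
    have "poly (jp (b l)) \<theta> = poly (jp (g ^ l)) \<theta>" for l
    proof -
      have "jp (g ^ l) = jp (g ^ l div \<mu>) * jp \<mu> + jp (b l)"
        by (simp only: b_def flip: jp_mult jp_add) simp
      then show ?thesis using \<mu>(2) by simp
    qed
    then have b: "poly (jp (b l)) \<theta> = x ^ l" for l by (simp add: jp_power g)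
    have "\<exists>c. (\<exists>l\<in>{..N}. c l \<noteq> 0) \<and> (\<Sum>l\<in>{..N}. Polynomial.smult (c l) (b l)) = 0"
    proof (rule poly_dependence)
      fix l n assume "N \<le> n"
      then show "Polynomial.coeff (b l) n = 0"
        using degree_mod_less[OF \<mu>(1), of "g ^ l"] by (auto simp: b_def N_def coeff_eq_0)
    qed auto
    then obtain c where c: "\<exists>l\<in>{..N}. c l \<noteq> 0" "(\<Sum>l\<in>{..N}. Polynomial.smult (c l) (b l)) = 0" by blast
    have jp_sum: "jp (sum h S) = (\<Sum>l\<in>S. jp (h l))" for h :: "nat \<Rightarrow> 'k poly" and S
      by (induction S rule: infinite_finite_induct) (auto simp: jp_add)
    have "poly (jp (\<Sum>l\<in>{..N}. Polynomial.smult (c l) (b l))) \<theta> = (\<Sum>l\<le>N. j (c l) * x ^ l)"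
      by (simp add: jp_sum poly_sum map_poly_smult hom b)
    with c have "(\<Sum>l\<le>N. j (c l) * x ^ l) = 0" by simp
    with c(1) show ?thesis by blast
  qed
  with \<open>N > 0\<close> show ?thesis by blast
qed

locale prime_extension = embedding j + A: dvr_prime A p \<pi> + B: prime_of_subring "integral_closure (j ` A)" P
  for j :: "'k::field \<Rightarrow> 'l::field" and A p :: "'k set" and \<pi> :: 'k and P :: "'l set" +
  fixes N :: nat
  assumes over: "{a \<in> A. j a \<in> P} = p"
    and max_A: "\<And>s. s \<in> A - p \<Longrightarrow> \<exists>b\<in>A. 1 - s * b \<in> p"
    and N: "N > 0"
    and relation: "\<And>x. \<exists>c. (\<exists>l\<le>N. c l \<noteq> 0) \<and> (\<Sum>l\<le>N. j (c l) * x ^ l) = 0"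
begin

abbreviation B :: "'l set" where "B \<equiv> integral_closure (j ` A)"

lemma subring_jA: "subring_of_field (j ` A)"
  unfolding subring_of_field_def
proof (intro conjI ballI)
  show "1 \<in> j ` A" using A.D_closed(2) hom(3) by (metis image_eqI)
  fix x y assume "x \<in> j ` A" "y \<in> j ` A"
  then obtain a b where ab: "a \<in> A" "b \<in> A" "x = j a" "y = j b" by blast
  then have "x - y = j (a - b)" "x * y = j (a * b)" by (simp_all add: hom_diff hom)
  then show "x - y \<in> j ` A" "x * y \<in> j ` A" using A.D_diff A.D_closed(4) ab by blast+
qed

lemma j_in_B: "a \<in> A \<Longrightarrow> j a \<in> B"
  using subring_of_field_closed[OF subring_jA]
  by (auto simp: integral_closure_def monic_def poly_over_def intro!: exI[of _ "[:- j a, 1:]"] bexI[of _ "[:- j a, 1:]"])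

lemma j_in_P: "a \<in> A \<Longrightarrow> j a \<in> P \<longleftrightarrow> a \<in> p"
  using over by blast

lemma j_compl: "a \<in> A - p \<Longrightarrow> j a \<in> B - P"
  using j_in_B j_in_P by blast

lemma j_units: "u \<in> A.units \<Longrightarrow> j u \<in> B.units"
  unfolding A.units_def using B.unitsI j_compl hom_divide by fastforce

lemma j\<pi>: "j \<pi> \<in> P" "j \<pi> \<noteq> 0"
  using A.t j_in_P[OF A.P_subset] by auto

text \<open>Take a monic g over \<open>A\<close> of least degree with g(s) in \<open>P\<close>, and
  write g = c + X h. If \<open>c\<close> were in \<open>P\<close>, so would be s h(s) and hence
  h(s), against minimality. So \<open>c\<close> is invertible modulo p, and -h(s)/c inverts s modulo
  \<open>P\<close>.\<close>

lemma max_B: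
  assumes s: "s \<in> B - P"
  shows "\<exists>b\<in>B. 1 - s * b \<in> P"
proof -
  note D' = subring_of_field_closed[OF subring_jA]
  let ?Q = "\<lambda>g. g \<in> poly_over (j ` A) \<and> monic g \<and> poly g s \<in> P"
  have "s \<in> B" using s by simp
  then obtain g0 where "g0 \<in> poly_over (j ` A)" "monic g0" "poly g0 s = 0"
    unfolding integral_closure_def by blast
  then have "?Q g0" using B.P_closed(1) by simp
  then obtain g where g: "?Q g" and min: "\<And>h. ?Q h \<Longrightarrow> Polynomial.degree g \<le> Polynomial.degree h"
    using ex_has_least_nat[of ?Q g0 Polynomial.degree] by blast
  have poly_B: "poly h s \<in> B" if "h \<in> poly_over (j ` A)" for h
  proof -
    have "Polynomial.coeff h n \<in> j ` A" for n
      using that by (simp only: poly_over_iff[OF D'(4)])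
    then have "Polynomial.coeff h n \<in> B" for n using j_in_B by (metis imageE)
    moreover have "sum u I \<in> B" if "\<And>i. i \<in> I \<Longrightarrow> u i \<in> B" for u and I :: "nat set"
      using that by (induction I rule: infinite_finite_induct) (auto intro: B.D_closed)
    ultimately show ?thesis using s B.D_closed(4) B.D_power unfolding poly_altdef by auto
  qed
  obtain c h where gh: "g = pCons c h" by (rule pCons_cases)
  have deg: "Polynomial.degree g > 0"
  proof (rule ccontr)
    assume "\<not> ?thesis"
    then have "g = 1" using g unfolding monic_def by (metis coeff_pCons_0 degree_eq_zeroE gr0I one_pCons)
    with g B.one_notin show False by simp
  qed
  then have h: "h \<noteq> 0" "Polynomial.degree g = Suc (Polynomial.degree h)" by (auto simp: gh split: if_splits)
  have hA: "h \<in> poly_over (j ` A)" and cA: "c \<in> j ` A"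
  proof -
    have *: "Polynomial.coeff g n \<in> j ` A" for n using g poly_over_iff[OF D'(4)] by blast
    from *[of "Suc _"] show "h \<in> poly_over (j ` A)" by (simp add: gh poly_over_iff[OF D'(4)])
    from *[of 0] show "c \<in> j ` A" by (simp add: gh)
  qed
  have hm: "monic h" using g h by (simp add: gh monic_def)
  have eval: "poly g s = c + s * poly h s" by (simp add: gh)
  have "c \<notin> P"
  proof
    assume "c \<in> P"
    then have "- c + poly g s \<in> P" using g B.P_closed(2) B.P_uminus by blast
    then have "s * poly h s \<in> P" by (simp add: eval)
    then have "poly h s \<in> P" using B.P_prime poly_B[OF hA] s by blast
    then show False using min[of h] hA hm h by simp
  qed
  then obtain a where a: "a \<in> A - p" "c = j a" using cA j_in_P by blast
  obtain a' where a': "a' \<in> A" "1 - a * a' \<in> p" using max_A[OF a(1)] by blast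
  have "1 - s * (- (poly h s * j a')) = (1 - c * j a') + poly g s * j a'" by (simp add: eval algebra_simps)
  moreover have "1 - c * j a' \<in> P"
    using j_in_P[OF A.P_subset[OF a'(2)]] a'(2) a(2) by (simp add: hom hom_diff)
  ultimately have "1 - s * (- (poly h s * j a')) \<in> P" using g j_in_B[OF a'(1)] B.P_closed by metis
  moreover have "- (poly h s * j a') \<in> B" using poly_B[OF hA] j_in_B[OF a'(1)] B.D_closed(4) B.D_uminus by blast
  ultimately show ?thesis by blast
qed

text \<open>The localization at \<open>P\<close> is a valuation ring: with \<open>b\<^sub>k = \<Sum>\<^sub>l\<^sub>\<ge>\<^sub>k c\<^sub>l \<alpha>\<^sup>l\<^sup>-\<^sup>k\<close>, both \<open>b\<^sub>k\<close> and
  \<open>b\<^sub>k \<alpha>\<close> are integral, and \<open>c\<^sub>k = b\<^sub>k - b\<^sub>k\<^sub>+\<^sub>1 \<alpha>\<close> lies outside \<open>P\<close> for some \<open>k\<close>.\<close>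

lemma valuation_ring_dichotomy: "\<alpha> \<noteq> 0 \<Longrightarrow> \<alpha> \<in> B.local_ring \<or> inverse \<alpha> \<in> B.local_ring"
proof -
  assume \<alpha>: "\<alpha> \<noteq> 0"
  obtain c0 l0 where c0: "l0 \<le> N" "c0 l0 \<noteq> 0" "(\<Sum>l\<le>N. j (c0 l) * \<alpha> ^ l) = 0" using relation by blast
  obtain q k where q: "\<And>l. l \<le> N \<Longrightarrow> q * c0 l \<in> A" "k \<le> N" "q * c0 k \<in> A - p"
    using A.primitive_multiple[of l0 N c0] c0 by blast
  define c where "c l = j (q * c0 l)" for l
  have c: "c l \<in> j ` A" if "l \<le> N" for l using q(1)[OF that] by (simp add: c_def)
  have root: "(\<Sum>l\<le>N. c l * \<alpha> ^ l) = 0"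
    using c0(3) by (simp add: c_def hom mult.assoc flip: sum_distrib_left)
  define b where "b i = (\<Sum>l=i..N. c l * \<alpha> ^ (l - i))" for i
  have b: "b i \<in> B" "b i * \<alpha> \<in> B" if "i \<le> N" for i
    using integral_truncation[OF subring_jA c root N that, of 0]
      integral_truncation[OF subring_jA c root N that, of 1] by (simp_all add: b_def)
  have ck: "c k \<in> B - P" using j_compl[OF q(3)] by (simp add: c_def)
  have *: "\<alpha> \<in> B.local_ring" if "b k \<notin> P"
    using B.local_ringI[of "b k * \<alpha>" "b k"] b[OF q(2)] that B.compl_nonzero[of "b k"] by simp
  show ?thesis
  proof (cases "k = N")
    case True
    then have "b k = c k" by (simp add: b_def)
    with ck * show ?thesis by simp
  next
    case False
    then have Suc: "Suc k \<le> N" using q(2) by simp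
    have "b k = c k + (\<Sum>l=Suc k..N. c l * \<alpha> ^ (l - k))"
      unfolding b_def using q(2) by (simp add: sum.atLeast_Suc_atMost)
    also have "(\<Sum>l=Suc k..N. c l * \<alpha> ^ (l - k)) = b (Suc k) * \<alpha>"
      unfolding b_def sum_distrib_right
    proof (rule sum.cong[OF refl])
      fix l assume "l \<in> {Suc k..N}"
      then have "l - k = Suc (l - Suc k)" by auto
      then show "c l * \<alpha> ^ (l - k) = c l * \<alpha> ^ (l - Suc k) * \<alpha>" by simp
    qed
    finally have split: "c k = b k + - (b (Suc k) * \<alpha>)" by simp
    show ?thesis
    proof (cases "b k \<in> P")
      case True
      have "b (Suc k) * \<alpha> \<notin> P"
      proof
        assume "b (Suc k) * \<alpha> \<in> P"
        then have "c k \<in> P" unfolding split by (intro B.P_closed(2)[OF True] B.P_uminus)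
        with ck show False by simp
      qed
      then have "b (Suc k) / (b (Suc k) * \<alpha>) \<in> B.local_ring"
        using B.local_ringI[of "b (Suc k)" "b (Suc k) * \<alpha>"] b[OF Suc] by simp
      moreover have "b (Suc k) \<noteq> 0" using \<open>b (Suc k) * \<alpha> \<notin> P\<close> B.P_closed(1) by auto
      ultimately show ?thesis using \<alpha> by (simp add: field_simps)
    qed (use * in simp)
  qed
qed

lemma trichotomy:
  assumes "x \<noteq> 0"
  obtains "x \<in> B.units" | "x \<in> B.local_max" | "inverse x \<in> B.local_max"
  using valuation_ring_dichotomy[OF assms] B.local_ring_cases B.units_inverse by (metis inverse_inverse_eq)

text \<open>By the dichotomy, divisibility in the local ring is a total preorder.\<close>

lemma minimal_term:
  assumes "finite I" "I \<noteq> {}" "\<And>i. i \<in> I \<Longrightarrow> y i \<noteq> 0"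
  shows "\<exists>i0\<in>I. \<forall>i\<in>I. y i / y i0 \<in> B.local_ring"
  using assms
proof (induction I rule: finite_ne_induct)
  case (singleton i)
  then show ?case using B.units_one B.local_ring_cases by simp
next
  case (insert i I)
  then obtain i0 where i0: "i0 \<in> I" "\<And>i. i \<in> I \<Longrightarrow> y i / y i0 \<in> B.local_ring" by auto
  have nz: "y i \<noteq> 0" "y i0 \<noteq> 0" using insert i0 by auto
  have one: "y k / y k \<in> B.local_ring" if "y k \<noteq> 0" for k
    using that B.units_one B.local_ring_cases by simp
  show ?case
  proof (cases "y i / y i0 \<in> B.local_ring")
    case True
    then show ?thesis using i0 by blast
  next
    case False
    then have "y i0 / y i \<in> B.local_ring"
      using valuation_ring_dichotomy[of "y i / y i0"] nz by simp
    then have "y k / y i \<in> B.local_ring" if "k \<in> I" for k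
      using B.local_ring_mult[OF i0(2)[OF that], of "y i0 / y i"] nz by simp
    then show ?thesis using one[OF nz(1)] by blast
  qed
qed

text \<open>Two terms of a linear relation between \<open>1, x, \<dots>, x\<^sup>N\<close> have the same value.\<close>

lemma power_commensurable:
  assumes x: "x \<noteq> 0"
  shows "\<exists>k i. 0 < k \<and> k \<le> N \<and> x ^ k * j \<pi> powi i \<in> B.units"
proof -
  obtain c l0 where c: "l0 \<le> N" "c l0 \<noteq> 0" "(\<Sum>l\<le>N. j (c l) * x ^ l) = 0" using relation by blast
  define I where "I = {l. l \<le> N \<and> c l \<noteq> 0}"
  define y where "y l = j (c l) * x ^ l" for l
  have fin: "finite I" unfolding I_def by (rule finite_subset[of _ "{..N}"]) auto
  have ne: "I \<noteq> {}" using c by (auto simp: I_def)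
  have y: "y l \<noteq> 0" if "l \<in> I" for l using x that by (auto simp: I_def y_def)
  have "\<exists>i0\<in>I. \<forall>i\<in>I. y i / y i0 \<in> B.local_ring" by (rule minimal_term[OF fin ne y])
  then obtain m where m: "m \<in> I" "\<And>l. l \<in> I \<Longrightarrow> y l / y m \<in> B.local_ring" by blast
  have "(\<Sum>l\<in>I. y l) = (\<Sum>l\<le>N. y l)"
  proof (rule sum.mono_neutral_left)
    show "\<forall>l\<in>{..N} - I. y l = 0" by (simp add: I_def y_def)
    show "I \<subseteq> {..N}" unfolding I_def by blast
  qed simp
  then have "(\<Sum>l\<in>I. y l / y m) = 0" using c(3) by (simp add: y_def flip: sum_divide_distrib)
  then have sum: "1 + (\<Sum>l\<in>I - {m}. y l / y m) = 0"
    using sum.remove[OF fin m(1), of "\<lambda>l. y l / y m"] y[OF m(1)] by simp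
  \<comment> \<open>The ratios of the other terms to the minimal one add up to -1, so they cannot
    all lie in the maximal ideal.\<close>
  have "\<exists>l\<in>I - {m}. y l / y m \<in> B.units"
  proof (rule ccontr)
    assume "\<not> ?thesis"
    then have max: "y l / y m \<in> B.local_max" if "l \<in> I - {m}" for l
      using m(2)[of l] that B.local_ring_cases by blast
    have zero: "0 \<in> B.local_max" using B.local_maxI[OF B.P_closed(1) B.compl_one] by simp
    have "(\<Sum>l\<in>S. y l / y m) \<in> B.local_max" if "S \<subseteq> I - {m}" for S
      using that by (induction S rule: infinite_finite_induct) (auto intro: zero B.local_max_add max)
    then have "(\<Sum>l\<in>I - {m}. y l / y m) \<in> B.local_max" by blast
    then have "- 1 \<in> B.local_max" using sum by (metis add_eq_0_iff)
    then have "(- 1) * (- 1) \<in> B.local_max"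
      by (rule B.local_max_mult) (use \<open>- 1 \<in> B.local_max\<close> B.local_ring_cases in blast)
    then show False using B.units_one B.units_not_max by simp
  qed
  then obtain l where l: "l \<in> I" "l \<noteq> m" "y l / y m \<in> B.units" by blast
  \<comment> \<open>If c_a x^a and c_b x^b have the same value, x^(b-a) is up to a unit c_a / c_b,
    hence up to a unit a power of \<pi>.\<close>
  have *: "\<exists>k i. 0 < k \<and> k \<le> N \<and> x ^ k * j \<pi> powi i \<in> B.units"
    if ab: "a \<in> I" "b \<in> I" "a < b" "y b / y a \<in> B.units" for a b
  proof -
    have cab: "c a \<noteq> 0" "c b \<noteq> 0" "b \<le> N" using ab by (auto simp: I_def)
    then obtain u where u: "u \<in> A.units" "c b / c a = \<pi> powi A.val (c b / c a) * u"
      using A.val_decomp[of "c b / c a"] by auto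
    let ?i = "A.val (c b / c a)"
    have ju: "j u \<noteq> 0" using A.units_nonzero[OF u(1)] by simp
    have "x ^ b = x ^ (b - a) * x ^ a" using ab(3) by (simp flip: power_add)
    then have "y b / y a = j (c b / c a) * x ^ (b - a)"
      using x cab by (simp add: y_def hom_divide)
    also have "j (c b / c a) = j \<pi> powi ?i * j u" by (subst u(2)) (simp only: hom(2) hom_power_int)
    finally have "x ^ (b - a) * j \<pi> powi ?i = y b / y a / j u" using ju by simp
    then have "x ^ (b - a) * j \<pi> powi ?i \<in> B.units" using B.units_divide[OF ab(4) j_units[OF u(1)]] by simp
    then show ?thesis using ab(3) cab(3) by (intro exI[of _ "b - a"] exI[of _ ?i]) auto
  qed
  show ?thesis
  proof (cases "m < l")
    case True
    then show ?thesis using *[OF m(1) l(1) _ l(3)] by simp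
  next
    case False
    have "y m / y l \<in> B.units" using B.units_inverse[OF l(3)] by simp
    then show ?thesis using *[OF l(1) m(1)] False l(2) by simp
  qed
qed

text \<open>The exponent \<open>N!\<close> works for all \<open>x\<close> at once: some \<open>x\<^sup>k\<close> with \<open>0 < k \<le> N\<close> has the value of a power of \<open>\<pi>\<close>.\<close>

definition \<nu> :: "'l \<Rightarrow> int" where
  "\<nu> x = (THE m. x ^ fact N / j \<pi> powi m \<in> B.units)"

lemma \<nu>_eq:
  assumes "x ^ fact N / j \<pi> powi m \<in> B.units"
  shows "\<nu> x = m"
  unfolding \<nu>_def
proof (rule the_equality, rule assms)
  fix m' assume "x ^ fact N / j \<pi> powi m' \<in> B.units"
  from B.units_divide[OF assms this] have u: "(x ^ fact N / j \<pi> powi m) / (x ^ fact N / j \<pi> powi m') \<in> B.units" .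
  have "x ^ fact N \<noteq> 0" using B.units_nonzero[OF assms] by auto
  then have "(x ^ fact N / j \<pi> powi m) / (x ^ fact N / j \<pi> powi m') = j \<pi> powi (m' - m)"
    using j\<pi>(2) by (simp add: power_int_diff)
  with u have "j \<pi> powi (m' - m) \<in> B.units" by simp
  from B.powi_unit[OF j\<pi>(1) this] show "m' = m" by simp
qed

lemma \<nu>_spec:
  assumes x: "x \<noteq> 0"
  shows "x ^ fact N / j \<pi> powi \<nu> x \<in> B.units"
proof -
  obtain k i where ki: "0 < k" "k \<le> N" "x ^ k * j \<pi> powi i \<in> B.units" using power_commensurable[OF x] by blast
  obtain q where q: "fact N = k * q" using dvd_fact[of k N] ki by (auto simp: dvd_def)
  have "(x ^ k * j \<pi> powi i) ^ q = x ^ fact N / j \<pi> powi (- (i * int q))"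
    using j\<pi>(2) by (simp add: q power_mult_distrib power_mult power_int_minus power_int_mult divide_inverse)
  then have "x ^ fact N / j \<pi> powi (- (i * int q)) \<in> B.units" using B.units_power[OF ki(3), of q] by simp
  with \<nu>_eq[OF this] show ?thesis by simp
qed

lemma \<nu>_mult: "x \<noteq> 0 \<Longrightarrow> y \<noteq> 0 \<Longrightarrow> \<nu> (x * y) = \<nu> x + \<nu> y"
  using B.units_mult[OF \<nu>_spec[of x] \<nu>_spec[of y]] j\<pi>(2)
  by (intro \<nu>_eq) (simp add: power_mult_distrib power_int_add)

lemma \<nu>_units: "u \<in> B.units \<Longrightarrow> \<nu> u = 0"
  by (rule \<nu>_eq) (simp add: B.units_power)

text \<open>Otherwise x^(N!) times a nonnegative power of \<pi> would be a unit and also lie in the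
  maximal ideal.\<close>

lemma \<nu>_max:
  assumes x: "x \<noteq> 0" "x \<in> B.local_max"
  shows "\<nu> x > 0"
proof (rule ccontr)
  assume "\<not> \<nu> x > 0"
  then have "j \<pi> powi \<nu> x = inverse (j \<pi> ^ nat (- \<nu> x))"
    by (cases "\<nu> x = 0") (simp_all add: power_int_def power_inverse)
  then have "x ^ fact N * j \<pi> ^ nat (- \<nu> x) \<in> B.units" using \<nu>_spec[OF x(1)] by (simp add: divide_inverse)
  moreover have loc: "x \<in> B.local_ring" using x B.local_ring_cases by blast
  have pow: "y ^ n \<in> B.local_ring" if "y \<in> B.local_ring" for y n
  proof (induction n)
    case 0
    show ?case using B.units_one B.local_ring_cases by simp
  next
    case (Suc n)
    show ?case using B.local_ring_mult[OF that Suc] by simp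
  qed
  have "x ^ fact N = x * x ^ (fact N - 1)" by (simp flip: power_Suc)
  then have "x ^ fact N \<in> B.local_max" using B.local_max_mult[OF x(2) pow[OF loc]] by metis
  moreover have "j \<pi> \<in> B.local_ring" using B.local_ringI[OF B.P_subset[OF j\<pi>(1)] B.compl_one] by simp
  ultimately have "x ^ fact N * j \<pi> ^ nat (- \<nu> x) \<in> B.local_max \<inter> B.units"
    using B.local_max_mult pow by blast
  then show False using B.units_not_max by blast
qed

lemma \<nu>_inverse: "x \<noteq> 0 \<Longrightarrow> \<nu> (inverse x) = - \<nu> x"
  using \<nu>_mult[of x "inverse x"] \<nu>_units[OF B.units_one] by simp

lemma \<nu>_power: "x \<noteq> 0 \<Longrightarrow> \<nu> (x ^ n) = int n * \<nu> x"
  by (induction n) (auto simp: \<nu>_mult \<nu>_units[OF B.units_one] algebra_simps)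

text \<open>A uniformizer is a nonzero element of \<open>P\<close> with least \<nu>. Dividing
  \<nu>(a) by \<nu>(t) with remainder leaves y = a / t^n with 0 \<le> \<nu>(y) < \<nu>(t), so
  neither y nor its inverse is in the maximal ideal.\<close>

lemma dvr_extension: "\<exists>t. dvr_prime B P t"
proof -
  obtain t where t: "t \<in> P" "t \<noteq> 0" and min: "\<And>x. x \<in> P \<Longrightarrow> x \<noteq> 0 \<Longrightarrow> nat (\<nu> t) \<le> nat (\<nu> x)"
    using ex_has_least_nat[of "\<lambda>x. x \<in> P \<and> x \<noteq> 0" "j \<pi>" "\<lambda>x. nat (\<nu> x)"] j\<pi> by blast
  have P_max: "x \<in> B.local_max" if "x \<in> P" for x using B.local_max_iff[OF B.P_subset] that by blast
  have t_pos: "\<nu> t > 0" by (rule \<nu>_max[OF t(2) P_max[OF t(1)]])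
  have t_min: "\<nu> t \<le> \<nu> x" if x: "x \<in> B.local_max" "x \<noteq> 0" for x
  proof -
    obtain a b where ab: "a \<in> P" "b \<in> B - P" "x = a / b" using x unfolding B.local_max_def by blast
    have b: "b \<noteq> 0" by (rule B.compl_nonzero[OF ab(2)])
    with x ab have a: "a \<noteq> 0" "x * b = a" by auto
    then have "\<nu> a = \<nu> x" using \<nu>_mult[OF x(2) b] \<nu>_units[OF B.compl_units[OF ab(2)]] by simp
    then show ?thesis using min[OF ab(1) a(1)] t_pos \<nu>_max[OF x(2,1)] by simp
  qed
  have "dvr_prime B P t"
  proof (intro dvr_prime.intro B.prime_of_subring_axioms dvr_prime_axioms.intro t)
    fix x
    have frac: "\<exists>a\<in>B. \<exists>b\<in>B. b \<noteq> 0 \<and> y = a / b" if "y \<in> B.local_ring" for y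
      using that B.compl_nonzero unfolding B.local_ring_def by blast
    show "\<exists>a\<in>B. \<exists>b\<in>B. b \<noteq> 0 \<and> x = a / b"
    proof (cases "x \<in> B.local_ring")
      case False
      have "0 \<in> B.local_ring" using B.local_ringI[OF B.D_closed(1) B.compl_one] by simp
      with False have x: "x \<noteq> 0" by auto
      then obtain a b where ab: "a \<in> B" "b \<in> B" "b \<noteq> 0" "inverse x = a / b"
        using valuation_ring_dichotomy[OF x] False frac by blast
      then have "a \<noteq> 0" "x = b / a" using x by (auto simp: field_simps)
      with ab show ?thesis by blast
    qed (use frac in blast)
  next
    fix a assume a: "a \<in> B" "a \<noteq> 0"
    have "a \<in> B.local_ring" using B.local_ringI[OF a(1) B.compl_one] by simp
    then have nonneg: "\<nu> a \<ge> 0" using B.local_ring_cases \<nu>_units \<nu>_max[OF a(2)] by force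
    define n where "n = nat (\<nu> a div \<nu> t)"
    define y where "y = a / t ^ n"
    have y: "y \<noteq> 0" "a = t ^ n * y" using a t by (auto simp: y_def)
    have "\<nu> a = int n * \<nu> t + \<nu> y" using y t \<nu>_mult[of "t ^ n" y] \<nu>_power[of t n] by simp
    moreover have "int n = \<nu> a div \<nu> t" using nonneg t_pos by (simp add: n_def pos_imp_zdiv_nonneg_iff)
    ultimately have "\<nu> y = \<nu> a mod \<nu> t" by (simp add: minus_div_mult_eq_mod[symmetric])
    then have r: "0 \<le> \<nu> y" "\<nu> y < \<nu> t" using t_pos by simp_all
    have "y \<in> B.units"
      using y(1)
    proof (cases rule: trichotomy)
      case 2
      then show ?thesis using t_min[OF 2 y(1)] r by simp
    next
      case 3
      then show ?thesis using \<nu>_max[OF _ 3] \<nu>_inverse[OF y(1)] y(1) r by simp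
    qed
    with y(2) show "\<exists>n. \<exists>u\<in>B.units. a = t ^ n * u" by blast
  qed
  then show ?thesis ..
qed

text \<open>Since \<pi> generates p locally, the ideal generated by p lies in P^n exactly if \<pi>
  does. So the ramification index is the value of \<pi>, and w / w(\<pi>) extends the valuation of
  \<open>A\<close>.\<close>

lemma extension_values:
  assumes t: "dvr_prime B P t"
  defines "w \<equiv> dvr_prime.val B P t"
  shows "\<And>x. x \<noteq> 0 \<Longrightarrow> w (j x) = w (j \<pi>) * A.val x" "w (j \<pi>) > 0"
    "int (ramification_index p j B P) = w (j \<pi>)"
    "\<And>x. x \<noteq> 0 \<Longrightarrow> prime_val B P x = ereal (real_of_int (w x))"
    "discrete_valuation w" "\<And>x. x \<in> B \<Longrightarrow> x \<noteq> 0 \<Longrightarrow> w x \<ge> 0"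
proof -
  interpret C: dvr_prime B P t by (rule t)
  interpret W: discrete_val w unfolding w_def by (rule discrete_val.intro[OF C.discrete_val_val])
  show "discrete_valuation w" by (rule W.disc)
  show "prime_val B P x = ereal (real_of_int (w x))" if "x \<noteq> 0" for x
    unfolding w_def by (rule C.prime_val_eq[OF max_B that])
  show "w x \<ge> 0" if "x \<in> B" "x \<noteq> 0" for x
    unfolding w_def by (rule C.val_nonneg_D[OF that])
  show pos: "w (j \<pi>) > 0"
    unfolding w_def using C.val_pos_iff[OF B.P_subset[OF j\<pi>(1)] j\<pi>(2)] j\<pi>(1) by simp
  have power: "w (x ^ n) = int n * w x" if "x \<noteq> 0" for x n
    using that by (induction n) (auto simp: W.val_1 W.val_mult algebra_simps)
  have powi: "w (x powi k) = k * w x" if "x \<noteq> 0" for x k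
  proof (cases "k \<ge> 0")
    case False
    have "w (inverse x) = - w x" using W.val_mult[of x "inverse x"] W.val_1 that by simp
    then show ?thesis using False that by (simp add: power_int_def power)
  qed (use that in \<open>simp add: power_int_def power\<close>)
  show val: "w (j x) = w (j \<pi>) * A.val x" if x: "x \<noteq> 0" for x
  proof -
    obtain u where u: "u \<in> A.units" "x = \<pi> powi A.val x * u" using A.val_decomp[OF x] by blast
    have "w (j u) = 0" unfolding w_def by (rule C.val_units[OF j_units[OF u(1)]])
    moreover have "j x = j \<pi> powi A.val x * j u" by (subst u(2)) (simp only: hom(2) hom_power_int)
    ultimately show ?thesis
      using W.val_mult[of "j \<pi> powi A.val x" "j u"] A.units_nonzero[OF u(1)] j\<pi>(2) by (simp add: powi)
  qed
  have iff: "x \<in> ideal_power B P n \<longleftrightarrow> x \<in> B \<and> (x = 0 \<or> int n \<le> w x)" for x n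
    unfolding w_def by (rule C.ideal_power_iff[OF max_B])
  have "genideal (ring_on B) (j ` p) \<subseteq> ideal_power B P n \<longleftrightarrow> int n \<le> w (j \<pi>)" for n
  proof
    have "j ` p \<subseteq> B" using j_in_B A.P_subset by blast
    then have "j ` p \<subseteq> genideal (ring_on B) (j ` p)"
      by (intro ring.genideal_self cring.axioms(1)[OF B.cring_D]) simp
    moreover assume "genideal (ring_on B) (j ` p) \<subseteq> ideal_power B P n"
    ultimately have "j \<pi> \<in> ideal_power B P n" using A.t(1) by blast
    then show "int n \<le> w (j \<pi>)" using iff j\<pi>(2) by blast
  next
    assume n: "int n \<le> w (j \<pi>)"
    have "j a \<in> ideal_power B P n" if a: "a \<in> p" for a
    proof (cases "a = 0")
      case False
      then have "A.val a \<ge> 1" using A.val_pos_iff[OF A.P_subset[OF a]] a by simp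
      then have "w (j \<pi>) * 1 \<le> w (j \<pi>) * A.val a" using pos by (intro mult_left_mono) auto
      then show ?thesis using n val[OF False] iff j_in_B[OF A.P_subset[OF a]] by simp
    qed (use iff B.D_closed(1) in simp)
    then show "genideal (ring_on B) (j ` p) \<subseteq> ideal_power B P n"
      by (intro ring.genideal_minimal cring.axioms(1)[OF B.cring_D] B.ideal_ideal_power) blast
  qed
  then have "ramification_index p j B P = nat (w (j \<pi>))"
    unfolding ramification_index_def using pos by (intro Greatest_equality) auto
  then show "int (ramification_index p j B P) = w (j \<pi>)" using pos by simp
qed

end

section \<open>The bound at a prime over p\<close>

section \<open>Quotients evaluated at the root\<close>

lemma quotient_at_prime:
  fixes A p :: "'k::field set"
    and f :: "'k poly"
    and j :: "'k \<Rightarrow> 'l::field"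
    and \<theta> :: 'l
    and \<iota> :: "'k \<Rightarrow> 'c::field"
    and T :: "('c, 'w::field) type_data"
    and y H :: real
  assumes ded: "dedekind_domain A"
    and f: "f \<in> poly_over A" "monic f"
    and emb: "field_embedding j" and root: "poly (map_poly j f) \<theta> = 0" and gen: "generated_by_root j \<theta>"
    and p: "primeideal p (ring_on A)" "p \<noteq> {0}"
    and \<pi>: "\<pi> \<in> A" "generates_local_maxideal A p \<pi>"
    and compl: "is_completion A p \<iota> (t_val T)"
    and r: "r \<ge> 1" and type: "is_type T (r - 1)" and repr: "representative T (r - 1) (t_phi T r)"
    and phi: "\<forall>i\<in>{1..r}. t_phi T i = map_poly \<iota> (\<phi> i)"
    and y: "(real s, y) \<in> NP_neg T r (map_poly \<iota> f)"
    and H: "H = (y - real s * real_of_int (phi_val T r)) / real (\<Prod>i<r. ram T i)"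
    and P: "P \<in> primes_over A p j (integral_closure (j ` A))"
  defines "B \<equiv> integral_closure (j ` A)"
  defines "\<beta> \<equiv> poly (map_poly j (phi_quotient (\<phi> r) f s)) \<theta>"
  shows "ereal H \<le> w_val p j B P \<beta>" "0 \<le> prime_val B P (\<beta> / j \<pi> powi \<lfloor>H\<rfloor>)"
proof -
  have emb': "field_embedding \<iota>" using compl by (simp add: is_completion_def)
  interpret \<iota>: embedding \<iota> by (rule embedding.intro[OF emb'])
  have frac: "\<exists>a\<in>A. \<exists>b\<in>A. b \<noteq> 0 \<and> x = a / b" for x
    using ded by (auto simp: dedekind_domain_def)
  have noeth: "noetherian_domain (ring_on A)" and max: "maximalideal p (ring_on A)"
    using ded p by (auto simp: dedekind_domain_def)
  interpret A: dvr_prime A p \<pi> by (rule dedekind_dvr[OF noeth p frac \<pi>])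
  have max_A: "\<exists>b\<in>A. 1 - s * b \<in> p" if "s \<in> A - p" for s
    by (rule maximal_inverse[OF max A.cring_D that])
  have val: "t_val T (\<iota> x) = A.val x" if "x \<noteq> 0" for x
  proof -
    have "ereal (real_of_int (t_val T (\<iota> x))) = prime_val A p x"
      using compl that by (simp add: is_completion_def)
    also have "\<dots> = ereal (real_of_int (A.val x))" by (rule A.prime_val_eq[OF max_A that])
    finally show ?thesis by simp
  qed
  have f0: "f \<noteq> 0" using f(2) by (auto simp: monic_def)
  obtain N where N: "N > 0" "\<And>x. \<exists>c. (\<exists>l\<le>N. c l \<noteq> 0) \<and> (\<Sum>l\<le>N. j (c l) * x ^ l) = 0"
    using algebraic_relation[OF emb gen f0 root] by blast
  have P': "primeideal P (ring_on (integral_closure (j ` A)))" "{a \<in> A. j a \<in> P} = p"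
    using P by (simp_all add: primes_over_def)
  interpret X: prime_extension j A p \<pi> P N
    by (intro prime_extension.intro prime_extension_axioms.intro embedding.intro emb A.dvr_prime_axioms
        prime_of_subring.intro P' max_A N)
  obtain t where t: "dvr_prime B P t" using X.dvr_extension by (auto simp: B_def)
  define w where "w = dvr_prime.val B P t"
  note w = X.extension_values[OF t[unfolded B_def], folded B_def, folded w_def]
  define e where "e = real_of_int (w (j \<pi>))"
  have e: "e > 0" using w(2) by (simp add: e_def)
  \<comment> \<open>w_P as a real-valued function; its value at 0 is junk, hence the use of
    \<open>vge\<close>.\<close>
  define W where "W x = real_of_int (w x) / e" for x
  interpret w: discrete_val w by (rule discrete_val.intro[OF w(5)])
  have vge_W: "vge W x z \<longleftrightarrow> vge w.rv x (z * e)" for x z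
    using e by (simp add: vge_def W_def field_simps)
  have quasi: "quasi_val W"
    using w.quasi_rv unfolding quasi_val_def vge_W by (simp add: distrib_right)
  have W_mult: "W (x * y) = W x + W y" if "x \<noteq> 0" "y \<noteq> 0" for x y
    using w.val_mult[OF that] by (simp add: W_def add_divide_distrib)
  have W_j: "vge W (j x) z \<longleftrightarrow> vge (\<lambda>x. real_of_int (t_val T (\<iota> x))) x z" for x z
    using w(1)[of x] val[of x] e by (cases "x = 0") (auto simp: vge_def W_def e_def field_simps)
  have "\<theta> \<in> B"
  proof -
    have 0: "0 \<in> A" "0 \<in> j ` A" using A.D_closed(1) X.hom_0 by (auto intro: image_eqI[of _ _ 0])
    have "X.jp f \<in> poly_over (j ` A)"
      using f(1) by (simp add: poly_over_iff[OF 0(1)] poly_over_iff[OF 0(2)])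
    moreover have "monic (X.jp f)" using f(2) X.hom(3) by (simp add: monic_def)
    ultimately show ?thesis using root unfolding B_def integral_closure_def by blast
  qed
  then have W_\<theta>: "vge W \<theta> 0" using w(6)[of \<theta>] e by (cases "\<theta> = 0") (auto simp: vge_def W_def)
  have "discrete_valuation A.val" by (rule A.discrete_val_val)
  then have disc: "discrete_valuation (\<lambda>x. t_val T (\<iota> x))"
    unfolding discrete_valuation_def by (simp add: val cong: conj_cong)
  interpret G: discrete_val "\<lambda>x. t_val T (\<iota> x)" by (rule discrete_val.intro[OF disc])
  define ev where "ev g = poly (X.jp g) \<theta>" for g
  interpret ev: evaluation ev W
    by unfold_locales (simp_all add: ev_def X.jp_add X.jp_mult X.hom(3) quasi W_mult)
  interpret type_over \<iota> ev W T \<phi> r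
  proof (unfold_locales; (fact r type repr disc)?)
    show "t_phi T i = map_poly \<iota> (\<phi> i)" if "1 \<le> i" "i \<le> r" for i using phi that by simp
    \<comment> \<open>Coefficients keep their values under \<open>j\<close> by \<open>W_j\<close>,
      and \<theta> is integral, so its powers lose nothing.\<close>
    show "vge W (ev a) x" if "vge G.gauss a x" for a x
      unfolding ev_def poly_altdef
    proof (rule quasi_val_sum[OF quasi])
      fix n
      have "vge W (j (Polynomial.coeff a n)) x" using that unfolding G.vge_gauss W_j by blast
      from quasi_val_mult[OF quasi this ev.vge_W_power[OF W_\<theta>, of n]]
      show "vge W (Polynomial.coeff (X.jp a) n * \<theta> ^ n) x" by simp
    qed
  qed
  have main: "vge W \<beta> H"
    using quotient_value[OF _ f0 y] root by (simp add: ev_def \<beta>_def H E_def)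
  have "real_of_int (int (ramification_index p j B P)) = e" by (simp only: w(3) e_def)
  then have ram_e: "real (ramification_index p j B P) = e" by simp
  have wval: "w_val p j B P x = ereal (W x)" if "x \<noteq> 0" for x
  proof -
    show ?thesis using w(4)[OF that] e by (simp add: w_val_def W_def ram_e)
  qed
  show "ereal H \<le> w_val p j B P \<beta>"
  proof (cases "\<beta> = 0")
    case True
    \<comment> \<open>The value at 0 is infinite and stays so after division by the ramification
      index.\<close>
    show ?thesis using True e by (simp add: w_val_def prime_val_def ram_e)
  next
    case False
    then show ?thesis using main by (simp add: wval vge_def)
  qed
  show "0 \<le> prime_val B P (\<beta> / j \<pi> powi \<lfloor>H\<rfloor>)"
  proof (cases "\<beta> = 0")
    case False
    let ?q = "j \<pi> powi \<lfloor>H\<rfloor>"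
    have \<pi>0: "\<pi> powi \<lfloor>H\<rfloor> \<noteq> 0" "?q \<noteq> 0" using A.t(2) by simp_all
    have "A.val (\<pi> powi \<lfloor>H\<rfloor>) = \<lfloor>H\<rfloor>" by (rule A.val_eq[OF A.units_one]) simp
    \<comment> \<open>The divisor has value e \<lfloor>H\<rfloor> \<le> e H, also for negative
      H.\<close>
    then have q: "w ?q = w (j \<pi>) * \<lfloor>H\<rfloor>" using w(1)[OF \<pi>0(1)] by (simp add: X.hom_power_int)
    have "w \<beta> = w (\<beta> / ?q) + w ?q" using w.val_mult[of "\<beta> / ?q" ?q] False \<pi>0(2) by simp
    moreover have "real_of_int (w ?q) \<le> real_of_int (w \<beta>)"
    proof -
      have "real_of_int (w ?q) = e * real_of_int \<lfloor>H\<rfloor>" by (simp add: q e_def)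
      also have "\<dots> \<le> e * H" using e by simp
      also have "\<dots> \<le> real_of_int (w \<beta>)" using main False e by (simp add: vge_def W_def field_simps)
      finally show ?thesis .
    qed
    ultimately show ?thesis using w(4)[of "\<beta> / ?q"] False \<pi>0(2) by simp
  qed (simp add: prime_val_def)
qed

theorem theorem3p3:
  fixes A p :: "'k::field set"
    and f :: "'k poly"
    and \<pi> :: 'k
    and j :: "'k \<Rightarrow> 'l::field"
    and \<theta> :: 'l
    and B :: "'l set"
    and \<iota> :: "'k \<Rightarrow> 'c::field"
    and T :: "('c, 'w::field) type_data"
    and \<phi> :: "nat \<Rightarrow> 'k poly"
    and r s :: nat
    and y H :: real
  assumes "global_field TYPE('k)" and "dedekind_domain A"
    and "f \<in> poly_over A" and "monic f" and "irreducible_in A f" and "coprime f (pderiv f)"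
    and "Polynomial.degree f > 1"
    and "field_embedding j" and "poly (map_poly j f) \<theta> = 0" and "generated_by_root j \<theta>"
    and "B = integral_closure (j ` A)"
    and "primeideal p (ring_on A)" and "p \<noteq> {0}"
    and "\<pi> \<in> A" and "generates_local_maxideal A p \<pi>"
    and "is_completion A p \<iota> (t_val T)" and "t_unif T = \<iota> \<pi>"
    and "r \<ge> 1" and "is_type T (r - 1)" and "representative T (r - 1) (t_phi T r)"
    and "type_dvd T (r - 1) (map_poly \<iota> f)"
    and "\<forall>i\<in>{1..r}. \<phi> i \<in> poly_over A \<and> t_phi T i = map_poly \<iota> (\<phi> i)"
    and "1 \<le> s" and "real s \<le> polygon_length (NP_neg T r (map_poly \<iota> f))"
    and "(real s, y) \<in> NP_neg T r (map_poly \<iota> f)"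
    and "H = (y - real s * real_of_int (phi_val T r)) / real (\<Prod>i<r. ram T i)"
  shows "(\<forall>P\<in>primes_over A p j B.
            ereal H \<le> w_val p j B P (poly (map_poly j (phi_quotient (\<phi> r) f s)) \<theta>)) \<and>
         p_integral A p j B
           (poly (map_poly j (phi_quotient (\<phi> r) f s)) \<theta> / j \<pi> powi \<lfloor>H\<rfloor>)"
proof -
  note * = quotient_at_prime[OF assms(2,3,4,8,9,10,12,13,14,15,16,18,19,20) _ assms(25,26)]
  have phi: "\<forall>i\<in>{1..r}. t_phi T i = map_poly \<iota> (\<phi> i)" using assms(22) by blast
  show ?thesis
    unfolding p_integral_def assms(11) using *[OF phi] by blast
qed

end
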